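(* Let $E=\mathbb{C}^d$. The total Grassmannian $\mathrm{Gr}(E)$ has Krull dimension $\binom{d+1}{2}$.
   Context: For $0\le r\le d$ let $\mathrm{Gr}_r(E)$ be the scheme parametrizing rank $r$ quotients of $E$. The total Grassmannian $\mathrm{Gr}(E)$ is the following topological space. As a set it is the disjoint union of the underlying topological spaces $|\mathrm{Gr}_r(E)|$ (including non-closed points), $0\le r\le d$. A subset $Z\subset \mathrm{Gr}(E)$ is closed if each $Z_r=Z\cap\mathrm{Gr}_r(E)$ is Zariski closed and $Z$ is downwards closed: for all $r\le s$, $Z_s^{(r)}\subset Z_r$, where $Z_s^{(r)}=\pi_r(\pi_s^{-1}(Z_s))$ and $\pi_s,\pi_r$ are the projections from the partial flag variety $\mathrm{Fl}_{r,s}(E)$ (parametrizing surjections $E\to Q_s\to Q_r$ with $Q_s,Q_r$ of ranks $s,r$) to $\mathrm{Gr}_s(E)$ and $\mathrm{Gr}_r(E)$. In other words, if a quotient $E\to U$ belongs to $Z$ then so does every quotient of $U$. The Krull dimension of a topological space is the supremum of lengths $k$ of strict chains $Z_0\subsetneq\cdots\subsetneq Z_k$ of irreducible closed subsets. *)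

theory Defs
  imports
    "HOL-Analysis.Abstract_Topology"
    "HOL-Library.Extended_Nat"
    "HOL-Library.Poly_Mapping"
    "HOL-Algebra.Ideal"
    "Jordan_Normal_Form.Determinant"
begin

section \<open>Krull dimension of a topological space\<close>

definition irreducible_subset :: "'a topology \<Rightarrow> 'a set \<Rightarrow> bool" where
  "irreducible_subset X S \<longleftrightarrow>
     S \<subseteq> topspace X \<and> S \<noteq> {} \<and>
     (\<forall>A B. closedin X A \<longrightarrow> closedin X B \<longrightarrow> S \<subseteq> A \<union> B \<longrightarrow> S \<subseteq> A \<or> S \<subseteq> B)"

text \<open>The supremum is taken in \<open>enat\<close>, so infinite dimension is possible; the empty space
  (which does not occur below) gets dimension \<open>0\<close>.\<close>

definition krull_dim :: "'a topology \<Rightarrow> enat" where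
  "krull_dim X = Sup {enat k | k. \<exists>Z :: nat \<Rightarrow> 'a set.
     (\<forall>i\<le>k. closedin X (Z i) \<and> irreducible_subset X (Z i)) \<and>
     (\<forall>i<k. Z i \<subset> Z (Suc i))}"


section \<open>The schemes of flags of quotients of \<open>\<complex>\<^sup>d\<close>\<close>

text \<open>
  For a set \<open>R\<close> of ranks, \<open>flag_scheme d R\<close> is the underlying point set of the scheme
  parametrizing flags of quotients of \<open>E = \<complex>\<^sup>d\<close> whose ranks are the elements of \<open>R\<close>.  Thus
  \<open>R = {r}\<close> gives the Grassmannian \<open>Gr\<^sub>r(E)\<close> and \<open>R = {r, s}\<close> gives the partial flag variety
  \<open>Fl\<^sub>r\<^sub>,\<^sub>s(E)\<close> (for \<open>r = s\<close> these coincide, since a surjection between quotients of equal rank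
  is an isomorphism).  It is constructed as the (multi-)Proj of its multihomogeneous coordinate
  ring under the Pluecker embedding into the product over \<open>k \<in> R\<close> of the projective spaces
  with homogeneous coordinates \<open>p\<^sub>I\<close>, where \<open>I\<close> is a \<open>k\<close>-element set of columns.  A point,
  closed or not, is therefore a multihomogeneous prime ideal.

  Column sets are represented by strictly increasing lists; the length of a list is the rank
  to which the coordinate belongs.
\<close>

type_synonym plucker_poly = "(nat list \<Rightarrow>\<^sub>0 nat) \<Rightarrow>\<^sub>0 complex"

definition plucker_index :: "nat \<Rightarrow> nat set \<Rightarrow> nat list set" where
  "plucker_index d R = {I. sorted_wrt (<) I \<and> set I \<subseteq> {..<d} \<and> length I \<in> R}"

definition plucker_ring :: "nat \<Rightarrow> nat set \<Rightarrow> plucker_poly ring" where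
  "plucker_ring d R =
     \<lparr>carrier = {f. \<forall>m \<in> Poly_Mapping.keys f. Poly_Mapping.keys m \<subseteq> plucker_index d R},
      monoid.mult = (*), one = 1, zero = 0, add = (+)\<rparr>"

definition plucker_var :: "nat list \<Rightarrow> plucker_poly" where
  "plucker_var I = Poly_Mapping.single (Poly_Mapping.single I 1) 1"

definition eval_plucker :: "(nat list \<Rightarrow> complex) \<Rightarrow> plucker_poly \<Rightarrow> complex" where
  "eval_plucker x f =
     (\<Sum>m \<in> Poly_Mapping.keys f. Poly_Mapping.lookup f m *
        (\<Prod>I \<in> Poly_Mapping.keys m. x I ^ Poly_Mapping.lookup m I))"

text \<open>The multidegree of a monomial records, for each rank \<open>k\<close>, its degree in the coordinates
  \<open>p\<^sub>I\<close> with \<open>length I = k\<close>.\<close>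

definition multidegree :: "(nat list \<Rightarrow>\<^sub>0 nat) \<Rightarrow> nat \<Rightarrow> nat" where
  "multidegree m k = (\<Sum>I | I \<in> Poly_Mapping.keys m \<and> length I = k. Poly_Mapping.lookup m I)"

definition multihomogeneous :: "plucker_poly \<Rightarrow> bool" where
  "multihomogeneous f \<longleftrightarrow> (\<exists>a. \<forall>m \<in> Poly_Mapping.keys f. multidegree m = a)"

definition component :: "(nat \<Rightarrow> nat) \<Rightarrow> plucker_poly \<Rightarrow> plucker_poly" where
  "component a f =
     (\<Sum>m | m \<in> Poly_Mapping.keys f \<and> multidegree m = a.
        Poly_Mapping.single m (Poly_Mapping.lookup f m))"

text \<open>A rank \<open>k\<close> quotient of \<open>\<complex>\<^sup>d\<close> over \<open>\<complex>\<close> is given by a \<open>k \<times> d\<close> matrix of a surjection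
  \<open>\<complex>\<^sup>d \<rightarrow> \<complex>\<^sup>k\<close>; a flag of such quotients by surjections each of which factors through those of
  larger rank.\<close>

definition quotient_mat :: "nat \<Rightarrow> nat \<Rightarrow> complex mat \<Rightarrow> bool" where
  "quotient_mat d k M \<longleftrightarrow>
     M \<in> carrier_mat k d \<and> (\<forall>y \<in> carrier_vec k. \<exists>x \<in> carrier_vec d. M *\<^sub>v x = y)"

definition quotient_flags :: "nat \<Rightarrow> nat set \<Rightarrow> (nat \<Rightarrow> complex mat) set" where
  "quotient_flags d R =
     {M. (\<forall>k \<in> R. quotient_mat d k (M k)) \<and>
         (\<forall>k \<in> R. \<forall>l \<in> R. k \<le> l \<longrightarrow> (\<exists>A \<in> carrier_mat k l. M k = A * M l))}"

definition plucker_coord :: "(nat \<Rightarrow> complex mat) \<Rightarrow> nat list \<Rightarrow> complex" where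
  "plucker_coord M I = det (mat_of_cols (length I) (map (col (M (length I))) I))"

text \<open>The multihomogeneous ideal of the flag variety.  Vanishing is required of every
  multihomogeneous component separately.  This matters for rank \<open>0\<close>, where the chosen
  representative of the only coordinate \<open>p\<^bsub>[]\<^esub>\<close> is always \<open>1\<close>, so that
  \<open>p\<^bsub>[]\<^esub> - 1\<close> must be kept out of the ideal.\<close>

definition flag_ideal :: "nat \<Rightarrow> nat set \<Rightarrow> plucker_poly set" where
  "flag_ideal d R =
     {f \<in> carrier (plucker_ring d R).
        \<forall>M \<in> quotient_flags d R. \<forall>a. eval_plucker (plucker_coord M) (component a f) = 0}"

text \<open>The last condition discards the primes containing one of the irrelevant ideals.\<close>

definition flag_scheme :: "nat \<Rightarrow> nat set \<Rightarrow> plucker_poly set set" where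
  "flag_scheme d R =
     {P. primeideal P (plucker_ring d R) \<and>
         (\<forall>f \<in> P. \<forall>a. component a f \<in> P) \<and>
         flag_ideal d R \<subseteq> P \<and>
         (\<forall>k \<in> R. \<not> plucker_var ` plucker_index d {k} \<subseteq> P)}"

definition zariski_closed :: "nat \<Rightarrow> nat set \<Rightarrow> plucker_poly set set \<Rightarrow> bool" where
  "zariski_closed d R C \<longleftrightarrow>
     (\<exists>S \<subseteq> carrier (plucker_ring d R).
        (\<forall>f \<in> S. multihomogeneous f) \<and> C = {P \<in> flag_scheme d R. S \<subseteq> P})"

text \<open>On points, the morphism forgetting all quotients in a flag except those with rank in \<open>R\<close> is
  contraction of primes.\<close>

definition forget :: "nat \<Rightarrow> nat set \<Rightarrow> plucker_poly set \<Rightarrow> plucker_poly set" where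
  "forget d R P = P \<inter> carrier (plucker_ring d R)"


section \<open>The total Grassmannian\<close>

abbreviation Gr :: "nat \<Rightarrow> nat \<Rightarrow> plucker_poly set set" where
  "Gr d r \<equiv> flag_scheme d {r}"

abbreviation Fl :: "nat \<Rightarrow> nat \<Rightarrow> nat \<Rightarrow> plucker_poly set set" where
  "Fl d r s \<equiv> flag_scheme d {r, s}"

text \<open>\<open>lower_transfer d r s C\<close> is \<open>C\<^sup>(\<^sup>r\<^sup>) = \<pi>\<^sub>r(\<pi>\<^sub>s\<^sup>-\<^sup>1(C))\<close> for \<open>C \<subseteq> Gr\<^sub>s(E)\<close>.\<close>

definition lower_transfer ::
  "nat \<Rightarrow> nat \<Rightarrow> nat \<Rightarrow> plucker_poly set set \<Rightarrow> plucker_poly set set" where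
  "lower_transfer d r s C = forget d {r} ` {F \<in> Fl d r s. forget d {s} F \<in> C}"

definition total_Gr_points :: "nat \<Rightarrow> (nat \<times> plucker_poly set) set" where
  "total_Gr_points d = (SIGMA r:{..d}. Gr d r)"

definition stratum :: "(nat \<times> plucker_poly set) set \<Rightarrow> nat \<Rightarrow> plucker_poly set set" where
  "stratum Z r = {P. (r, P) \<in> Z}"

definition total_Gr_closed :: "nat \<Rightarrow> (nat \<times> plucker_poly set) set \<Rightarrow> bool" where
  "total_Gr_closed d Z \<longleftrightarrow>
     Z \<subseteq> total_Gr_points d \<and>
     (\<forall>r\<le>d. zariski_closed d {r} (stratum Z r)) \<and>
     (\<forall>s\<le>d. \<forall>r\<le>s. lower_transfer d r s (stratum Z s) \<subseteq> stratum Z r)"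

definition total_Gr :: "nat \<Rightarrow> (nat \<times> plucker_poly set) topology" where
  "total_Gr d =
     topology (\<lambda>U. U \<subseteq> total_Gr_points d \<and> total_Gr_closed d (total_Gr_points d - U))"


subsection \<open>The sets declared closed do form the closed sets of a topology\<close>

lemma multidegree_add: "multidegree (m + n) k = multidegree m k + multidegree n k"
proof -
  let ?K = "Poly_Mapping.keys m \<union> Poly_Mapping.keys n"
  have *: "multidegree q k = (\<Sum>I | I \<in> ?K \<and> length I = k. Poly_Mapping.lookup q I)"
    if "Poly_Mapping.keys q \<subseteq> ?K" for q
    unfolding multidegree_def
  proof (rule sum.mono_neutral_left)
    show "\<forall>I \<in> {I. I \<in> ?K \<and> length I = k} - {I. I \<in> Poly_Mapping.keys q \<and> length I = k}.
        Poly_Mapping.lookup q I = 0"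
      by (auto simp: in_keys_iff)
  qed (use that in auto)
  show ?thesis
    using *[of m] *[of n] *[of "m + n"] Poly_Mapping.keys_add[of m n]
    by (simp add: lookup_add sum.distrib)
qed

lemma multihomogeneous_mult:
  assumes "multihomogeneous f" "multihomogeneous g"
  shows "multihomogeneous (f * g)"
proof -
  obtain a b where ab: "\<forall>m \<in> Poly_Mapping.keys f. multidegree m = a"
      "\<forall>m \<in> Poly_Mapping.keys g. multidegree m = b"
    using assms unfolding multihomogeneous_def by blast
  have "multidegree m = (\<lambda>k. a k + b k)" if "m \<in> Poly_Mapping.keys (f * g)" for m
  proof -
    have "m \<in> {p + q |p q. p \<in> Poly_Mapping.keys f \<and> q \<in> Poly_Mapping.keys g}"
      using keys_mult that by (rule subsetD)
    then obtain p q where "m = p + q" "p \<in> Poly_Mapping.keys f" "q \<in> Poly_Mapping.keys g"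
      by auto
    then show ?thesis
      using ab by (simp add: multidegree_add fun_eq_iff)
  qed
  then show ?thesis
    unfolding multihomogeneous_def by auto
qed

lemma plucker_ring_mult_closed:
  assumes "f \<in> carrier (plucker_ring d R)" "g \<in> carrier (plucker_ring d R)"
  shows "f * g \<in> carrier (plucker_ring d R)"
proof -
  have "Poly_Mapping.keys m \<subseteq> plucker_index d R" if "m \<in> Poly_Mapping.keys (f * g)" for m
  proof -
    have "m \<in> {a + b |a b. a \<in> Poly_Mapping.keys f \<and> b \<in> Poly_Mapping.keys g}"
      using keys_mult that by (rule subsetD)
    then obtain p q where pq: "m = p + q" "p \<in> Poly_Mapping.keys f" "q \<in> Poly_Mapping.keys g"
      by auto
    then have "Poly_Mapping.keys p \<subseteq> plucker_index d R" "Poly_Mapping.keys q \<subseteq> plucker_index d R"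
      using assms unfolding plucker_ring_def by simp_all
    then show ?thesis
      using Poly_Mapping.keys_add[of p q] unfolding pq(1) by (meson Un_least subset_trans)
  qed
  then show ?thesis
    unfolding plucker_ring_def by simp
qed

lemma zariski_closed_empty: "zariski_closed d R {}"
proof -
  have "1 \<notin> P" if "P \<in> flag_scheme d R" for P
  proof -
    interpret primeideal P "plucker_ring d R"
      using that unfolding flag_scheme_def by blast
    show ?thesis
      using I_notcarr one_imp_carrier unfolding plucker_ring_def by auto
  qed
  then show ?thesis
    unfolding zariski_closed_def
    by (intro exI[of _ "{1}"]) (auto simp: plucker_ring_def multihomogeneous_def)
qed

lemma zariski_closed_Un:
  assumes "zariski_closed d R C" "zariski_closed d R D"
  shows "zariski_closed d R (C \<union> D)"
proof -
  obtain S T where S: "S \<subseteq> carrier (plucker_ring d R)" "\<forall>f \<in> S. multihomogeneous f"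
      "C = {P \<in> flag_scheme d R. S \<subseteq> P}"
    and T: "T \<subseteq> carrier (plucker_ring d R)" "\<forall>f \<in> T. multihomogeneous f"
      "D = {P \<in> flag_scheme d R. T \<subseteq> P}"
    using assms unfolding zariski_closed_def by blast
  let ?ST = "{f * g | f g. f \<in> S \<and> g \<in> T}"
  have ST: "S \<subseteq> P \<or> T \<subseteq> P \<longleftrightarrow> ?ST \<subseteq> P" if "P \<in> flag_scheme d R" for P
  proof -
    interpret primeideal P "plucker_ring d R"
      using that unfolding flag_scheme_def by blast
    have mult: "x \<otimes>\<^bsub>plucker_ring d R\<^esub> y = x * y" for x y
      by (simp add: plucker_ring_def)
    show ?thesis
    proof
      assume "S \<subseteq> P \<or> T \<subseteq> P"
      then show "?ST \<subseteq> P"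
        using S(1) T(1) I_l_closed I_r_closed unfolding mult by blast
    next
      assume ST: "?ST \<subseteq> P"
      show "S \<subseteq> P \<or> T \<subseteq> P"
      proof (rule ccontr)
        assume "\<not> ?thesis"
        then obtain f g where "f \<in> S" "f \<notin> P" "g \<in> T" "g \<notin> P" by blast
        then show False
          using ST S(1) T(1) I_prime[of f g] unfolding mult by blast
      qed
    qed
  qed
  have "C \<union> D = {P. P \<in> flag_scheme d R \<and> (S \<subseteq> P \<or> T \<subseteq> P)}"
    unfolding S(3) T(3) conj_disj_distribL Collect_disj_eq ..
  also have "\<dots> = {P \<in> flag_scheme d R. ?ST \<subseteq> P}"
    by (intro Collect_cong conj_cong refl ST)
  finally have eq: "C \<union> D = {P \<in> flag_scheme d R. ?ST \<subseteq> P}" .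
  show ?thesis
    unfolding zariski_closed_def
  proof (intro exI conjI)
    show "?ST \<subseteq> carrier (plucker_ring d R)"
      using S(1) T(1) plucker_ring_mult_closed by (auto dest!: subsetD)
    show "\<forall>f \<in> ?ST. multihomogeneous f"
      using S(2) T(2) multihomogeneous_mult by auto
  qed (rule eq)
qed

lemma zariski_closed_Inter:
  assumes "\<And>C. C \<in> \<C> \<Longrightarrow> zariski_closed d R C"
  shows "zariski_closed d R (flag_scheme d R \<inter> \<Inter>\<C>)"
proof -
  have "\<forall>C \<in> \<C>. \<exists>S. S \<subseteq> carrier (plucker_ring d R) \<and>
      (\<forall>f \<in> S. multihomogeneous f) \<and> C = {P \<in> flag_scheme d R. S \<subseteq> P}"
    using assms unfolding zariski_closed_def by simp
  then obtain S where S: "\<forall>C \<in> \<C>. S C \<subseteq> carrier (plucker_ring d R) \<and>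
      (\<forall>f \<in> S C. multihomogeneous f) \<and> C = {P \<in> flag_scheme d R. S C \<subseteq> P}"
    by (rule bchoice[THEN exE])
  have mem: "P \<in> C \<longleftrightarrow> P \<in> flag_scheme d R \<and> S C \<subseteq> P" if "C \<in> \<C>" for C P
  proof -
    have "C = {P \<in> flag_scheme d R. S C \<subseteq> P}"
      using S that by blast
    then show ?thesis
      by (metis (no_types, lifting) mem_Collect_eq)
  qed
  have eq: "flag_scheme d R \<inter> \<Inter>\<C> = {P \<in> flag_scheme d R. (\<Union>C\<in>\<C>. S C) \<subseteq> P}"
  proof (rule Set.set_eqI)
    fix P
    show "P \<in> flag_scheme d R \<inter> \<Inter>\<C> \<longleftrightarrow> P \<in> {P \<in> flag_scheme d R. (\<Union>C\<in>\<C>. S C) \<subseteq> P}"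
      unfolding Int_iff Inter_iff mem_Collect_eq UN_subset_iff using mem[of _ P] by auto
  qed
  show ?thesis
    unfolding zariski_closed_def
  proof (intro exI conjI)
    show "(\<Union>C\<in>\<C>. S C) \<subseteq> carrier (plucker_ring d R)"
      using S by (simp add: UN_subset_iff)
    show "\<forall>f \<in> (\<Union>C\<in>\<C>. S C). multihomogeneous f"
      using S by simp
  qed (rule eq)
qed

lemma cring_plucker_ring: "cring (plucker_ring d R)"
proof (rule cringI)
  have neg: "- f \<in> carrier (plucker_ring d R)" if "f \<in> carrier (plucker_ring d R)" for f
    using that by (auto simp: plucker_ring_def)
  show "abelian_group (plucker_ring d R)"
  proof (rule abelian_groupI)
    fix f g assume "f \<in> carrier (plucker_ring d R)" "g \<in> carrier (plucker_ring d R)"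
    then show "f \<oplus>\<^bsub>plucker_ring d R\<^esub> g \<in> carrier (plucker_ring d R)"
      using Poly_Mapping.keys_add[of f g] unfolding plucker_ring_def by auto
  next
    fix f assume "f \<in> carrier (plucker_ring d R)"
    then show "\<exists>g \<in> carrier (plucker_ring d R). g \<oplus>\<^bsub>plucker_ring d R\<^esub> f = \<zero>\<^bsub>plucker_ring d R\<^esub>"
      using neg by (intro bexI[of _ "- f"]) (auto simp: plucker_ring_def)
  qed (auto simp: plucker_ring_def add.assoc add.commute)
  show "comm_monoid (plucker_ring d R)"
  proof (rule comm_monoidI)
    fix f g assume "f \<in> carrier (plucker_ring d R)" "g \<in> carrier (plucker_ring d R)"
    then show "f \<otimes>\<^bsub>plucker_ring d R\<^esub> g \<in> carrier (plucker_ring d R)"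
      using plucker_ring_mult_closed[of f d R g] unfolding plucker_ring_def by simp
  qed (auto simp: plucker_ring_def mult.assoc mult.commute)
qed (auto simp: plucker_ring_def distrib_right)

lemma forget_in_Gr:
  assumes F: "F \<in> flag_scheme d R" and r: "r \<in> R"
  shows "forget d {r} F \<in> Gr d r"
proof -
  interpret F: primeideal F "plucker_ring d R"
    using F unfolding flag_scheme_def by blast
  interpret S: cring "plucker_ring d {r}"
    by (rule cring_plucker_ring)
  have sub: "carrier (plucker_ring d {r}) \<subseteq> carrier (plucker_ring d R)"
  proof -
    have "plucker_index d {r} \<subseteq> plucker_index d R"
      using r unfolding plucker_index_def by auto
    then show ?thesis
      unfolding plucker_ring_def by (simp add: Collect_mono_iff) (meson subset_trans)
  qed
  have ops: "x \<otimes>\<^bsub>plucker_ring d Q\<^esub> y = x * y" "x \<oplus>\<^bsub>plucker_ring d Q\<^esub> y = x + y"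
    "\<zero>\<^bsub>plucker_ring d Q\<^esub> = 0" "\<one>\<^bsub>plucker_ring d Q\<^esub> = 1" for x y Q
    by (simp_all add: plucker_ring_def)
  let ?P = "forget d {r} F"
  have fl: "flag_ideal d {r} \<subseteq> F"
  proof -
    have "quotient_flags d R \<subseteq> quotient_flags d {r}"
      using r unfolding quotient_flags_def by auto
    then have "flag_ideal d {r} \<subseteq> flag_ideal d R"
      using sub unfolding flag_ideal_def by blast
    then show ?thesis
      using F unfolding flag_scheme_def by blast
  qed
  have one: "1 \<notin> F"
    using F.I_notcarr F.one_imp_carrier unfolding ops by auto
  have neg: "- f \<in> F" if "f \<in> F" for f
  proof -
    have *: "- 1 \<in> carrier (plucker_ring d R)"
      by (auto simp: plucker_ring_def)
    show ?thesis
      using F.I_l_closed[OF that *] unfolding ops by simp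
  qed
  have ideal: "ideal ?P (plucker_ring d {r})"
  proof (rule idealI)
    show "ring (plucker_ring d {r})" by (rule S.ring_axioms)
    show "subgroup ?P (add_monoid (plucker_ring d {r}))"
    proof (rule group.subgroupI)
      show "Group.group (add_monoid (plucker_ring d {r}))" by (rule S.a_group)
      show "?P \<subseteq> carrier (add_monoid (plucker_ring d {r}))"
        unfolding forget_def by simp
      show "?P \<noteq> {}"
        using additive_subgroup.zero_closed[OF F.additive_subgroup_axioms] S.zero_closed
        unfolding forget_def ops by auto
    next
      fix f assume f: "f \<in> ?P"
      have "- f \<in> carrier (plucker_ring d {r})"
        using f unfolding forget_def plucker_ring_def by auto
      moreover have "inv\<^bsub>add_monoid (plucker_ring d {r})\<^esub> f = - f"
      proof (rule group.inv_equality[OF S.a_group])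
        show "- f \<otimes>\<^bsub>add_monoid (plucker_ring d {r})\<^esub> f = \<one>\<^bsub>add_monoid (plucker_ring d {r})\<^esub>"
          by (simp add: ops)
      qed (use f calculation in \<open>auto simp: forget_def\<close>)
      ultimately show "inv\<^bsub>add_monoid (plucker_ring d {r})\<^esub> f \<in> ?P"
        using f neg unfolding forget_def by auto
    next
      fix f g assume "f \<in> ?P" "g \<in> ?P"
      then show "f \<otimes>\<^bsub>add_monoid (plucker_ring d {r})\<^esub> g \<in> ?P"
        using additive_subgroup.a_closed[OF F.additive_subgroup_axioms] S.a_closed
        unfolding forget_def ops by (simp add: ops)
    qed
  next
    fix f g assume "f \<in> ?P" "g \<in> carrier (plucker_ring d {r})"
    then show "g \<otimes>\<^bsub>plucker_ring d {r}\<^esub> f \<in> ?P" "f \<otimes>\<^bsub>plucker_ring d {r}\<^esub> g \<in> ?P"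
      using F.I_l_closed[of f g] F.I_r_closed[of f g] sub
        plucker_ring_mult_closed[of f d "{r}" g] plucker_ring_mult_closed[of g d "{r}" f]
      unfolding forget_def ops by auto
  qed
  have "primeideal ?P (plucker_ring d {r})"
  proof (rule primeidealI[OF ideal S.cring_axioms])
    show "carrier (plucker_ring d {r}) \<noteq> ?P"
      using one S.one_closed unfolding forget_def ops by blast
  next
    fix f g assume "f \<in> carrier (plucker_ring d {r})" "g \<in> carrier (plucker_ring d {r})"
      "f \<otimes>\<^bsub>plucker_ring d {r}\<^esub> g \<in> ?P"
    then show "f \<in> ?P \<or> g \<in> ?P"
      using F.I_prime[of f g] sub unfolding forget_def ops by blast
  qed
  moreover have "\<forall>f \<in> ?P. \<forall>a. component a f \<in> ?P"
  proof (intro ballI allI)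
    fix f a assume f: "f \<in> ?P"
    have "Poly_Mapping.keys (component a f) \<subseteq> Poly_Mapping.keys f"
      unfolding component_def
      by (rule subset_trans[OF Poly_Mapping.keys_sum]) (auto split: if_splits)
    then have "component a f \<in> carrier (plucker_ring d {r})"
      using f unfolding forget_def plucker_ring_def by auto
    then show "component a f \<in> ?P"
      using f F unfolding forget_def flag_scheme_def by blast
  qed
  moreover have "flag_ideal d {r} \<subseteq> ?P"
    using fl unfolding forget_def flag_ideal_def by blast
  moreover have "\<not> plucker_var ` plucker_index d {r} \<subseteq> ?P"
    using F r unfolding flag_scheme_def forget_def by blast
  ultimately show ?thesis
    unfolding flag_scheme_def by blast
qed

lemma total_Gr_closed_Un:
  assumes "total_Gr_closed d Y" "total_Gr_closed d Z"
  shows "total_Gr_closed d (Y \<union> Z)"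
proof -
  have st: "stratum (Y \<union> Z) r = stratum Y r \<union> stratum Z r" for r
    unfolding stratum_def by blast
  have lt: "lower_transfer d r s (C \<union> D) = lower_transfer d r s C \<union> lower_transfer d r s D" for r s C D
    unfolding lower_transfer_def by blast
  show ?thesis
    using assms unfolding total_Gr_closed_def st lt
    by (meson Un_least Un_mono zariski_closed_Un)
qed

lemma total_Gr_closed_Inter:
  assumes cl: "\<And>Z. Z \<in> \<Z> \<Longrightarrow> total_Gr_closed d Z"
  shows "total_Gr_closed d (total_Gr_points d \<inter> \<Inter>\<Z>)"
proof -
  have st: "stratum (total_Gr_points d \<inter> \<Inter>\<Z>) r = Gr d r \<inter> \<Inter>((\<lambda>Z. stratum Z r) ` \<Z>)"
    if "r \<le> d" for r
    using that unfolding stratum_def total_Gr_points_def by auto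
  have "zariski_closed d {r} (stratum (total_Gr_points d \<inter> \<Inter>\<Z>) r)" if "r \<le> d" for r
    unfolding st[OF that] using cl that unfolding total_Gr_closed_def
    by (intro zariski_closed_Inter) blast
  moreover have "lower_transfer d r s (stratum (total_Gr_points d \<inter> \<Inter>\<Z>) s) \<subseteq>
      stratum (total_Gr_points d \<inter> \<Inter>\<Z>) r" if sd: "s \<le> d" and rs: "r \<le> s" for r s
  proof
    fix P assume "P \<in> lower_transfer d r s (stratum (total_Gr_points d \<inter> \<Inter>\<Z>) s)"
    then obtain F where F: "F \<in> Fl d r s" "P = forget d {r} F"
        "\<And>Z. Z \<in> \<Z> \<Longrightarrow> forget d {s} F \<in> stratum Z s"
      unfolding lower_transfer_def st[OF sd] by blast
    have "P \<in> stratum Z r" if "Z \<in> \<Z>" for Z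
      using cl[OF that] F that sd rs unfolding total_Gr_closed_def lower_transfer_def by blast
    moreover have "P \<in> Gr d r"
      using forget_in_Gr F(1,2) by blast
    ultimately show "P \<in> stratum (total_Gr_points d \<inter> \<Inter>\<Z>) r"
      using st[of r] sd rs by auto
  qed
  ultimately show ?thesis
    unfolding total_Gr_closed_def by blast
qed

lemma total_Gr_closed_empty: "total_Gr_closed d {}"
  unfolding total_Gr_closed_def
  by (auto simp: stratum_def zariski_closed_empty lower_transfer_def)

lemma openin_total_Gr:
  "openin (total_Gr d) U \<longleftrightarrow> U \<subseteq> total_Gr_points d \<and> total_Gr_closed d (total_Gr_points d - U)"
proof -
  let ?X = "total_Gr_points d"
  let ?L = "\<lambda>U. U \<subseteq> ?X \<and> total_Gr_closed d (?X - U)"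
  have "istopology ?L"
    unfolding istopology_def
  proof (intro conjI allI impI)
    fix S T assume S: "?L S" and T: "?L T"
    show "S \<inter> T \<subseteq> ?X" using S by blast
    have "?X - S \<inter> T = (?X - S) \<union> (?X - T)" by blast
    then show "total_Gr_closed d (?X - S \<inter> T)" using S T total_Gr_closed_Un by metis
  next
    fix \<K> assume K: "\<forall>K\<in>\<K>. ?L K"
    show "\<Union>\<K> \<subseteq> ?X" using K by blast
    have "total_Gr_closed d (?X \<inter> \<Inter>((\<lambda>K. ?X - K) ` \<K>))"
      using K by (intro total_Gr_closed_Inter) blast
    moreover have "?X - \<Union>\<K> = ?X \<inter> \<Inter>((\<lambda>K. ?X - K) ` \<K>)" by blast
    ultimately show "total_Gr_closed d (?X - \<Union>\<K>)" by simp
  qed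
  then show ?thesis
    unfolding total_Gr_def by (simp add: topology_inverse')
qed

lemma topspace_total_Gr: "topspace (total_Gr d) = total_Gr_points d"
proof -
  have "openin (total_Gr d) (total_Gr_points d)"
    by (simp add: openin_total_Gr total_Gr_closed_empty)
  then show ?thesis
    by (meson openin_subset openin_topspace openin_total_Gr subset_antisym)
qed

lemma closedin_total_Gr: "closedin (total_Gr d) Z \<longleftrightarrow> total_Gr_closed d Z"
proof -
  have "Z \<subseteq> total_Gr_points d" if "total_Gr_closed d Z"
    using that unfolding total_Gr_closed_def by blast
  then show ?thesis
    unfolding closedin_def topspace_total_Gr openin_total_Gr
    by (metis Diff_subset double_diff order_refl)
qed

end

theory Submission
  imports Defs "HOL-Library.List_Lexorder" "HOL-Algebra.RingHom"
begin

text \<open>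
  Attach to an irreducible closed set \<open>Z\<close> the polynomials in the Pluecker variables that vanish on
  all \<open>d \<times> d\<close> matrices that factor through a quotient belonging to \<open>Z\<close>, where \<open>p\<^sub>I\<close> is evaluated
  as the minor of the first rows in the columns \<open>I\<close>.  Because \<open>Z\<close> is downwards closed, this
  is a prime, and it shrinks strictly when \<open>Z\<close> grows.  Up to row operations that do not affect these
  minors, a generic matrix is upper triangular, so any \<open>(d + 1) choose 2 + 1\<close> polynomials are
  algebraically dependent on the matrices, which excludes longer chains of such primes.

  Conversely, let \<open>0 \<le> j \<le> t < d\<close>, and consider the rank \<open>t\<close> quotients of the coordinate space
  \<open>\<complex>\<^sup>t\<^sup>+\<^sup>1\<close>, which form a projective space of dimension \<open>t\<close>.  The closures of its standard
  \<open>j\<close>-dimensional subspaces, ordered lexicographically by \<open>(t, j)\<close> and followed by the whole space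
  (the closure of the point of rank \<open>d\<close>), form a strict chain: the last one of rank \<open>t\<close> consists of
  quotients of the single point that comes next, of rank \<open>t + 1\<close>.
\<close>

subsection \<open>Substitution into polynomials in the Pluecker variables\<close>

text \<open>Quotients of different ranks live in different projective spaces. Replacing a quotient
  \<open>X\<close> of rank \<open>s\<close> by all products \<open>N X\<close> with \<open>N\<close>
  of size \<open>d\<close> by \<open>s\<close> puts them into one affine space. If a quotient
  factors through a larger one, the matrices over it are among those over the larger one, so the
  points over which a given polynomial vanishes form a closed set of the total Grassmannian. The
  minors of size \<open>s\<close> are the Pluecker coordinates of \<open>X\<close> up to a common
  factor and the larger minors are zero; hence equations of positive degree for a top stratum hold
  automatically at lower ranks.

  The obstacle is that points are primes, not matrices. No residue field is formed: the universal
  \<open>X\<close> is available only as a matrix of Pluecker coordinates, after multiplication by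
  some \<open>p_J\<close> outside the prime. All identities are congruences modulo the prime, and
  general position is replaced by interpolation on finite grids of complex constants.\<close>

definition mono_eval :: "(nat list \<Rightarrow> 'a::comm_ring_1) \<Rightarrow> (nat list \<Rightarrow>\<^sub>0 nat) \<Rightarrow> 'a" where
  "mono_eval x m = (\<Prod>I\<in>Poly_Mapping.keys m. x I ^ Poly_Mapping.lookup m I)"

text \<open>The coefficient map \<open>\<kappa>\<close> is a parameter because values are taken in
  the complex numbers, in the Pluecker polynomials themselves, and in univariate polynomials over
  such rings.\<close>

definition plucker_eval :: "(complex \<Rightarrow> 'a::comm_ring_1) \<Rightarrow> (nat list \<Rightarrow> 'a) \<Rightarrow> plucker_poly \<Rightarrow> 'a" where
  "plucker_eval \<kappa> x f = (\<Sum>m\<in>Poly_Mapping.keys f. \<kappa> (Poly_Mapping.lookup f m) * mono_eval x m)"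

lemma eval_plucker_eq: "eval_plucker x f = plucker_eval (\<lambda>c. c) x f"
  by (simp add: eval_plucker_def plucker_eval_def mono_eval_def)

lemma mono_eval_superset:
  assumes "finite K" "Poly_Mapping.keys m \<subseteq> K"
  shows "mono_eval x m = (\<Prod>I\<in>K. x I ^ Poly_Mapping.lookup m I)"
  unfolding mono_eval_def using assms
  by (intro prod.mono_neutral_left) (auto simp: in_keys_iff)

lemma mono_eval_add: "mono_eval x (m + n) = mono_eval x m * mono_eval x n"
proof -
  let ?K = "Poly_Mapping.keys m \<union> Poly_Mapping.keys n"
  have "mono_eval x q = (\<Prod>I\<in>?K. x I ^ Poly_Mapping.lookup q I)" if "Poly_Mapping.keys q \<subseteq> ?K" for q
    by (rule mono_eval_superset) (use that in auto)
  from this[of m] this[of n] this[of "m + n"] show ?thesis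
    using Poly_Mapping.keys_add[of m n] by (simp add: lookup_add power_add prod.distrib)
qed

lemma mono_eval_0 [simp]: "mono_eval x 0 = 1"
  by (simp add: mono_eval_def)

lemma mono_eval_single [simp]: "mono_eval x (Poly_Mapping.single I n) = x I ^ n"
  by (simp add: mono_eval_def)

lemma plucker_poly_expand:
  "f = (\<Sum>m\<in>Poly_Mapping.keys f. Poly_Mapping.single m (Poly_Mapping.lookup f m))"
  for f :: "'m \<Rightarrow>\<^sub>0 'b::comm_monoid_add"
proof (rule poly_mapping_eqI)
  fix m
  show "Poly_Mapping.lookup f m =
      Poly_Mapping.lookup (\<Sum>m\<in>Poly_Mapping.keys f. Poly_Mapping.single m (Poly_Mapping.lookup f m)) m"
    by (simp add: lookup_sum lookup_single when_def in_keys_iff)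
qed

context comm_ring_hom
begin

lemma hom_mono_eval: "hom (mono_eval x m) = mono_eval (\<lambda>I. hom (x I)) m"
  by (simp add: mono_eval_def hom_distribs)

lemma hom_plucker_eval: "hom (plucker_eval \<kappa> x f) = plucker_eval (\<lambda>c. hom (\<kappa> c)) (\<lambda>I. hom (x I)) f"
  by (simp add: plucker_eval_def hom_distribs hom_mono_eval)

end

locale complex_algebra = comm_ring_hom \<kappa> for \<kappa> :: "complex \<Rightarrow> 'a::comm_ring_1"
begin

lemma plucker_eval_superset:
  assumes "finite K" "Poly_Mapping.keys f \<subseteq> K"
  shows "plucker_eval \<kappa> x f = (\<Sum>m\<in>K. \<kappa> (Poly_Mapping.lookup f m) * mono_eval x m)"
  unfolding plucker_eval_def using assms
  by (intro sum.mono_neutral_left) (auto simp: in_keys_iff)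

lemma plucker_eval_add: "plucker_eval \<kappa> x (f + g) = plucker_eval \<kappa> x f + plucker_eval \<kappa> x g"
proof -
  let ?K = "Poly_Mapping.keys f \<union> Poly_Mapping.keys g"
  have "plucker_eval \<kappa> x q = (\<Sum>m\<in>?K. \<kappa> (Poly_Mapping.lookup q m) * mono_eval x m)"
    if "Poly_Mapping.keys q \<subseteq> ?K" for q
    by (rule plucker_eval_superset) (use that in auto)
  from this[of f] this[of g] this[of "f + g"] show ?thesis
    using Poly_Mapping.keys_add[of f g]
    by (simp add: lookup_add hom_distribs sum.distrib distrib_right)
qed

lemma plucker_eval_0 [simp]: "plucker_eval \<kappa> x 0 = 0"
  by (simp add: plucker_eval_def)

lemma plucker_eval_single [simp]:
  "plucker_eval \<kappa> x (Poly_Mapping.single m c) = \<kappa> c * mono_eval x m"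
  by (cases "c = 0") (simp_all add: plucker_eval_def)

lemma plucker_eval_sum: "plucker_eval \<kappa> x (\<Sum>i\<in>A. f i) = (\<Sum>i\<in>A. plucker_eval \<kappa> x (f i))"
  by (induction A rule: infinite_finite_induct) (simp_all add: plucker_eval_add)

lemma plucker_eval_mult: "plucker_eval \<kappa> x (f * g) = plucker_eval \<kappa> x f * plucker_eval \<kappa> x g"
proof -
  let ?F = "Poly_Mapping.keys f" and ?G = "Poly_Mapping.keys g"
  let ?f = "\<lambda>m. Poly_Mapping.single m (Poly_Mapping.lookup f m)"
  let ?g = "\<lambda>m. Poly_Mapping.single m (Poly_Mapping.lookup g m)"
  have "f * g = (\<Sum>m\<in>?F. ?f m) * (\<Sum>m\<in>?G. ?g m)"
    using plucker_poly_expand[of f] plucker_poly_expand[of g] by simp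
  also have "\<dots> = (\<Sum>m\<in>?F. \<Sum>n\<in>?G. Poly_Mapping.single (m + n)
      (Poly_Mapping.lookup f m * Poly_Mapping.lookup g n))"
    by (simp add: sum_product mult_single)
  finally have "plucker_eval \<kappa> x (f * g) = (\<Sum>m\<in>?F. \<Sum>n\<in>?G.
      (\<kappa> (Poly_Mapping.lookup f m) * mono_eval x m) * (\<kappa> (Poly_Mapping.lookup g n) * mono_eval x n))"
    by (simp add: plucker_eval_sum mono_eval_add hom_distribs algebra_simps)
  also have "\<dots> = plucker_eval \<kappa> x f * plucker_eval \<kappa> x g"
    by (simp add: plucker_eval_def sum_product)
  finally show ?thesis .
qed

lemma plucker_eval_1 [simp]: "plucker_eval \<kappa> x 1 = 1"
  using plucker_eval_single[of x 0 1] by simp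

lemma plucker_eval_hom: "comm_ring_hom (plucker_eval \<kappa> x)"
  by unfold_locales (simp_all add: plucker_eval_add plucker_eval_mult)

lemma plucker_eval_var [simp]: "plucker_eval \<kappa> x (plucker_var I) = x I"
  by (simp add: plucker_var_def)

end

section \<open>Leading minors and their degrees along lines\<close>

definition minor :: "(nat \<Rightarrow> nat \<Rightarrow> 'a::comm_ring_1) \<Rightarrow> nat list \<Rightarrow> 'a" where
  "minor Y I = det (mat (length I) (length I) (\<lambda>(i, j). Y i (I ! j)))"

lemma (in comm_ring_hom) hom_minor: "hom (minor Y I) = minor (\<lambda>i k. hom (Y i k)) I"
proof -
  have "map_mat hom (mat (length I) (length I) (\<lambda>(i, j). Y i (I ! j)))
      = mat (length I) (length I) (\<lambda>(i, j). hom (Y i (I ! j)))"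
    by (rule eq_matI) auto
  then show ?thesis
    unfolding minor_def by (metis hom_det)
qed

definition minor_eval :: "(complex \<Rightarrow> 'a::comm_ring_1) \<Rightarrow> (nat \<Rightarrow> nat \<Rightarrow> 'a) \<Rightarrow> plucker_poly \<Rightarrow> 'a" where
  "minor_eval \<kappa> Y = plucker_eval \<kappa> (minor Y)"

lemma (in comm_ring_hom) hom_minor_eval:
  "hom (minor_eval \<kappa> Y f) = minor_eval (\<lambda>c. hom (\<kappa> c)) (\<lambda>i k. hom (Y i k)) f"
  by (simp add: minor_eval_def hom_plucker_eval hom_minor)

lemma comm_ring_hom_poly: "comm_ring_hom (\<lambda>q :: 'a::comm_ring_1 poly. poly q t)"
  by unfold_locales auto

text \<open>Each \<open>p_I\<close> counts with weight \<open>length I\<close>, the degree of its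
  minor in the matrix entries. Summing over monomials is crude, but any bound that depends on
  \<open>f\<close> alone is good enough.\<close>

definition minor_degree :: "plucker_poly \<Rightarrow> nat" where
  "minor_degree f = (\<Sum>m\<in>Poly_Mapping.keys f. \<Sum>I\<in>Poly_Mapping.keys m. length I * Poly_Mapping.lookup m I)"

lemma degree_minor_eval:
  fixes Y :: "nat \<Rightarrow> nat \<Rightarrow> 'a::comm_ring_1 poly"
  assumes "\<And>i k. degree (Y i k) \<le> 1"
  shows "degree (minor_eval (\<lambda>c. [:\<kappa> c:]) Y f) \<le> minor_degree f"
proof -
  have minor: "degree (minor Y I) \<le> length I" for I
    unfolding minor_def using assms
    by (intro order.trans[OF degree_det_le[of "length I" _ 1]]) auto
  have "degree ([:\<kappa> (Poly_Mapping.lookup f m):] * mono_eval (minor Y) m)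
      \<le> (\<Sum>I\<in>Poly_Mapping.keys m. length I * Poly_Mapping.lookup m I)" (is "degree (?c * ?m) \<le> ?s") for m
  proof -
    have "degree (?c * ?m) \<le> degree ?c + degree ?m" by (rule degree_mult_le)
    also have "\<dots> = degree ?m" by simp
    also have "\<dots> \<le> (\<Sum>I\<in>Poly_Mapping.keys m. degree (minor Y I ^ Poly_Mapping.lookup m I))"
      unfolding mono_eval_def using degree_prod_sum_le[of "Poly_Mapping.keys m"] by (simp add: o_def)
    also have "\<dots> \<le> ?s"
      by (intro sum_mono order.trans[OF degree_power_le] mult_right_mono minor) auto
    finally show ?thesis .
  qed
  moreover have "(\<Sum>I\<in>Poly_Mapping.keys m. length I * Poly_Mapping.lookup m I) \<le> minor_degree f"
    if "m \<in> Poly_Mapping.keys f" for m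
    unfolding minor_degree_def using that by (intro member_le_sum) auto
  ultimately show ?thesis
    unfolding minor_eval_def plucker_eval_def
    by (intro degree_sum_le) (auto intro: order.trans)
qed

text \<open>The degree bound does not depend on the line, so grids of one size serve all lines. The
  parameter \<open>t\<close> runs through the whole ring, not just the constants; cancelling
  \<open>p_J\<close> later relies on this.\<close>

lemma (in complex_algebra) minor_eval_line:
  fixes Y0 Y1 :: "nat \<Rightarrow> nat \<Rightarrow> 'a"
  shows "\<exists>q. degree q \<le> minor_degree f \<and> (\<forall>t. poly q t = minor_eval \<kappa> (\<lambda>i k. Y0 i k + t * Y1 i k) f)"
proof -
  let ?q = "minor_eval (\<lambda>c. [:\<kappa> c:]) (\<lambda>i k. [:Y0 i k, Y1 i k:]) f"
  have "poly ?q t = minor_eval \<kappa> (\<lambda>i k. Y0 i k + t * Y1 i k) f" for t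
  proof -
    have "poly ?q t = minor_eval (\<lambda>c. poly [:\<kappa> c:] t) (\<lambda>i k. poly [:Y0 i k, Y1 i k:] t) f"
      by (rule comm_ring_hom.hom_minor_eval[OF comm_ring_hom_poly])
    then show ?thesis by simp
  qed
  moreover have "degree ?q \<le> minor_degree f"
    by (rule degree_minor_eval) (simp add: degree_pCons_le)
  ultimately show ?thesis by blast
qed

section \<open>Ideals, congruences and interpolation at complex nodes\<close>

definition ideal_set :: "'a::comm_ring_1 set \<Rightarrow> bool" where
  "ideal_set P \<longleftrightarrow> 0 \<in> P \<and> (\<forall>x\<in>P. \<forall>y\<in>P. x + y \<in> P) \<and> (\<forall>x\<in>P. \<forall>r. r * x \<in> P)"

text \<open>Primes of the whole type, without a carrier, so that congruences can be substituted
  freely into polynomials. The primes of the coordinate rings are transported here by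
  \<open>prime_ext\<close>.\<close>

definition prime_set :: "'a::comm_ring_1 set \<Rightarrow> bool" where
  "prime_set P \<longleftrightarrow> ideal_set P \<and> 1 \<notin> P \<and> (\<forall>x y. x * y \<in> P \<longrightarrow> x \<in> P \<or> y \<in> P)"

lemma ideal_set_singleton_0: "ideal_set {0}"
  by (simp add: ideal_set_def)

context
  fixes P :: "'a::comm_ring_1 set"
  assumes P: "ideal_set P"
begin

lemma ideal_0: "0 \<in> P" and ideal_add: "x \<in> P \<Longrightarrow> y \<in> P \<Longrightarrow> x + y \<in> P"
  and ideal_mult: "x \<in> P \<Longrightarrow> r * x \<in> P" and ideal_mult': "x \<in> P \<Longrightarrow> x * r \<in> P"
  using P unfolding ideal_set_def by (auto simp: mult.commute)

lemma ideal_uminus: "x \<in> P \<Longrightarrow> - x \<in> P"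
  using ideal_mult[of x "-1"] by simp

lemma ideal_diff: "x \<in> P \<Longrightarrow> y \<in> P \<Longrightarrow> x - y \<in> P"
  using ideal_add[of x "- y"] ideal_uminus[of y] by simp

lemma ideal_sum: "(\<And>i. i \<in> A \<Longrightarrow> f i \<in> P) \<Longrightarrow> (\<Sum>i\<in>A. f i) \<in> P"
  by (induction A rule: infinite_finite_induct) (auto intro: ideal_0 ideal_add)

lemma ideal_cong: "x - y \<in> P \<Longrightarrow> x \<in> P \<longleftrightarrow> y \<in> P"
  using ideal_diff[of x "x - y"] ideal_add[of "x - y" y] by auto

lemma ideal_cong_mult:
  assumes "x - x' \<in> P" "y - y' \<in> P"
  shows "x * y - x' * y' \<in> P"
proof -
  have "x * y - x' * y' = y * (x - x') + x' * (y - y')"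
    by (simp add: algebra_simps)
  then show ?thesis
    using ideal_add[OF ideal_mult[OF assms(1)] ideal_mult[OF assms(2)]] by simp
qed

lemma ideal_cong_sum:
  assumes "\<And>i. i \<in> A \<Longrightarrow> f i - g i \<in> P"
  shows "(\<Sum>i\<in>A. f i) - (\<Sum>i\<in>A. g i) \<in> P"
  using ideal_sum[of A "\<lambda>i. f i - g i"] assms by (simp add: sum_subtractf)

lemma ideal_cong_prod:
  "(\<And>i. i \<in> A \<Longrightarrow> f i - g i \<in> P) \<Longrightarrow> (\<Prod>i\<in>A. f i) - (\<Prod>i\<in>A. g i) \<in> P"
  by (induction A rule: infinite_finite_induct) (auto intro: ideal_0 ideal_cong_mult)

lemma ideal_cong_power: "x - y \<in> P \<Longrightarrow> x ^ n - y ^ n \<in> P"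
  by (induction n) (auto intro: ideal_0 ideal_cong_mult)

lemma ideal_cong_plucker_eval:
  assumes "\<And>I. x I - y I \<in> P"
  shows "plucker_eval \<kappa> x f - plucker_eval \<kappa> y f \<in> P"
  unfolding plucker_eval_def mono_eval_def
  using assms by (auto intro!: ideal_cong_sum ideal_cong_mult ideal_cong_prod ideal_cong_power ideal_0)

lemma ideal_cong_minor:
  assumes "\<And>i k. X i k - Y i k \<in> P"
  shows "minor X I - minor Y I \<in> P"
proof -
  let ?A = "\<lambda>X :: nat \<Rightarrow> nat \<Rightarrow> 'a. mat (length I) (length I) (\<lambda>(i, j). X i (I ! j))"
  have "det (?A X) = (\<Sum>p\<in>{p. p permutes {0..<length I}}. signof p * (\<Prod>i = 0..<length I. X i (I ! p i)))" for X
    unfolding det_def'[of "?A X" "length I", simplified]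
    by (auto intro!: sum.cong prod.cong simp: permutes_in_image)
  then show ?thesis
    unfolding minor_def using assms
    by (auto intro!: ideal_cong_sum ideal_cong_mult ideal_cong_prod ideal_0)
qed

lemma ideal_cong_minor_eval:
  assumes "\<And>i k. X i k - Y i k \<in> P"
  shows "minor_eval \<kappa> X f - minor_eval \<kappa> Y f \<in> P"
  unfolding minor_eval_def by (intro ideal_cong_plucker_eval ideal_cong_minor assms)

lemma ideal_poly:
  assumes "\<And>i. coeff q i \<in> P"
  shows "poly q t \<in> P"
  unfolding poly_altdef using assms by (auto intro: ideal_sum ideal_mult')

end

text \<open>The residue ring need not be a domain, so roots cannot simply be counted; but
  differences of distinct nodes are units, being images of nonzero complex numbers. Dividing by
  \<open>X - \<kappa> t0\<close> therefore leaves a quotient whose values at the other nodes are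
  again in \<open>P\<close>.\<close>

lemma (in complex_algebra) ideal_coeffs:
  assumes P: "ideal_set P"
    and "finite T" "degree q < card T" "\<And>t. t \<in> T \<Longrightarrow> poly q (\<kappa> t) \<in> P"
  shows "coeff q i \<in> P"
  using assms(2-)
proof (induction "degree q" arbitrary: q T i)
  case 0
  then obtain t a where "t \<in> T" "q = [:a:]"
    by (metis card.empty degree_eq_zeroE equals0I less_nat_zero_code)
  with 0 show ?case by (cases i) (auto intro: ideal_0[OF P])
next
  case (Suc n)
  then obtain t0 where t0: "t0 \<in> T" by fastforce
  let ?q = "synthetic_div q (\<kappa> t0)"
  have q: "q = [:- \<kappa> t0, 1:] * ?q + [:poly q (\<kappa> t0):]"
    by (rule synthetic_div_correct'[symmetric])
  have "coeff ?q i \<in> P" for i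
  proof (rule Suc.hyps(1)[of _ "T - {t0}"])
    show "n = degree ?q" using Suc.hyps(2) by (simp add: degree_synthetic_div)
    then show "degree ?q < card (T - {t0})" using Suc.prems(1,2) Suc.hyps(2) t0 by simp
    fix t assume t: "t \<in> T - {t0}"
    have "poly q (\<kappa> t) = (\<kappa> t - \<kappa> t0) * poly ?q (\<kappa> t) + poly q (\<kappa> t0)"
      by (subst q) (simp add: algebra_simps)
    then have "(\<kappa> t - \<kappa> t0) * poly ?q (\<kappa> t) \<in> P"
      using ideal_diff[OF P Suc.prems(3)[of t] Suc.prems(3)[OF t0]] t by simp
    then have "\<kappa> (inverse (t - t0)) * ((\<kappa> t - \<kappa> t0) * poly ?q (\<kappa> t)) \<in> P"
      by (rule ideal_mult[OF P])
    moreover have "\<kappa> (inverse (t - t0)) * (\<kappa> t - \<kappa> t0) = 1"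
      using t by (subst hom_minus[symmetric], subst hom_mult[symmetric]) simp
    ultimately show "poly ?q (\<kappa> t) \<in> P"
      by (metis mult.assoc mult.left_neutral)
  qed (use Suc.prems(1) in auto)
  then show ?case
    using Suc.prems(3)[OF t0]
    by (subst q) (auto simp: coeff_pCons split: nat.splits intro!: ideal_add[OF P] ideal_diff[OF P] ideal_mult[OF P] ideal_uminus[OF P])
qed

text \<open>A function that is a polynomial of degree at most \<open>e\<close> in each variable is determined
  modulo \<open>P\<close> by its values on a grid with more than \<open>e\<close> points in each direction.\<close>

lemma (in complex_algebra) ideal_grid:
  fixes \<phi> :: "('v \<Rightarrow> 'a) \<Rightarrow> 'a"
  assumes P: "ideal_set P"
    and poly: "\<And>N v. v \<in> S \<Longrightarrow> \<exists>q. degree q \<le> e \<and> (\<forall>t. poly q t = \<phi> (N(v := t)))"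
    and T: "finite T" "e < card T" and S: "finite S"
    and grid: "\<And>N. (\<forall>v\<in>S. N v \<in> \<kappa> ` T) \<Longrightarrow> (\<forall>v. v \<notin> S \<longrightarrow> N v = N0 v) \<Longrightarrow> \<phi> N \<in> P"
    and N: "\<forall>v. v \<notin> S \<longrightarrow> N v = N0 v"
  shows "\<phi> N \<in> P"
  using S poly grid N
proof (induction S arbitrary: N0 N rule: finite_induct)
  case (insert v S)
  obtain q where q: "degree q \<le> e" "\<And>t. poly q t = \<phi> (N(v := t))"
    using insert.prems(1)[of v N] by blast
  have "poly q (\<kappa> t) \<in> P" if t: "t \<in> T" for t
    unfolding q(2)
  proof (rule insert.IH)
    show "\<forall>w. w \<notin> S \<longrightarrow> (N(v := \<kappa> t)) w = (N0(v := \<kappa> t)) w" using insert.prems(3) by auto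
    fix N' assume N': "\<forall>v\<in>S. N' v \<in> \<kappa> ` T" "\<forall>w. w \<notin> S \<longrightarrow> N' w = (N0(v := \<kappa> t)) w"
    then show "\<phi> N' \<in> P"
      using t insert.hyps(2) by (intro insert.prems(2)) auto
  qed (use insert.prems(1,3) in auto)
  then have "coeff q i \<in> P" for i
    using ideal_coeffs[OF P T(1), of q i] q(1) T(2) by auto
  then have "poly q (N v) \<in> P" by (rule ideal_poly[OF P])
  then show ?case unfolding q(2) by simp
qed auto

definition const_poly :: "complex \<Rightarrow> plucker_poly" where
  "const_poly c = Poly_Mapping.single 0 c"

interpretation const_poly: complex_algebra const_poly
  by unfold_locales (simp_all add: const_poly_def single_add mult_single)

lemma complex_algebra_id: "complex_algebra (\<lambda>c. c)"
  by unfold_locales auto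

subsection \<open>Multihomogeneous polynomials\<close>

text \<open>The degree is kept explicit because it becomes the exponent when rescaled coordinates
  are substituted. The zero polynomial has every degree.\<close>

definition mhomog :: "nat \<Rightarrow> nat set \<Rightarrow> (nat \<Rightarrow> nat) \<Rightarrow> plucker_poly \<Rightarrow> bool" where
  "mhomog d R a f \<longleftrightarrow> f \<in> carrier (plucker_ring d R) \<and> (\<forall>m\<in>Poly_Mapping.keys f. multidegree m = a)"

lemma mem_plucker_ring:
  "f \<in> carrier (plucker_ring d R) \<longleftrightarrow> (\<forall>m\<in>Poly_Mapping.keys f. Poly_Mapping.keys m \<subseteq> plucker_index d R)"
  by (simp add: plucker_ring_def)

lemma mhomog_carrier: "mhomog d R a f \<Longrightarrow> f \<in> carrier (plucker_ring d R)"
  by (simp add: mhomog_def)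

lemma mhomog_imp_multihomogeneous: "mhomog d R a f \<Longrightarrow> multihomogeneous f"
  by (auto simp: mhomog_def multihomogeneous_def)

lemma mhomog_0: "mhomog d R a 0"
  by (simp add: mhomog_def mem_plucker_ring)

lemma mhomog_1: "mhomog d R (\<lambda>k. 0) 1"
  by (simp add: mhomog_def mem_plucker_ring multidegree_def fun_eq_iff)

lemma mhomog_add: "mhomog d R a f \<Longrightarrow> mhomog d R a g \<Longrightarrow> mhomog d R a (f + g)"
  using Poly_Mapping.keys_add[of f g] unfolding mhomog_def mem_plucker_ring by blast

lemma mhomog_uminus: "mhomog d R a f \<Longrightarrow> mhomog d R a (- f)"
  by (simp add: mhomog_def mem_plucker_ring)

lemma mhomog_diff: "mhomog d R a f \<Longrightarrow> mhomog d R a g \<Longrightarrow> mhomog d R a (f - g)"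
  using mhomog_add[of d R a f "- g"] mhomog_uminus[of d R a g] by simp

lemma mhomog_sum: "(\<And>i. i \<in> A \<Longrightarrow> mhomog d R a (f i)) \<Longrightarrow> mhomog d R a (\<Sum>i\<in>A. f i)"
  by (induction A rule: infinite_finite_induct) (auto intro: mhomog_0 mhomog_add)

lemma mhomog_mult:
  assumes f: "mhomog d R a f" and g: "mhomog d R b g" and c: "\<And>k. c k = a k + b k"
  shows "mhomog d R c (f * g)"
  unfolding mhomog_def
proof (intro conjI ballI)
  show "f * g \<in> carrier (plucker_ring d R)"
    using assms unfolding mhomog_def by (intro plucker_ring_mult_closed) auto
  fix m assume "m \<in> Poly_Mapping.keys (f * g)"
  then obtain p q where "m = p + q" "p \<in> Poly_Mapping.keys f" "q \<in> Poly_Mapping.keys g"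
    using keys_mult[of f g] by blast
  then show "multidegree m = c"
    using f g c unfolding mhomog_def by (auto simp: multidegree_add fun_eq_iff)
qed

lemma mhomog_prod:
  assumes "\<And>i. i \<in> A \<Longrightarrow> mhomog d R a (f i)" "finite A"
  shows "mhomog d R (\<lambda>k. card A * a k) (\<Prod>i\<in>A. f i)"
  using assms(2,1)
proof (induction A rule: finite_induct)
  case (insert i A)
  then show ?case
    by (auto intro!: mhomog_mult[where a = a and b = "\<lambda>k. card A * a k"])
qed (simp add: mhomog_1)

lemma mhomog_power: "mhomog d R a f \<Longrightarrow> mhomog d R (\<lambda>k. n * a k) (f ^ n)"
  using mhomog_prod[of "{..<n}" d R a "\<lambda>_. f"] by simp

lemma mhomog_minor:
  assumes "\<And>i j. i < length I \<Longrightarrow> j < length I \<Longrightarrow> mhomog d R a (Y i (I ! j))"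
  shows "mhomog d R (\<lambda>k. length I * a k) (minor Y I)"
proof -
  let ?n = "length I"
  have eq: "minor Y I = (\<Sum>p\<in>{p. p permutes {0..<?n}}. signof p * (\<Prod>i = 0..<?n. Y i (I ! p i)))"
    unfolding minor_def det_def'[of _ ?n, OF mat_carrier]
    by (intro sum.cong refl arg_cong2[of _ _ _ _ "(*)"] prod.cong) (auto simp: permutes_in_image)
  have h: "mhomog d R (\<lambda>k. ?n * a k) (signof p * (\<Prod>i = 0..<?n. Y i (I ! p i)))"
    if p: "p permutes {0..<?n}" for p
  proof -
    have "mhomog d R (\<lambda>k. card {0..<?n} * a k) (\<Prod>i = 0..<?n. Y i (I ! p i))"
      by (rule mhomog_prod) (use p assms in \<open>auto simp: permutes_in_image\<close>)
    then show ?thesis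
      by (auto simp: sign_def mhomog_uminus)
  qed
  show ?thesis
    unfolding eq by (rule mhomog_sum) (use h in blast)
qed

lemma lookup_component:
  "Poly_Mapping.lookup (component a f) m = (if multidegree m = a then Poly_Mapping.lookup f m else 0)"
proof -
  let ?K = "{m \<in> Poly_Mapping.keys f. multidegree m = a}"
  have "Poly_Mapping.lookup (component a f) m = (\<Sum>m'\<in>?K. if m' = m then Poly_Mapping.lookup f m' else 0)"
    unfolding component_def lookup_sum by (rule sum.cong[OF refl]) (simp only: lookup_single when_def)
  also have "\<dots> = (if m \<in> ?K then Poly_Mapping.lookup f m else 0)"
    by (rule sum.delta) simp
  finally show ?thesis
    by (simp add: in_keys_iff del: lookup_not_eq_zero_eq_in_keys)
qed

lemma component_mhomog:
  assumes "mhomog d R b f"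
  shows "component a f = (if a = b then f else 0)"
  by (rule poly_mapping_eqI) (use assms in \<open>auto simp: lookup_component mhomog_def in_keys_iff simp del: lookup_not_eq_zero_eq_in_keys\<close>)

lemma mhomog_in_flag_ideal:
  assumes f: "mhomog d R b f"
    and "\<And>M. M \<in> quotient_flags d R \<Longrightarrow> plucker_eval (\<lambda>c. c) (plucker_coord M) f = 0"
  shows "f \<in> flag_ideal d R"
  unfolding flag_ideal_def using assms(2) mhomog_carrier[OF f]
  by (auto simp: component_mhomog[OF f] eval_plucker_eq complex_algebra.plucker_eval_0[OF complex_algebra_id])

lemma mhomog_component:
  assumes "f \<in> carrier (plucker_ring d R)"
  shows "mhomog d R a (component a f)"
  using assms by (auto simp: mhomog_def mem_plucker_ring in_keys_iff lookup_component
      simp del: lookup_not_eq_zero_eq_in_keys split: if_splits)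

lemma sum_components: "f = (\<Sum>a\<in>multidegree ` Poly_Mapping.keys f. component a f)"
proof (rule poly_mapping_eqI)
  fix m
  have "(\<Sum>a\<in>multidegree ` Poly_Mapping.keys f. if a = multidegree m then Poly_Mapping.lookup f m else 0)
      = (if multidegree m \<in> multidegree ` Poly_Mapping.keys f then Poly_Mapping.lookup f m else 0)"
    by (rule sum.delta) simp
  also have "\<dots> = Poly_Mapping.lookup f m"
    by (auto simp: in_keys_iff simp del: lookup_not_eq_zero_eq_in_keys)
  finally show "Poly_Mapping.lookup f m
      = Poly_Mapping.lookup (\<Sum>a\<in>multidegree ` Poly_Mapping.keys f. component a f) m"
    unfolding lookup_sum lookup_component by (simp only: eq_commute[of "multidegree m"])
qed

subsection \<open>Quotient matrices in Pluecker coordinates\<close>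

text \<open>For distinct entries, the determinant of the permutation matrix that sorts
  \<open>L\<close>. The determinant also gives 0 for lists with repetitions, without a case
  distinction.\<close>

definition col_sign :: "nat list \<Rightarrow> complex" where
  "col_sign L = det (mat (length L) (length L) (\<lambda>(i, j). if sort L ! i = L ! j then 1 else 0))"

text \<open>The alternating extension of the Pluecker coordinates to arbitrary lists of columns: the
  sign of the sorting permutation times the coordinate of the sorted list, and \<open>0\<close> for a list
  with repetitions.\<close>

definition alt_var :: "nat list \<Rightarrow> plucker_poly" where
  "alt_var L = Poly_Mapping.single (Poly_Mapping.single (sort L) 1) (col_sign L)"

text \<open>By Cramer's rule, row \<open>l\<close> of this matrix is \<open>p\<^sub>J\<close> times row \<open>l\<close> of the representative
  of the universal quotient whose columns \<open>J\<close> form the identity matrix.\<close>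

definition cramer :: "nat \<Rightarrow> nat list \<Rightarrow> nat \<Rightarrow> nat \<Rightarrow> plucker_poly" where
  "cramer d J l k = (if l < length J \<and> k < d then alt_var (J[l := k]) else 0)"

lemma minor_not_distinct:
  assumes "\<not> distinct L"
  shows "minor Y L = 0"
proof -
  obtain i j where ij: "i < length L" "j < length L" "i \<noteq> j" "L ! i = L ! j"
    using assms by (auto simp: distinct_conv_nth)
  show ?thesis
    unfolding minor_def
    by (rule det_identical_columns[OF _ ij(3,1,2)]) (use ij in \<open>auto intro!: eq_vecI\<close>)
qed

lemma col_sign_minor: "col_sign L = minor (\<lambda>i k. if sort L ! i = k then 1 else 0) L"
  by (simp add: col_sign_def minor_def)

text \<open>The square matrix with columns \<open>L\<close> is the one with columns
  \<open>sort L\<close> times the permutation matrix behind \<open>col_sign\<close>; repeated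
  columns make both sides zero.\<close>

lemma minor_sort: "minor Y L = col_sign L * minor Y (sort L)"
proof (cases "distinct L")
  case True
  let ?n = "length L"
  let ?A = "mat ?n ?n (\<lambda>(i, j). Y i (sort L ! j))"
  let ?B = "mat ?n ?n (\<lambda>(i, j). if sort L ! i = L ! j then 1 else 0)"
  have eq: "mat ?n ?n (\<lambda>(i, j). Y i (L ! j)) = ?A * ?B"
  proof (rule eq_matI)
    fix i j assume "i < dim_row (?A * ?B)" "j < dim_col (?A * ?B)"
    then have ij: "i < ?n" "j < ?n" by simp_all
    have "L ! j \<in> set (sort L)" using ij by simp
    then obtain k where k: "k < ?n" "sort L ! k = L ! j"
      unfolding in_set_conv_nth by auto
    have eqv: "sort L ! k' = L ! j \<longleftrightarrow> k' = k" if "k' < ?n" for k'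
      using that k True nth_eq_iff_index_eq[of "sort L" k' k] by auto
    have "(\<Sum>k'<?n. Y i (sort L ! k') * (if sort L ! k' = L ! j then 1 else 0))
        = (\<Sum>k'<?n. if k' = k then Y i (L ! j) else 0)"
      by (rule sum.cong) (auto simp: eqv k(2))
    then show "mat ?n ?n (\<lambda>(i, j). Y i (L ! j)) $$ (i, j) = (?A * ?B) $$ (i, j)"
      using ij k by (simp add: scalar_prod_def lessThan_atLeast0)
  qed simp_all
  have "det (?A * ?B) = det ?A * det ?B"
    by (rule det_mult) auto
  then show ?thesis
    unfolding minor_def col_sign_def length_sort eq by (simp only: mult.commute)
next
  case False
  then show ?thesis by (simp add: minor_not_distinct col_sign_minor)
qed

lemma col_sign_sorted:
  assumes "sorted_wrt (<) L"
  shows "col_sign L = 1"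
proof -
  have "sort L = L" "distinct L"
    using assms strict_sorted_iff[of L] by (auto simp: sort_key_id_if_sorted sorted_sort_id)
  then have "mat (length L) (length L) (\<lambda>(i, j). if sort L ! i = L ! j then 1 else 0) = (1\<^sub>m (length L) :: complex mat)"
    by (intro eq_matI) (auto simp: nth_eq_iff_index_eq)
  then show ?thesis unfolding col_sign_def by simp
qed

lemma alt_var_sorted:
  assumes "sorted_wrt (<) L"
  shows "alt_var L = plucker_var L"
  using assms col_sign_sorted[OF assms] strict_sorted_iff[of L]
  by (auto simp: alt_var_def plucker_var_def sort_key_id_if_sorted sorted_sort_id)

lemma alt_var_not_distinct: "\<not> distinct L \<Longrightarrow> alt_var L = 0"
  by (simp add: alt_var_def col_sign_minor minor_not_distinct)

definition unit_degree :: "nat \<Rightarrow> nat \<Rightarrow> nat" where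
  "unit_degree s k = (if k = s then 1 else 0)"

lemma multidegree_single: "multidegree (Poly_Mapping.single I (Suc 0)) = unit_degree (length I)"
proof
  fix k
  have "{Ia \<in> Poly_Mapping.keys (Poly_Mapping.single I (Suc 0)). length Ia = k} = (if length I = k then {I} else {})"
    by auto
  then show "multidegree (Poly_Mapping.single I (Suc 0)) k = unit_degree (length I) k"
    by (simp add: multidegree_def unit_degree_def)
qed

lemma mhomog_var: "I \<in> plucker_index d R \<Longrightarrow> mhomog d R (unit_degree (length I)) (plucker_var I)"
  by (auto simp: mhomog_def mem_plucker_ring plucker_var_def multidegree_single)

lemma mhomog_alt_var:
  assumes "set L \<subseteq> {..<d}" "length L \<in> R"
  shows "mhomog d R (unit_degree (length L)) (alt_var L)"
proof (cases "distinct L")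
  case True
  then have "sort L \<in> plucker_index d R"
    using assms strict_sorted_iff[of "sort L"] by (auto simp: plucker_index_def)
  then show ?thesis
    by (auto simp: mhomog_def mem_plucker_ring alt_var_def multidegree_single split: if_splits)
qed (simp add: alt_var_not_distinct mhomog_0)

lemma mhomog_cramer:
  assumes "set J \<subseteq> {..<d}" "length J \<in> R"
  shows "mhomog d R (unit_degree (length J)) (cramer d J l k)"
proof (cases "l < length J \<and> k < d")
  case True
  then have "set (J[l := k]) \<subseteq> {..<d}"
    using assms(1) set_update_subset_insert[of J l k] by auto
  then show ?thesis
    using True assms(2) mhomog_alt_var[of "J[l := k]" d R] by (simp add: cramer_def)
qed (auto simp: cramer_def mhomog_0)

definition flag_entry :: "(nat \<Rightarrow> complex mat) \<Rightarrow> nat \<Rightarrow> nat \<Rightarrow> nat \<Rightarrow> complex" where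
  "flag_entry M s i k = M s $$ (i, k)"

lemma plucker_coord_minor:
  assumes "M (length L) \<in> carrier_mat (length L) d" "set L \<subseteq> {..<d}"
  shows "plucker_coord M L = minor (flag_entry M (length L)) L"
proof -
  have "mat_of_cols (length L) (map (col (M (length L))) L)
      = mat (length L) (length L) (\<lambda>(i, j). M (length L) $$ (i, L ! j))"
    using assms by (intro eq_matI) (auto simp: mat_of_cols_index subset_iff)
  then show ?thesis by (simp add: plucker_coord_def minor_def flag_entry_def)
qed

lemma eval_alt_var:
  assumes "M (length L) \<in> carrier_mat (length L) d" "set L \<subseteq> {..<d}"
  shows "plucker_eval (\<lambda>c. c) (plucker_coord M) (alt_var L) = minor (flag_entry M (length L)) L"
  using plucker_coord_minor[of M "sort L" d] assms minor_sort[of "flag_entry M (length L)" L]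
  by (simp add: alt_var_def complex_algebra.plucker_eval_single[OF complex_algebra_id])

lemma eval_cramer:
  assumes "M (length J) \<in> carrier_mat (length J) d" "set J \<subseteq> {..<d}" "l < length J" "k < d"
  shows "plucker_eval (\<lambda>c. c) (plucker_coord M) (cramer d J l k) = minor (flag_entry M (length J)) (J[l := k])"
proof -
  have "set (J[l := k]) \<subseteq> {..<d}"
    using assms set_update_subset_insert[of J l k] by auto
  then show ?thesis
    using assms eval_alt_var[of M "J[l := k]" d] by (simp add: cramer_def)
qed

abbreviation minor_mat :: "(nat \<Rightarrow> nat \<Rightarrow> 'a) \<Rightarrow> nat list \<Rightarrow> 'a mat" where
  "minor_mat Y J \<equiv> mat (length J) (length J) (\<lambda>(i, j). Y i (J ! j))"

text \<open>The cofactors along column \<open>l\<close> do not see the replaced column. So the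
  matrix with entries \<open>minor Y (J[l := k])\<close> is the adjugate of the block
  \<open>Y_J\<close> times \<open>Y\<close>, which is how the next two lemmas use it.\<close>

lemma minor_update:
  assumes l: "l < length J"
  shows "minor Y (J[l := k]) = (\<Sum>i<length J. Y i k * cofactor (minor_mat Y J) i l)"
proof -
  have "cofactor (minor_mat Y (J[l := k])) i l = cofactor (minor_mat Y J) i l" for i
  proof -
    have "mat_delete (minor_mat Y (J[l := k])) i l = mat_delete (minor_mat Y J) i l"
      using l by (intro eq_matI) (auto simp: mat_delete_def)
    then show ?thesis by (simp add: cofactor_def)
  qed
  then show ?thesis
    unfolding minor_def using l
    by (subst laplace_expansion_column[of _ "length J" l]) (auto intro!: sum.cong)
qed

text \<open>This is the entry \<open>(i, k)\<close> of \<open>A adj(A) Y = det(A) Y\<close> for the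
  block \<open>A\<close> of columns \<open>J\<close>.\<close>

lemma cramer_rule:
  assumes i: "i < length J"
  shows "(\<Sum>l<length J. Y i (J ! l) * minor Y (J[l := k])) = minor Y J * Y i k"
proof -
  let ?n = "length J" and ?A = "minor_mat Y J"
  have adj: "(\<Sum>l<?n. Y i (J ! l) * cofactor ?A i' l) = (if i' = i then minor Y J else 0)"
    if i': "i' < ?n" for i'
  proof -
    have "(?A * adj_mat ?A) $$ (i, i') = (\<Sum>l<?n. Y i (J ! l) * cofactor ?A i' l)"
      using i i' by (simp add: adj_mat_def scalar_prod_def lessThan_atLeast0)
    then show ?thesis
      using adj_mat(2)[of ?A ?n] i i' by (auto simp: minor_def)
  qed
  have "(\<Sum>l<?n. Y i (J ! l) * minor Y (J[l := k]))
      = (\<Sum>l<?n. \<Sum>i'<?n. Y i' k * (Y i (J ! l) * cofactor ?A i' l))"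
    by (intro sum.cong) (auto simp: minor_update sum_distrib_left algebra_simps)
  also have "\<dots> = (\<Sum>i'<?n. Y i' k * (\<Sum>l<?n. Y i (J ! l) * cofactor ?A i' l))"
    by (subst sum.swap) (simp add: sum_distrib_left)
  also have "\<dots> = (\<Sum>i'<?n. if i' = i then Y i k * minor Y J else 0)"
    by (intro sum.cong) (auto simp: adj)
  also have "\<dots> = minor Y J * Y i k" using i by simp
  finally show ?thesis .
qed

text \<open>Take determinants of \<open>adj(A) Y_I\<close>. The extra factor
  \<open>minor Y J\<close> turns \<open>det(adj(A)) = det(A)^(n-1)\<close> into an identity that
  needs no division and also makes sense for \<open>n = 0\<close>.\<close>

lemma minor_cramer:
  assumes "length I = length J"
  shows "minor Y J * minor (\<lambda>l k. minor Y (J[l := k])) I = minor Y J ^ length J * minor Y I"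
proof -
  let ?n = "length J" and ?A = "minor_mat Y J"
  have A: "?A \<in> carrier_mat ?n ?n" by simp
  note adj = adj_mat[OF A]
  have "minor_mat (\<lambda>l k. minor Y (J[l := k])) I = adj_mat ?A * minor_mat Y I"
    using assms
    by (intro eq_matI) (auto simp: minor_update adj_mat_def scalar_prod_def lessThan_atLeast0 mult.commute)
  then have "minor (\<lambda>l k. minor Y (J[l := k])) I = det (adj_mat ?A) * minor Y I"
    unfolding minor_def using det_mult[of "adj_mat ?A" ?n "minor_mat Y I"] adj(1) assms by simp
  moreover have "det ?A * det (adj_mat ?A) = det ?A ^ ?n"
    using det_mult[OF A adj(1)] adj(2) by (simp add: det_smult)
  ultimately show ?thesis
    by (simp add: minor_def mult.assoc[symmetric])
qed

text \<open>By linearity, Cramer's rule expresses every vector in the row space of a matrix through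
  its entries in the columns \<open>J\<close>, up to the factor \<open>det(Y_J)\<close>; in a flag,
  the rows of the smaller quotient are such vectors. Read modulo a prime, the relation makes the
  factorization of quotients available at non-closed points.\<close>

lemma cramer_rows_in_flag_ideal:
  assumes J: "J \<in> plucker_index d {s}" and I: "I \<in> plucker_index d {r}"
    and rs: "r \<in> R" "s \<in> R" "r \<le> s" and l: "l < r" and k: "k < d"
  shows "plucker_var J * cramer d I l k - (\<Sum>m<s. cramer d I l (J ! m) * cramer d J m k) \<in> flag_ideal d R"
    (is "?f \<in> _")
proof (rule mhomog_in_flag_ideal)
  have JI: "set J \<subseteq> {..<d}" "length J = s" "set I \<subseteq> {..<d}" "length I = r"
    "sorted_wrt (<) J"
    using J I by (auto simp: plucker_index_def)
  have hI: "mhomog d R (unit_degree r) (cramer d I l k')" for k'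
    using mhomog_cramer[of I d R] JI rs by simp
  have hJ: "mhomog d R (unit_degree s) (cramer d J m k')" for m k'
    using mhomog_cramer[of J d R] JI rs by simp
  have hJ': "mhomog d R (unit_degree s) (plucker_var J)"
    using mhomog_var[of J d R] J JI rs by (auto simp: plucker_index_def)
  let ?a = "\<lambda>k. unit_degree s k + unit_degree r k"
  show "mhomog d R ?a ?f"
    by (intro mhomog_diff mhomog_sum mhomog_mult[OF hJ' hI] mhomog_mult[OF hI hJ]) auto
  fix M assume M: "M \<in> quotient_flags d R"
  have Mr: "M r \<in> carrier_mat r d" and Ms: "M s \<in> carrier_mat s d"
    using M rs by (auto simp: quotient_flags_def quotient_mat_def)
  obtain A where A: "A \<in> carrier_mat r s" "M r = A * M s"
    using M rs unfolding quotient_flags_def by blast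
  let ?Y = "flag_entry M s" and ?Z = "flag_entry M r"
  have Z: "?Z i k = (\<Sum>j<s. A $$ (i, j) * ?Y j k)" if "i < r" "k < d" for i k
    using A Ms that by (simp add: flag_entry_def scalar_prod_def lessThan_atLeast0)
  \<comment> \<open>Row \<open>l\<close> of \<open>adj(Z_I) A\<close>: the coefficients of the
    Cramer row of the smaller quotient in terms of the rows of the larger one.\<close>
  define b where "b j = (\<Sum>i<r. cofactor (minor_mat ?Z I) i l * A $$ (i, j))" for j
  have row: "minor ?Z (I[l := k]) = (\<Sum>j<s. b j * ?Y j k)" if "k < d" for k
  proof -
    have "minor ?Z (I[l := k]) = (\<Sum>i<r. \<Sum>j<s. (cofactor (minor_mat ?Z I) i l * A $$ (i, j)) * ?Y j k)"
      using l JI that by (simp add: minor_update Z sum_distrib_left sum_distrib_right algebra_simps)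
    also have "\<dots> = (\<Sum>j<s. b j * ?Y j k)"
      unfolding b_def sum_distrib_right by (rule sum.swap)
    finally show ?thesis .
  qed
  have Jd: "J ! m < d" if "m < s" for m
    using JI(1,2) that nth_mem[of m J] by blast
  have "(\<Sum>m<s. minor ?Z (I[l := J ! m]) * minor ?Y (J[m := k]))
      = (\<Sum>m<s. \<Sum>j<s. b j * (?Y j (J ! m) * minor ?Y (J[m := k])))"
    by (intro sum.cong) (auto simp: row Jd sum_distrib_left algebra_simps)
  also have "\<dots> = (\<Sum>j<s. b j * (\<Sum>m<s. ?Y j (J ! m) * minor ?Y (J[m := k])))"
    by (subst sum.swap) (simp add: sum_distrib_left)
  also have "\<dots> = (\<Sum>j<s. b j * (minor ?Y J * ?Y j k))"
    using JI(2) by (auto intro!: sum.cong simp: cramer_rule)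
  also have "\<dots> = minor ?Y J * minor ?Z (I[l := k])"
    by (simp add: row k sum_distrib_left algebra_simps)
  finally have *: "(\<Sum>m<s. minor ?Z (I[l := J ! m]) * minor ?Y (J[m := k])) = minor ?Y J * minor ?Z (I[l := k])" .
  interpret ev: comm_ring_hom "plucker_eval (\<lambda>c. c) (plucker_coord M)"
    by (rule complex_algebra.plucker_eval_hom[OF complex_algebra_id])
  have "plucker_eval (\<lambda>c. c) (plucker_coord M) (plucker_var J) = minor ?Y J"
    using eval_alt_var[of M J d] JI Ms by (simp add: alt_var_sorted)
  moreover have "plucker_eval (\<lambda>c. c) (plucker_coord M) (cramer d I l k') = minor ?Z (I[l := k'])" if "k' < d" for k'
    using eval_cramer[of M I d] JI Mr l that by simp
  moreover have "plucker_eval (\<lambda>c. c) (plucker_coord M) (cramer d J m k) = minor ?Y (J[m := k])" if "m < s" for m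
    using eval_cramer[of M J d] JI Ms k that by simp
  ultimately show "plucker_eval (\<lambda>c. c) (plucker_coord M) ?f = 0"
    using * k Jd by (simp add: ev.hom_minus ev.hom_mult ev.hom_sum)
qed

text \<open>The universal form of \<open>minor_cramer\<close>: up to powers of \<open>p_J\<close>,
  the Cramer matrix has the Pluecker coordinates of the point itself.\<close>

lemma minor_cramer_in_flag_ideal:
  assumes J: "J \<in> plucker_index d {s}" and I: "I \<in> plucker_index d {s}"
  shows "plucker_var J * minor (cramer d J) I - plucker_var J ^ s * plucker_var I \<in> flag_ideal d {s}"
    (is "?f \<in> _")
proof (rule mhomog_in_flag_ideal)
  have JI: "set J \<subseteq> {..<d}" "length J = s" "set I \<subseteq> {..<d}" "length I = s"
    "sorted_wrt (<) J" "sorted_wrt (<) I"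
    using J I by (auto simp: plucker_index_def)
  have h: "mhomog d {s} (unit_degree s) (plucker_var L)" if "L \<in> plucker_index d {s}" for L
    using mhomog_var[OF that] that by (auto simp: plucker_index_def)
  have m: "mhomog d {s} (\<lambda>k. s * unit_degree s k) (minor (cramer d J) I)"
    using mhomog_minor[of I d "{s}" "unit_degree s" "cramer d J"] mhomog_cramer[of J d "{s}"] JI by simp
  show "mhomog d {s} (\<lambda>k. unit_degree s k + s * unit_degree s k) ?f"
    by (rule mhomog_diff[OF mhomog_mult[OF h[OF J] m] mhomog_mult[OF mhomog_power[OF h[OF J]] h[OF I]]]) simp_all
  fix M assume "M \<in> quotient_flags d {s}"
  then have M: "M s \<in> carrier_mat s d"
    by (auto simp: quotient_flags_def quotient_mat_def)
  let ?Y = "flag_entry M s"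
  interpret ev: comm_ring_hom "plucker_eval (\<lambda>c. c) (plucker_coord M)"
    by (rule complex_algebra.plucker_eval_hom[OF complex_algebra_id])
  have v: "plucker_eval (\<lambda>c. c) (plucker_coord M) (plucker_var L) = minor ?Y L" if "L \<in> plucker_index d {s}" for L
    using eval_alt_var[of M L d] M that by (auto simp: alt_var_sorted plucker_index_def)
  have "minor_mat (\<lambda>l k. plucker_eval (\<lambda>c. c) (plucker_coord M) (cramer d J l k)) I
      = minor_mat (\<lambda>l k. minor ?Y (J[l := k])) I"
  proof (rule eq_matI)
    fix i j assume "i < dim_row (minor_mat (\<lambda>l k. minor ?Y (J[l := k])) I)"
      "j < dim_col (minor_mat (\<lambda>l k. minor ?Y (J[l := k])) I)"
    then have ij: "i < length I" "j < length I" by simp_all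
    then have "I ! j < d" using JI(3) nth_mem[of j I] by blast
    then show "minor_mat (\<lambda>l k. plucker_eval (\<lambda>c. c) (plucker_coord M) (cramer d J l k)) I $$ (i, j)
        = minor_mat (\<lambda>l k. minor ?Y (J[l := k])) I $$ (i, j)"
      using eval_cramer[of M J d i "I ! j"] JI M ij by simp
  qed simp_all
  from arg_cong[OF this, of det]
  have mn: "plucker_eval (\<lambda>c. c) (plucker_coord M) (minor (cramer d J) I) = minor (\<lambda>l k. minor ?Y (J[l := k])) I"
    unfolding ev.hom_minor by (simp only: minor_def[of _ I])
  have "minor ?Y J * minor (\<lambda>l k. minor ?Y (J[l := k])) I = minor ?Y J ^ s * minor ?Y I"
    using minor_cramer[of I J ?Y] JI by simp
  then show "plucker_eval (\<lambda>c. c) (plucker_coord M) ?f = 0"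
    unfolding ev.hom_minus ev.hom_mult ev.hom_power v[OF J] v[OF I] mn by simp
qed

subsection \<open>Primes of the coordinate rings as primes of the ambient ring\<close>

lemma const_poly_in_carrier: "const_poly c \<in> carrier (plucker_ring d R)"
  by (simp add: const_poly_def mem_plucker_ring)

lemma plucker_var_in_carrier: "I \<in> plucker_index d R \<Longrightarrow> plucker_var I \<in> carrier (plucker_ring d R)"
  by (simp add: plucker_var_def mem_plucker_ring)

lemma plucker_ring_add_closed:
  "f \<in> carrier (plucker_ring d R) \<Longrightarrow> g \<in> carrier (plucker_ring d R) \<Longrightarrow> f + g \<in> carrier (plucker_ring d R)"
  using Poly_Mapping.keys_add[of f g] unfolding mem_plucker_ring by blast

lemma plucker_ring_0_closed: "0 \<in> carrier (plucker_ring d R)"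
  and plucker_ring_1_closed: "1 \<in> carrier (plucker_ring d R)"
  by (simp_all add: mem_plucker_ring)

lemma plucker_ring_sum_closed:
  "(\<And>i. i \<in> A \<Longrightarrow> f i \<in> carrier (plucker_ring d R)) \<Longrightarrow> (\<Sum>i\<in>A. f i) \<in> carrier (plucker_ring d R)"
  by (induction A rule: infinite_finite_induct) (auto intro: plucker_ring_0_closed plucker_ring_add_closed)

lemma plucker_ring_prod_closed:
  "(\<And>i. i \<in> A \<Longrightarrow> f i \<in> carrier (plucker_ring d R)) \<Longrightarrow> (\<Prod>i\<in>A. f i) \<in> carrier (plucker_ring d R)"
  by (induction A rule: infinite_finite_induct) (auto intro: plucker_ring_1_closed plucker_ring_mult_closed)

lemma plucker_ring_power_closed:
  "f \<in> carrier (plucker_ring d R) \<Longrightarrow> f ^ n \<in> carrier (plucker_ring d R)"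
  by (induction n) (auto intro: plucker_ring_1_closed plucker_ring_mult_closed)

lemma plucker_eval_in_carrier:
  assumes "\<And>I. x I \<in> carrier (plucker_ring d R)"
  shows "plucker_eval const_poly x f \<in> carrier (plucker_ring d R)"
  unfolding plucker_eval_def mono_eval_def
  by (intro plucker_ring_sum_closed plucker_ring_mult_closed plucker_ring_prod_closed
      plucker_ring_power_closed const_poly_in_carrier assms)

lemma minor_in_carrier:
  assumes Y: "\<And>i k. Y i k \<in> carrier (plucker_ring d R)"
  shows "minor Y I \<in> carrier (plucker_ring d R)"
proof -
  have "minor Y I = (\<Sum>p\<in>{p. p permutes {0..<length I}}. signof p * (\<Prod>i = 0..<length I. Y i (I ! p i)))"
    unfolding minor_def det_def'[of _ "length I", OF mat_carrier]
    by (intro sum.cong refl arg_cong2[of _ _ _ _ "(*)"] prod.cong) (auto simp: permutes_in_image)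
  moreover have "signof p \<in> carrier (plucker_ring d R)" for p
    by (auto simp: sign_def mem_plucker_ring)
  ultimately show ?thesis
    by (auto intro!: plucker_ring_sum_closed plucker_ring_mult_closed plucker_ring_prod_closed Y)
qed

lemma minor_eval_in_carrier:
  assumes "\<And>i k. Y i k \<in> carrier (plucker_ring d R)"
  shows "minor_eval const_poly Y f \<in> carrier (plucker_ring d R)"
  unfolding minor_eval_def by (intro plucker_eval_in_carrier minor_in_carrier assms)

lemma prod_single_1:
  "(\<Prod>i\<in>A. Poly_Mapping.single (a i) (1::complex)) = Poly_Mapping.single (\<Sum>i\<in>A. a i) 1"
  by (induction A rule: infinite_finite_induct) (simp_all add: mult_single)

lemma mono_eval_plucker_var:
  assumes "\<And>I. I \<in> Poly_Mapping.keys m \<Longrightarrow> x I = plucker_var I"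
  shows "mono_eval x m = Poly_Mapping.single m 1"
proof -
  have pow: "plucker_var I ^ n = Poly_Mapping.single (Poly_Mapping.single I n) 1" for I n
    by (induction n) (simp_all add: plucker_var_def mult_single single_add[symmetric])
  have "mono_eval x m = (\<Prod>I\<in>Poly_Mapping.keys m.
      Poly_Mapping.single (Poly_Mapping.single I (Poly_Mapping.lookup m I)) 1)"
    unfolding mono_eval_def using assms by (intro prod.cong) (auto simp: pow)
  also have "\<dots> = Poly_Mapping.single m 1"
    unfolding prod_single_1 plucker_poly_expand[of m, symmetric] ..
  finally show ?thesis .
qed

text \<open>A retraction of the ambient polynomial ring onto the coordinate ring; pulling a prime
  back along it gives a prime of the whole type with the same trace on the coordinate ring.\<close>

definition restrict_vars :: "nat \<Rightarrow> nat set \<Rightarrow> plucker_poly \<Rightarrow> plucker_poly" where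
  "restrict_vars d R =
     plucker_eval const_poly (\<lambda>I. if I \<in> plucker_index d R then plucker_var I else 0)"

lemma restrict_vars_hom: "comm_ring_hom (restrict_vars d R)"
  unfolding restrict_vars_def by (rule const_poly.plucker_eval_hom)

lemma restrict_vars_in_carrier: "restrict_vars d R f \<in> carrier (plucker_ring d R)"
  unfolding restrict_vars_def
  by (rule plucker_eval_in_carrier) (auto intro: plucker_var_in_carrier plucker_ring_0_closed)

lemma restrict_vars_id:
  assumes "f \<in> carrier (plucker_ring d R)"
  shows "restrict_vars d R f = f"
proof -
  have "restrict_vars d R f
      = (\<Sum>m\<in>Poly_Mapping.keys f. const_poly (Poly_Mapping.lookup f m) * Poly_Mapping.single m 1)"
    unfolding restrict_vars_def plucker_eval_def using assms
    by (intro sum.cong refl arg_cong2[of _ _ _ _ "(*)"] mono_eval_plucker_var) (auto simp: mem_plucker_ring)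
  also have "\<dots> = (\<Sum>m\<in>Poly_Mapping.keys f. Poly_Mapping.single m (Poly_Mapping.lookup f m))"
    by (simp add: const_poly_def mult_single)
  also have "\<dots> = f"
    by (rule plucker_poly_expand[symmetric])
  finally show ?thesis .
qed

definition prime_ext :: "nat \<Rightarrow> nat set \<Rightarrow> plucker_poly set \<Rightarrow> plucker_poly set" where
  "prime_ext d R P = {f. restrict_vars d R f \<in> P}"

lemma mem_prime_ext: "f \<in> carrier (plucker_ring d R) \<Longrightarrow> f \<in> prime_ext d R P \<longleftrightarrow> f \<in> P"
  by (simp add: prime_ext_def restrict_vars_id)

lemma prime_set_prime_ext:
  assumes "primeideal P (plucker_ring d R)"
  shows "prime_set (prime_ext d R P)"
proof -
  interpret P: primeideal P "plucker_ring d R" by fact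
  have ops: "x \<otimes>\<^bsub>plucker_ring d R\<^esub> y = x * y" "x \<oplus>\<^bsub>plucker_ring d R\<^esub> y = x + y"
    "\<zero>\<^bsub>plucker_ring d R\<^esub> = 0" "\<one>\<^bsub>plucker_ring d R\<^esub> = 1" for x y
    by (simp_all add: plucker_ring_def)
  have zero: "0 \<in> P"
    using additive_subgroup.zero_closed[OF P.additive_subgroup_axioms] unfolding ops .
  have one: "1 \<notin> P"
    using P.I_notcarr P.one_imp_carrier unfolding ops by auto
  have add: "x + y \<in> P" if "x \<in> P" "y \<in> P" for x y
    using additive_subgroup.a_closed[OF P.additive_subgroup_axioms that] unfolding ops .
  have mult: "r * x \<in> P" if "x \<in> P" "r \<in> carrier (plucker_ring d R)" for x r
    using P.I_l_closed[OF that] unfolding ops .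
  have prime: "x \<in> P \<or> y \<in> P"
    if "x * y \<in> P" "x \<in> carrier (plucker_ring d R)" "y \<in> carrier (plucker_ring d R)" for x y
    using P.I_prime[OF that(2,3)] that(1) unfolding ops by blast
  interpret h: comm_ring_hom "restrict_vars d R" by (rule restrict_vars_hom)
  show ?thesis
    unfolding prime_set_def ideal_set_def prime_ext_def mem_Collect_eq h.hom_add h.hom_mult h.hom_zero h.hom_one
    using zero one add mult prime restrict_vars_in_carrier by (auto simp: Ball_def)
qed

lemma flag_ideal_carrier: "flag_ideal d R \<subseteq> carrier (plucker_ring d R)"
  by (auto simp: flag_ideal_def)

lemma flag_scheme_prime_ext:
  assumes "P \<in> flag_scheme d R"
  shows "prime_set (prime_ext d R P)" "flag_ideal d R \<subseteq> prime_ext d R P"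
  using assms prime_set_prime_ext mem_prime_ext flag_ideal_carrier
  unfolding flag_scheme_def by blast+

lemma prime_set_ideal: "prime_set P \<Longrightarrow> ideal_set P"
  by (simp add: prime_set_def)

lemma prime_set_power: "prime_set P \<Longrightarrow> x \<notin> P \<Longrightarrow> x ^ n \<notin> P"
  by (induction n) (auto simp: prime_set_def)

subsection \<open>The cone of matrices over a quotient\<close>

text \<open>The product of a \<open>d\<close> by \<open>s\<close> and an \<open>s\<close> by
  \<open>d\<close> matrix, continued by zero outside the \<open>d\<close> by \<open>d\<close>
  square. The fixed size \<open>d\<close> lets all ranks share one space of matrices.\<close>

definition combine :: "nat \<Rightarrow> nat \<Rightarrow> (nat \<Rightarrow> nat \<Rightarrow> 'a::comm_ring_1) \<Rightarrow> (nat \<Rightarrow> nat \<Rightarrow> 'a) \<Rightarrow> nat \<Rightarrow> nat \<Rightarrow> 'a" where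
  "combine d s N X i k = (if i < d \<and> k < d then \<Sum>l<s. N i l * X l k else 0)"

lemma card_of_nat_complex: "finite ((of_nat :: nat \<Rightarrow> complex) ` {..n})" "card ((of_nat :: nat \<Rightarrow> complex) ` {..n}) = Suc n"
  by (simp_all add: card_image)

lemma (in complex_algebra) minor_eval_update:
  assumes "\<And>t i k. Y t i k = Y0 i k + t * Y1 i k"
  shows "\<exists>q. degree q \<le> minor_degree f \<and> (\<forall>t. poly q t = minor_eval \<kappa> (Y t) f)"
proof -
  have "Y t = (\<lambda>i k. Y0 i k + t * Y1 i k)" for t
    using assms by (simp add: fun_eq_iff)
  then show ?thesis using minor_eval_line[of f Y0 Y1] by simp
qed

text \<open>The value is a polynomial of bounded degree in each of the finitely many entries of
  \<open>N\<close> that matter, so interpolation on a grid of complex constants reaches every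
  \<open>N\<close> over the ring.\<close>

lemma (in complex_algebra) ideal_combine:
  assumes P: "ideal_set P"
    and *: "\<And>N :: nat \<Rightarrow> nat \<Rightarrow> complex. minor_eval \<kappa> (combine d s (\<lambda>i l. \<kappa> (N i l)) X) f \<in> P"
  shows "minor_eval \<kappa> (combine d s N X) f \<in> P"
proof -
  let ?S = "{..<d} \<times> {..<s}" and ?T = "(of_nat :: nat \<Rightarrow> complex) ` {..minor_degree f}"
  let ?\<phi> = "\<lambda>N :: nat \<times> nat \<Rightarrow> 'a. minor_eval \<kappa> (combine d s (\<lambda>i l. N (i, l)) X) f"
  have restrict: "?\<phi> N = ?\<phi> (\<lambda>v. if v \<in> ?S then N v else 0)" for N
    by (intro arg_cong2[of _ _ _ _ "minor_eval \<kappa>"] refl ext) (auto simp: combine_def intro!: sum.cong)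
  have "?\<phi> (\<lambda>v. if v \<in> ?S then case_prod N v else 0) \<in> P"
  proof (rule ideal_grid[OF P, of ?S "minor_degree f" ?\<phi> ?T "\<lambda>_. 0"])
    fix N and v :: "nat \<times> nat" assume v: "v \<in> ?S"
    have "combine d s (\<lambda>i l. (N(v := t)) (i, l)) X i k = combine d s (\<lambda>i l. (N(v := 0)) (i, l)) X i k
        + t * (if i < d \<and> k < d \<and> i = fst v then X (snd v) k else 0)" for t i k
    proof (cases "i < d \<and> k < d \<and> i = fst v")
      case True
      have "(\<Sum>l<s. (N(v := t)) (i, l) * X l k)
          = (\<Sum>l<s. (N(v := 0)) (i, l) * X l k + (if l = snd v then t * X l k else 0))"
        using True by (intro sum.cong) (auto simp: prod_eq_iff)
      then show ?thesis
        using True v by (auto simp: combine_def sum.distrib)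
    next
      case False
      then show ?thesis by (auto simp: combine_def intro!: sum.cong)
    qed
    then show "\<exists>q. degree q \<le> minor_degree f \<and> (\<forall>t. poly q t = ?\<phi> (N(v := t)))"
      by (rule minor_eval_update)
  next
    fix N assume N: "\<forall>v\<in>?S. N v \<in> \<kappa> ` ?T" "\<forall>v. v \<notin> ?S \<longrightarrow> N v = 0"
    have "\<exists>c. N v = \<kappa> c" for v
    proof (cases "v \<in> ?S")
      case True
      then show ?thesis using N(1) by blast
    next
      case False
      then have "N v = \<kappa> 0" using N(2) by (metis hom_zero)
      then show ?thesis ..
    qed
    then obtain c where "N v = \<kappa> (c v)" for v by metis
    then show "?\<phi> N \<in> P" using *[of "\<lambda>i l. c (i, l)"] by simp
  qed (use card_of_nat_complex[of "minor_degree f"] in auto)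
  then show ?thesis using restrict[of "case_prod N"] by simp
qed

text \<open>Modulo \<open>P\<close> and up to the factor \<open>p\<^sub>J\<close>, these are the vectors in the row space of the universal
  quotient, expressed through their entries in the columns \<open>J\<close>.\<close>

definition row_space :: "nat \<Rightarrow> plucker_poly set \<Rightarrow> nat list \<Rightarrow> (nat \<Rightarrow> plucker_poly) set" where
  "row_space d P J = {y. \<forall>k<d.
     plucker_var J * y k - (\<Sum>m<length J. y (J ! m) * cramer d J m k) \<in> P}"

definition cone_point :: "nat \<Rightarrow> nat list \<Rightarrow> (nat \<Rightarrow> nat \<Rightarrow> complex) \<Rightarrow> nat \<Rightarrow> nat \<Rightarrow> plucker_poly" where
  "cone_point d J N = combine d (length J) (\<lambda>i l. const_poly (N i l)) (cramer d J)"

text \<open>Modulo \<open>P\<close>, the matrix \<open>p_J Y\<close> is the part of \<open>Y\<close>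
  in the columns \<open>J\<close> times the Cramer matrix. Since \<open>f\<close> need not be
  homogeneous, \<open>p_J\<close> cannot simply be pulled out; it is cancelled along the line
  through 0 and \<open>Y\<close>, one coefficient at a time.\<close>

lemma minor_eval_row_space:
  assumes P: "prime_set P" and pJ: "plucker_var J \<notin> P"
    and cone: "\<And>N. minor_eval const_poly (cone_point d J N) f \<in> P"
    and Y: "\<And>i. i < d \<Longrightarrow> Y i \<in> row_space d P J" "\<And>i k. \<not> (i < d \<and> k < d) \<Longrightarrow> Y i k = 0"
  shows "minor_eval const_poly Y f \<in> P"
proof -
  note I = prime_set_ideal[OF P]
  let ?p = "plucker_var J"
  obtain q where q: "\<And>t. poly q t = minor_eval const_poly (\<lambda>i k. 0 + t * Y i k) f"
    using const_poly.minor_eval_line[of f "\<lambda>_ _. 0" Y] by blast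
  have q_in: "poly q (const_poly c * ?p) \<in> P" for c
  proof -
    let ?N = "\<lambda>i l. const_poly c * Y i (J ! l)"
    have "combine d (length J) ?N (cramer d J) i k - (0 + const_poly c * ?p * Y i k) \<in> P" for i k
    proof (cases "i < d \<and> k < d")
      case True
      then have "- (const_poly c * (?p * Y i k - (\<Sum>m<length J. Y i (J ! m) * cramer d J m k))) \<in> P"
        using Y(1)[of i] by (intro ideal_uminus[OF I] ideal_mult[OF I]) (auto simp: row_space_def)
      then show ?thesis
        using True by (simp add: combine_def algebra_simps sum_distrib_left)
    next
      case False
      then have "combine d (length J) ?N (cramer d J) i k = 0" "Y i k = 0"
        using Y(2) by (simp_all only: combine_def if_False)
      then show ?thesis by (simp add: ideal_0[OF I])
    qed
    then have "minor_eval const_poly (combine d (length J) ?N (cramer d J)) f - poly q (const_poly c * ?p) \<in> P"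
      unfolding q by (intro ideal_cong_minor_eval[OF I])
    moreover have "minor_eval const_poly (combine d (length J) ?N (cramer d J)) f \<in> P"
      using cone unfolding cone_point_def by (rule const_poly.ideal_combine[OF I])
    ultimately show ?thesis using ideal_cong[OF I] by blast
  qed
  \<comment> \<open>This is \<open>q(p_J X)\<close>, whose coefficients are those of
    \<open>q\<close> times powers of \<open>p_J\<close>. Its values at all constants lie in
    \<open>P\<close>, and \<open>p_J\<close> is outside the prime \<open>P\<close>, so the
    coefficients of \<open>q\<close> lie in \<open>P\<close>; evaluation at 1 returns to
    \<open>Y\<close>.\<close>
  let ?r = "pcompose q [:0, ?p:]"
  have "coeff ?r i \<in> P" for i
    using card_of_nat_complex[of "degree ?r"] q_in
    by (intro const_poly.ideal_coeffs[OF I, of "of_nat ` {..degree ?r}"]) (auto simp: poly_pcompose)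
  then have "?p ^ i * coeff q i \<in> P" for i
    by (metis coeff_pcompose_linear)
  then have "coeff q i \<in> P" for i
    using P prime_set_power[OF P pJ, of i] unfolding prime_set_def by blast
  then have "poly q 1 \<in> P" by (rule ideal_poly[OF I])
  then show ?thesis unfolding q by simp
qed

lemma cramer_in_row_space:
  assumes P: "ideal_set P" "flag_ideal d R \<subseteq> P"
    and J: "J \<in> plucker_index d {s}" and I: "I \<in> plucker_index d {r}"
    and rs: "r \<in> R" "s \<in> R" "r \<le> s" and l: "l < r"
  shows "cramer d I l \<in> row_space d P J"
proof -
  have "length J = s" using J by (simp add: plucker_index_def)
  then show ?thesis
    unfolding row_space_def using cramer_rows_in_flag_ideal[OF J I rs l] P(2) by auto
qed

lemma combine_in_row_space:
  assumes P: "ideal_set P" and X: "\<And>l. l < s \<Longrightarrow> X l \<in> row_space d P J" and J: "set J \<subseteq> {..<d}" and i: "i < d"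
  shows "combine d s N X i \<in> row_space d P J"
  unfolding row_space_def
proof (intro CollectI allI impI)
  fix k assume k: "k < d"
  have Jd: "J ! m < d" if "m < length J" for m
    using J nth_mem[OF that] by blast
  have "(\<Sum>m<length J. combine d s N X i (J ! m) * cramer d J m k)
      = (\<Sum>m<length J. \<Sum>l<s. N i l * (X l (J ! m) * cramer d J m k))"
    using i Jd by (intro sum.cong) (auto simp: combine_def sum_distrib_right mult.assoc)
  also have "\<dots> = (\<Sum>l<s. N i l * (\<Sum>m<length J. X l (J ! m) * cramer d J m k))"
    by (subst sum.swap) (simp add: sum_distrib_left)
  finally have "plucker_var J * combine d s N X i k - (\<Sum>m<length J. combine d s N X i (J ! m) * cramer d J m k)
      = (\<Sum>l<s. N i l * (plucker_var J * X l k - (\<Sum>m<length J. X l (J ! m) * cramer d J m k)))"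
    using i k by (simp add: combine_def sum_distrib_left sum_subtractf algebra_simps)
  also have "\<dots> \<in> P"
    using X k by (intro ideal_sum[OF P] ideal_mult[OF P]) (auto simp: row_space_def)
  finally show "plucker_var J * combine d s N X i k
      - (\<Sum>m<length J. combine d s N X i (J ! m) * cramer d J m k) \<in> P" .
qed

text \<open>The Cramer rows of the rank \<open>r\<close> quotient lie in the row space of the rank
  \<open>s\<close> quotient. For \<open>r < s\<close> this passes vanishing on to smaller quotients;
  for \<open>r = s\<close> it shows that the choice of the chart \<open>J\<close> does not
  matter.\<close>

lemma cone_transfer:
  assumes P: "prime_set P" "flag_ideal d R \<subseteq> P"
    and J: "J \<in> plucker_index d {s}" and I: "I \<in> plucker_index d {r}"
    and rs: "r \<in> R" "s \<in> R" "r \<le> s" and pJ: "plucker_var J \<notin> P"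
    and cone: "\<And>N. minor_eval const_poly (cone_point d J N) f \<in> P"
  shows "minor_eval const_poly (cone_point d I N) f \<in> P"
proof (rule minor_eval_row_space[OF P(1) pJ cone])
  have len: "length I = r" and Jd: "set J \<subseteq> {..<d}" using I J by (auto simp: plucker_index_def)
  show "cone_point d I N i \<in> row_space d P J" if "i < d" for i
    unfolding cone_point_def len
    by (intro combine_in_row_space[OF prime_set_ideal[OF P(1)] _ Jd that]
        cramer_in_row_space[OF prime_set_ideal[OF P(1)] P(2) J I rs])
qed (auto simp: cone_point_def combine_def)

text \<open>Quantifying over every \<open>J\<close>, including those with \<open>p_J\<close> in
  \<open>P\<close>, avoids the choice of a chart; by \<open>mem_cone_ideal\<close> any single chart
  with \<open>p_J\<close> outside \<open>P\<close> gives the same set.\<close>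

definition cone_ideal :: "nat \<Rightarrow> nat \<Rightarrow> plucker_poly set \<Rightarrow> plucker_poly set" where
  "cone_ideal d s P = {f. \<forall>J\<in>plucker_index d {s}. \<forall>N. minor_eval const_poly (cone_point d J N) f \<in> P}"

lemma cone_in_carrier:
  assumes "J \<in> plucker_index d {s}" "s \<in> R"
  shows "minor_eval const_poly (cone_point d J N) f \<in> carrier (plucker_ring d R)"
proof -
  have "cramer d J l k \<in> carrier (plucker_ring d R)" for l k
    using assms by (intro mhomog_carrier[OF mhomog_cramer]) (auto simp: plucker_index_def)
  then show ?thesis
    unfolding cone_point_def combine_def
    by (intro minor_eval_in_carrier)
      (auto intro!: plucker_ring_sum_closed plucker_ring_mult_closed const_poly_in_carrier plucker_ring_0_closed)
qed

lemma flag_scheme_nonzero: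
  assumes "P \<in> flag_scheme d R" "s \<in> R"
  obtains J where "J \<in> plucker_index d {s}" "plucker_var J \<notin> P" "plucker_var J \<notin> prime_ext d R P"
proof -
  obtain J where J: "J \<in> plucker_index d {s}" "plucker_var J \<notin> P"
    using assms unfolding flag_scheme_def by blast
  then have "J \<in> plucker_index d R" using assms(2) by (auto simp: plucker_index_def)
  then show ?thesis using that[OF J] J(2) mem_prime_ext plucker_var_in_carrier by blast
qed

lemma mem_cone_ideal:
  assumes P: "P \<in> Gr d s" and J: "J \<in> plucker_index d {s}" "plucker_var J \<notin> P"
  shows "f \<in> cone_ideal d s P \<longleftrightarrow> (\<forall>N. minor_eval const_poly (cone_point d J N) f \<in> P)"
proof
  assume cone: "\<forall>N. minor_eval const_poly (cone_point d J N) f \<in> P"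
  note P' = flag_scheme_prime_ext[OF P]
  have carr: "minor_eval const_poly (cone_point d I N) f \<in> carrier (plucker_ring d {s})"
    if "I \<in> plucker_index d {s}" for I N
    using cone_in_carrier[OF that] by simp
  have "minor_eval const_poly (cone_point d I N) f \<in> prime_ext d {s} P" if I: "I \<in> plucker_index d {s}" for I N
    by (rule cone_transfer[OF P' J(1) I])
      (use J cone carr[OF J(1)] mem_prime_ext plucker_var_in_carrier in auto)
  then show "f \<in> cone_ideal d s P"
    unfolding cone_ideal_def using carr mem_prime_ext by blast
qed (use J in \<open>auto simp: cone_ideal_def\<close>)

text \<open>Both cones are computed inside the flag prime \<open>F\<close>, where the rows of the
  two quotients can be compared. This inclusion is why vanishing loci are downwards closed.\<close>

lemma cone_ideal_forget:
  assumes F: "F \<in> flag_scheme d R" and rs: "r \<in> R" "s \<in> R" "r \<le> s"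
  shows "cone_ideal d s (forget d {s} F) \<subseteq> cone_ideal d r (forget d {r} F)"
proof
  fix f assume f: "f \<in> cone_ideal d s (forget d {s} F)"
  obtain J where J: "J \<in> plucker_index d {s}" "plucker_var J \<notin> prime_ext d R F"
    using flag_scheme_nonzero[OF F rs(2)] by metis
  have mem: "g \<in> forget d {t} F \<longleftrightarrow> g \<in> prime_ext d R F"
    if "g \<in> carrier (plucker_ring d {t})" "g \<in> carrier (plucker_ring d R)" for g t
    using that mem_prime_ext by (auto simp: forget_def)
  have J_in: "minor_eval const_poly (cone_point d J N) f \<in> prime_ext d R F" for N
    using f J(1) mem[OF cone_in_carrier cone_in_carrier] rs(2) unfolding cone_ideal_def by blast
  have "minor_eval const_poly (cone_point d I N) f \<in> forget d {r} F" if I: "I \<in> plucker_index d {r}" for I N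
    using cone_transfer[OF flag_scheme_prime_ext[OF F] J(1) I rs J(2) J_in, of N]
      mem[OF cone_in_carrier cone_in_carrier] I rs(1) by blast
  then show "f \<in> cone_ideal d r (forget d {r} F)"
    unfolding cone_ideal_def by blast
qed

text \<open>The space of the matrices \<open>N\<close> is irreducible: if \<open>f\<close> fails at
  \<open>N0\<close> and \<open>g\<close> at \<open>N1\<close>, both become univariate polynomials on
  the joining line, and one of them takes values in \<open>P\<close> at infinitely many integers,
  hence everywhere.\<close>

lemma prime_set_cone:
  assumes P: "prime_set P"
  shows "prime_set {f. \<forall>N. minor_eval const_poly (cone_point d J N) f \<in> P}"
proof -
  note I = prime_set_ideal[OF P]
  have add: "minor_eval const_poly Y (f + g) = minor_eval const_poly Y f + minor_eval const_poly Y g"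
    and mult: "minor_eval const_poly Y (f * g) = minor_eval const_poly Y f * minor_eval const_poly Y g"
    and zero: "minor_eval const_poly Y 0 = 0" and one: "minor_eval const_poly Y 1 = 1" for Y f g
    unfolding minor_eval_def
    by (simp_all add: const_poly.plucker_eval_add const_poly.plucker_eval_mult)
  have "(\<forall>N. minor_eval const_poly (cone_point d J N) f \<in> P) \<or> (\<forall>N. minor_eval const_poly (cone_point d J N) g \<in> P)"
    if fg: "\<forall>N. minor_eval const_poly (cone_point d J N) (f * g) \<in> P" for f g
  proof (rule ccontr)
    assume "\<not> ?thesis"
    then obtain N0 N1 where N: "minor_eval const_poly (cone_point d J N0) f \<notin> P"
      "minor_eval const_poly (cone_point d J N1) g \<notin> P" by blast
    let ?N = "\<lambda>c i l. N0 i l + c * (N1 i l - N0 i l)"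
    let ?Y0 = "cone_point d J N0" and ?Y1 = "\<lambda>i k. cone_point d J N1 i k - cone_point d J N0 i k"
    have line: "cone_point d J (?N c) = (\<lambda>i k. ?Y0 i k + const_poly c * ?Y1 i k)" for c
      by (intro ext) (auto simp: cone_point_def combine_def const_poly.hom_add const_poly.hom_mult
          const_poly.hom_minus sum.distrib sum_subtractf sum_distrib_left algebra_simps)
    obtain q where q: "\<And>t. poly q t = minor_eval const_poly (\<lambda>i k. ?Y0 i k + t * ?Y1 i k) f"
      using const_poly.minor_eval_line[of f ?Y0 ?Y1] by blast
    obtain r where r: "\<And>t. poly r t = minor_eval const_poly (\<lambda>i k. ?Y0 i k + t * ?Y1 i k) g"
      using const_poly.minor_eval_line[of g ?Y0 ?Y1] by blast
    let ?A = "{n. poly q (const_poly (of_nat n)) \<in> P}" and ?B = "{n. poly r (const_poly (of_nat n)) \<in> P}"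
    have "poly q (const_poly c) * poly r (const_poly c) \<in> P" for c
      using fg[rule_format, of "?N c"] unfolding q r mult line .
    then have "?A \<union> ?B = UNIV"
      using P unfolding prime_set_def by blast
    then have inf: "infinite ?A \<or> infinite ?B"
      by (metis finite_Un infinite_UNIV_nat)
    have all: "poly p t \<in> P" if infinite: "infinite {n. poly p (const_poly (of_nat n)) \<in> P}" for p t
    proof -
      obtain B where B: "B \<subseteq> {n. poly p (const_poly (of_nat n)) \<in> P}" "finite B" "card B = Suc (degree p)"
        using infinite_arbitrarily_large[OF infinite, of "Suc (degree p)"] by blast
      have "coeff p i \<in> P" for i
        by (rule const_poly.ideal_coeffs[OF I, of "of_nat ` B"])
          (use B in \<open>auto simp: card_image\<close>)
      then show ?thesis by (rule ideal_poly[OF I])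
    qed
    from inf show False
    proof
      assume "infinite ?A"
      from all[OF this, of 0] show False using N(1) unfolding q by simp
    next
      assume "infinite ?B"
      from all[OF this, of 1] show False using N(2) unfolding r by simp
    qed
  qed
  moreover have "ideal_set {f. \<forall>N. minor_eval const_poly (cone_point d J N) f \<in> P}"
    unfolding ideal_set_def using ideal_0[OF I] ideal_add[OF I] ideal_mult[OF I]
    by (simp add: add mult zero)
  moreover have "1 \<notin> P" using P by (simp add: prime_set_def)
  ultimately show ?thesis
    unfolding prime_set_def[of "Collect _"] mem_Collect_eq one by blast
qed

lemma prime_set_cone_ideal:
  assumes P: "P \<in> Gr d s"
  shows "prime_set (cone_ideal d s P)"
proof -
  obtain J where J: "J \<in> plucker_index d {s}" "plucker_var J \<notin> P"
    using flag_scheme_nonzero[OF P] by blast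
  have "minor_eval const_poly (cone_point d J N) f \<in> prime_ext d {s} P \<longleftrightarrow>
      minor_eval const_poly (cone_point d J N) f \<in> P" for N f
    using cone_in_carrier[OF J(1)] mem_prime_ext by blast
  then have "cone_ideal d s P = {f. \<forall>N. minor_eval const_poly (cone_point d J N) f \<in> prime_ext d {s} P}"
    using mem_cone_ideal[OF P J] by blast
  then show ?thesis
    using prime_set_cone[OF flag_scheme_prime_ext(1)[OF P]] by simp
qed

subsection \<open>From irreducible closed sets to primes\<close>

definition locus :: "nat \<Rightarrow> plucker_poly \<Rightarrow> (nat \<times> plucker_poly set) set" where
  "locus d f = {(s, P). (s, P) \<in> total_Gr_points d \<and> f \<in> cone_ideal d s P}"

definition set_ideal :: "nat \<Rightarrow> (nat \<times> plucker_poly set) set \<Rightarrow> plucker_poly set" where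
  "set_ideal d Z = {f. \<forall>(s, P)\<in>Z. f \<in> cone_ideal d s P}"

lemma flag_scheme_component:
  "P \<in> flag_scheme d R \<Longrightarrow> f \<in> P \<Longrightarrow> component a f \<in> P"
  by (simp add: flag_scheme_def)

lemma flag_scheme_mem_components:
  assumes P: "P \<in> flag_scheme d R" and f: "f \<in> carrier (plucker_ring d R)"
  shows "f \<in> P \<longleftrightarrow> (\<forall>a. component a f \<in> P)"
proof
  assume *: "\<forall>a. component a f \<in> P"
  have "component a f \<in> prime_ext d R P" for a
    using * mem_prime_ext[OF mhomog_carrier[OF mhomog_component[OF f]]] by blast
  then have "(\<Sum>a\<in>multidegree ` Poly_Mapping.keys f. component a f) \<in> prime_ext d R P"
    by (intro ideal_sum prime_set_ideal flag_scheme_prime_ext(1)[OF P])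
  then show "f \<in> P"
    using sum_components[of f] mem_prime_ext[OF f] by metis
qed (use P flag_scheme_component in blast)

text \<open>The values of \<open>f\<close> at cone points are not multihomogeneous in general, but a
  point of the scheme contains an element exactly if it contains its components, so these serve as
  equations of each stratum. Compatibility with transfer is
  \<open>cone_ideal_forget\<close>.\<close>

lemma total_Gr_closed_locus: "total_Gr_closed d (locus d f)"
  unfolding total_Gr_closed_def
proof (intro conjI allI impI)
  show "locus d f \<subseteq> total_Gr_points d" by (auto simp: locus_def)
next
  fix r assume r: "r \<le> d"
  let ?ev = "\<lambda>J N. minor_eval const_poly (cone_point d J N) f"
  let ?S = "{component a (?ev J N) | a J N. J \<in> plucker_index d {r}}"
  have ev: "?ev J N \<in> carrier (plucker_ring d {r})" if "J \<in> plucker_index d {r}" for J N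
    using cone_in_carrier[OF that] by simp
  have "stratum (locus d f) r = {P \<in> Gr d r. f \<in> cone_ideal d r P}"
    using r by (auto simp: stratum_def locus_def total_Gr_points_def)
  also have "\<dots> = {P \<in> Gr d r. ?S \<subseteq> P}"
    unfolding cone_ideal_def using flag_scheme_mem_components[OF _ ev] by blast
  finally have eq: "stratum (locus d f) r = {P \<in> Gr d r. ?S \<subseteq> P}" .
  have hom: "mhomog d {r} a (component a (?ev J N))" if "J \<in> plucker_index d {r}" for a J N
    by (rule mhomog_component[OF ev[OF that]])
  show "zariski_closed d {r} (stratum (locus d f) r)"
    unfolding zariski_closed_def
  proof (intro exI conjI)
    show "?S \<subseteq> carrier (plucker_ring d {r})"
      using mhomog_carrier[OF hom] by blast
    show "\<forall>f\<in>?S. multihomogeneous f"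
      using mhomog_imp_multihomogeneous[OF hom] by blast
  qed (rule eq)
next
  fix s r assume sr: "s \<le> d" "r \<le> s"
  show "lower_transfer d r s (stratum (locus d f) s) \<subseteq> stratum (locus d f) r"
  proof
    fix P assume "P \<in> lower_transfer d r s (stratum (locus d f) s)"
    then obtain F where F: "F \<in> Fl d r s" "P = forget d {r} F" "f \<in> cone_ideal d s (forget d {s} F)"
      by (auto simp: lower_transfer_def stratum_def locus_def)
    have "f \<in> cone_ideal d r P"
      using cone_ideal_forget[OF F(1), of r s] F(2,3) sr by auto
    moreover have "P \<in> Gr d r"
      using forget_in_Gr[OF F(1), of r] F(2) by simp
    ultimately show "P \<in> stratum (locus d f) r"
      using sr by (auto simp: stratum_def locus_def total_Gr_points_def)
  qed
qed

lemma set_ideal_iff_locus: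
  "Z \<subseteq> total_Gr_points d \<Longrightarrow> f \<in> set_ideal d Z \<longleftrightarrow> Z \<subseteq> locus d f"
  by (auto simp: set_ideal_def locus_def)

text \<open>All cone ideals are prime, so if a product vanishes on \<open>Z\<close> then the loci of
  the two factors cover \<open>Z\<close>; they are closed, and irreducibility selects one of
  them.\<close>

lemma prime_set_set_ideal:
  assumes "irreducible_subset (total_Gr d) Z"
  shows "prime_set (set_ideal d Z)"
proof -
  have Z: "Z \<subseteq> total_Gr_points d" "Z \<noteq> {}"
    and irred: "\<And>A B. total_Gr_closed d A \<Longrightarrow> total_Gr_closed d B \<Longrightarrow> Z \<subseteq> A \<union> B \<Longrightarrow> Z \<subseteq> A \<or> Z \<subseteq> B"
    using assms by (auto simp: irreducible_subset_def closedin_total_Gr topspace_total_Gr)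
  have prime: "prime_set (cone_ideal d s P)" if "(s, P) \<in> Z" for s P
    using that Z by (intro prime_set_cone_ideal) (auto simp: total_Gr_points_def)
  have mem: "f \<in> set_ideal d Z \<longleftrightarrow> (\<forall>s P. (s, P) \<in> Z \<longrightarrow> f \<in> cone_ideal d s P)" for f
    by (auto simp: set_ideal_def)
  note I = prime_set_ideal[OF prime]
  have "ideal_set (set_ideal d Z)"
    unfolding ideal_set_def by (simp add: mem I ideal_0 ideal_add ideal_mult)
  moreover have "1 \<notin> set_ideal d Z"
  proof -
    obtain s P where sP: "(s, P) \<in> Z" using Z(2) by fastforce
    then show ?thesis using prime[OF sP] unfolding mem prime_set_def by blast
  qed
  moreover have "f \<in> set_ideal d Z \<or> g \<in> set_ideal d Z" if fg: "f * g \<in> set_ideal d Z" for f g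
  proof -
    have "Z \<subseteq> locus d f \<union> locus d g"
    proof
      fix x assume x: "x \<in> Z"
      obtain s P where sP: "x = (s, P)" by (cases x)
      then have "f * g \<in> cone_ideal d s P"
        using fg x mem by blast
      then have "f \<in> cone_ideal d s P \<or> g \<in> cone_ideal d s P"
        using prime[of s P] x sP unfolding prime_set_def by simp
      then show "x \<in> locus d f \<union> locus d g"
        using x sP Z(1) by (auto simp: locus_def)
    qed
    then have "Z \<subseteq> locus d f \<or> Z \<subseteq> locus d g"
      by (rule irred[OF total_Gr_closed_locus total_Gr_closed_locus])
    then show ?thesis
      by (simp only: set_ideal_iff_locus[OF Z(1)])
  qed
  ultimately show ?thesis by (simp add: prime_set_def)
qed

text \<open>Transfer never raises the rank. Splitting off such a part is how irreducibility gets
  applied to the stratum of highest rank.\<close>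

lemma total_Gr_closed_truncate:
  assumes "total_Gr_closed d Z"
  shows "total_Gr_closed d {(r, P). (r, P) \<in> Z \<and> r < s}"
proof -
  have "stratum {(r, P). (r, P) \<in> Z \<and> r < s} t = (if t < s then stratum Z t else {})" for t
    by (auto simp: stratum_def)
  then show ?thesis
    using assms unfolding total_Gr_closed_def
    by (auto simp: zariski_closed_empty lower_transfer_def)
qed

subsection \<open>Strict inclusions of irreducible closed sets\<close>

lemma minor_eval_plucker_var [simp]: "minor_eval const_poly Y (plucker_var I) = minor Y I"
  by (simp add: minor_eval_def)

lemma plucker_index_length_le:
  assumes "I \<in> plucker_index d {s}"
  shows "s \<le> d"
proof -
  have "distinct I" "set I \<subseteq> {..<d}" "length I = s"
    using assms strict_sorted_iff[of I] by (auto simp: plucker_index_def)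
  then show ?thesis
    using card_mono[of "{..<d}" "set I"] distinct_card[of I] by simp
qed

text \<open>The leading block factors through \<open>s\<close> dimensions: with \<open>N\<close>
  padded by zeros it becomes a product of square matrices whose left factor has a zero column at
  index \<open>s\<close>.\<close>

lemma minor_combine_0:
  assumes I: "set I \<subseteq> {..<d}" "length I \<le> d" and s: "s < length I"
  shows "minor (combine d s N X) I = 0"
proof -
  let ?n = "length I"
  let ?A = "mat ?n ?n (\<lambda>(i, l). if l < s then N i l else 0)"
  let ?B = "mat ?n ?n (\<lambda>(l, j). X l (I ! j))"
  have "minor_mat (combine d s N X) I = ?A * ?B"
  proof (rule eq_matI)
    fix i j assume "i < dim_row (?A * ?B)" "j < dim_col (?A * ?B)"
    then have ij: "i < ?n" "j < ?n" by simp_all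
    have "I ! j < d" using I(1) nth_mem[OF ij(2)] by blast
    then have "minor_mat (combine d s N X) I $$ (i, j) = (\<Sum>l<s. N i l * X l (I ! j))"
      using ij I(2) by (simp add: combine_def)
    also have "\<dots> = (\<Sum>l<?n. (if l < s then N i l else 0) * X l (I ! j))"
      using s by (intro sum.mono_neutral_cong_left) auto
    also have "\<dots> = (?A * ?B) $$ (i, j)"
      using ij by (simp add: scalar_prod_def lessThan_atLeast0)
    finally show "minor_mat (combine d s N X) I $$ (i, j) = (?A * ?B) $$ (i, j)" .
  qed simp_all
  then have "minor (combine d s N X) I = det ?A * det ?B"
    unfolding minor_def using det_mult[of ?A ?n ?B] by simp
  moreover have "det ?A = 0"
    using s by (subst laplace_expansion_column[of _ ?n s]) auto
  ultimately show ?thesis by simp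
qed

lemma minor_combine:
  assumes I: "set I \<subseteq> {..<d}" "length I \<le> d"
  shows "minor (combine d (length I) N X) I = minor N [0..<length I] * minor X I"
proof -
  let ?n = "length I"
  have "minor_mat (combine d ?n N X) I = minor_mat N [0..<?n] * minor_mat X I"
  proof (rule eq_matI)
    fix i j assume "i < dim_row (minor_mat N [0..<?n] * minor_mat X I)"
      "j < dim_col (minor_mat N [0..<?n] * minor_mat X I)"
    then have ij: "i < ?n" "j < ?n" by simp_all
    have "I ! j < d" using I(1) nth_mem[OF ij(2)] by blast
    then show "minor_mat (combine d ?n N X) I $$ (i, j) = (minor_mat N [0..<?n] * minor_mat X I) $$ (i, j)"
      using ij I(2) by (simp add: combine_def scalar_prod_def lessThan_atLeast0)
  qed simp_all
  then show ?thesis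
    unfolding minor_def using det_mult[of "minor_mat N [0..<?n]" ?n "minor_mat X I"] by simp
qed

definition id_matrix :: "nat \<Rightarrow> nat \<Rightarrow> complex" where
  "id_matrix i l = (if i = l then 1 else 0)"

lemma minor_id_matrix: "minor (\<lambda>i l. const_poly (id_matrix i l)) [0..<n] = 1"
proof -
  have "minor_mat (\<lambda>i l. const_poly (id_matrix i l)) [0..<n] = 1\<^sub>m n"
    by (rule eq_matI) (auto simp: id_matrix_def)
  then show ?thesis unfolding minor_def by simp
qed

lemma mono_eval_scale:
  assumes "Poly_Mapping.keys m \<subseteq> plucker_index d {s}"
  shows "mono_eval (\<lambda>I. c * x I) m = c ^ multidegree m s * mono_eval x m"
proof -
  have "{I \<in> Poly_Mapping.keys m. length I = s} = Poly_Mapping.keys m"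
    using assms by (auto simp: plucker_index_def)
  then have "multidegree m s = (\<Sum>I\<in>Poly_Mapping.keys m. Poly_Mapping.lookup m I)"
    unfolding multidegree_def by simp
  then show ?thesis
    by (simp add: mono_eval_def power_mult_distrib prod.distrib power_sum)
qed

lemma plucker_eval_scale:
  assumes "mhomog d {s} a g"
  shows "plucker_eval \<kappa> (\<lambda>I. c * x I) g = c ^ a s * plucker_eval \<kappa> x g"
  unfolding plucker_eval_def sum_distrib_left
  using assms by (intro sum.cong) (auto simp: mono_eval_scale mhomog_def mem_plucker_ring algebra_simps)

lemma plucker_eval_cong:
  assumes "g \<in> carrier (plucker_ring d R)" "\<And>I. I \<in> plucker_index d R \<Longrightarrow> x I = y I"
  shows "plucker_eval \<kappa> x g = plucker_eval \<kappa> y g"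
  unfolding plucker_eval_def mono_eval_def
  using assms by (intro sum.cong refl arg_cong2[of _ _ _ _ "(*)"] prod.cong arg_cong2[of _ _ _ _ "(^)"])
    (auto simp: mem_plucker_ring)

text \<open>On the cone, \<open>p_J\<close> times a minor of size \<open>s\<close> is the Pluecker
  coordinate times the leading minor of \<open>N\<close> and \<open>p_J ^ s\<close>. Homogeneity
  pulls these scalars out of \<open>g\<close>, so the multihomogeneous elements of \<open>P\<close>
  can be recovered from its cone.\<close>

lemma mem_cone_ideal_mhomog:
  assumes P: "P \<in> Gr d s" and g: "mhomog d {s} a g"
  shows "g \<in> cone_ideal d s P \<longleftrightarrow> g \<in> P"
proof -
  obtain J where J: "J \<in> plucker_index d {s}" "plucker_var J \<notin> P" "plucker_var J \<notin> prime_ext d {s} P"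
    using flag_scheme_nonzero[OF P] by blast
  let ?P = "prime_ext d {s} P" and ?p = "plucker_var J"
  have prime: "prime_set ?P" and flag: "flag_ideal d {s} \<subseteq> ?P"
    using flag_scheme_prime_ext[OF P] by auto
  note I = prime_set_ideal[OF prime]
  have sd: "s \<le> d" and len: "length J = s"
    using plucker_index_length_le[OF J(1)] J(1) by (auto simp: plucker_index_def)
  have gc: "g \<in> carrier (plucker_ring d {s})" by (rule mhomog_carrier[OF g])
  have key: "?p ^ a s * minor_eval const_poly (cone_point d J N) g
      - (minor (\<lambda>i l. const_poly (N i l)) [0..<s] * ?p ^ s) ^ a s * g \<in> ?P" for N
  proof -
    let ?c = "minor (\<lambda>i l. const_poly (N i l)) [0..<s]"
    \<comment> \<open>The congruence has to hold for all lists \<open>I\<close>, including those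
      that cannot occur in \<open>g\<close>; there both substitutions are set to 0.\<close>
    let ?x = "\<lambda>I. if I \<in> plucker_index d {s} then ?p * minor (cone_point d J N) I else 0"
    let ?y = "\<lambda>I. if I \<in> plucker_index d {s} then ?c * ?p ^ s * plucker_var I else 0"
    have "?x I - ?y I \<in> ?P" for I
    proof (cases "I \<in> plucker_index d {s}")
      case True
      then have "minor (cone_point d J N) I = ?c * minor (cramer d J) I"
        using minor_combine[of I d "\<lambda>i l. const_poly (N i l)" "cramer d J"] sd len
        by (auto simp: cone_point_def plucker_index_def)
      then have "?x I - ?y I = ?c * (?p * minor (cramer d J) I - ?p ^ s * plucker_var I)"
        using True by (simp add: algebra_simps)
      also have "\<dots> \<in> ?P"
        using minor_cramer_in_flag_ideal[OF J(1) True] flag by (intro ideal_mult[OF I]) auto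
      finally show ?thesis .
    qed (simp add: ideal_0[OF I])
    then have "plucker_eval const_poly ?x g - plucker_eval const_poly ?y g \<in> ?P"
      by (rule ideal_cong_plucker_eval[OF I])
    moreover have "plucker_eval const_poly ?x g = ?p ^ a s * minor_eval const_poly (cone_point d J N) g"
      unfolding minor_eval_def plucker_eval_scale[OF g, symmetric] by (rule plucker_eval_cong[OF gc]) simp
    moreover have "plucker_eval const_poly ?y g = (?c * ?p ^ s) ^ a s * plucker_eval const_poly plucker_var g"
      unfolding plucker_eval_scale[OF g, symmetric] by (rule plucker_eval_cong[OF gc]) simp
    moreover have "plucker_eval const_poly plucker_var g = restrict_vars d {s} g"
      unfolding restrict_vars_def by (rule plucker_eval_cong[OF gc]) simp
    ultimately show ?thesis by (simp add: restrict_vars_id[OF gc])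
  qed
  have pe: "?p ^ n \<notin> ?P" for n by (rule prime_set_power[OF prime J(3)])
  have mem: "minor_eval const_poly (cone_point d J N) g \<in> P \<longleftrightarrow> minor_eval const_poly (cone_point d J N) g \<in> ?P" for N
    using mem_prime_ext[OF cone_in_carrier[OF J(1)]] by blast
  show ?thesis
  proof
    assume "g \<in> cone_ideal d s P"
    \<comment> \<open>For \<open>id_matrix\<close> the leading minor of \<open>N\<close> is 1, so
      only a power of \<open>p_J\<close> remains in front of \<open>g\<close>.\<close>
    then have "minor_eval const_poly (cone_point d J id_matrix) g \<in> ?P"
      using J(1) mem by (auto simp: cone_ideal_def)
    then have "(1 * ?p ^ s) ^ a s * g \<in> ?P"
      using key[of id_matrix] ideal_cong[OF I] ideal_mult[OF I] unfolding minor_id_matrix by blast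
    then have "g \<in> ?P"
      using prime pe[of "s * a s"] unfolding prime_set_def by (simp add: power_mult) blast
    then show "g \<in> P" using mem_prime_ext[OF gc] by simp
  next
    assume "g \<in> P"
    then have "g \<in> ?P" using mem_prime_ext[OF gc] by simp
    then have "?p ^ a s * minor_eval const_poly (cone_point d J N) g \<in> ?P" for N
      using key[of N] ideal_cong[OF I] ideal_mult[OF I] by blast
    then have "minor_eval const_poly (cone_point d J N) g \<in> P" for N
      using prime pe[of "a s"] mem unfolding prime_set_def by blast
    then show "g \<in> cone_ideal d s P" using mem_cone_ideal[OF P J(1,2)] by blast
  qed
qed

text \<open>A matrix over a quotient of rank \<open>r\<close> has no nonzero minor of size
  \<open>s > r\<close>, and positive degree guarantees that every monomial of \<open>g\<close>
  contains such a minor.\<close>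

lemma mhomog_in_cone_ideal_lower:
  assumes P: "P \<in> Gr d r" and r: "r < s" "s \<le> d" and g: "mhomog d {s} a g" and a: "a s > 0"
  shows "g \<in> cone_ideal d r P"
proof -
  have "minor_eval const_poly (cone_point d J N) g = 0" if J: "J \<in> plucker_index d {r}" for J N
  proof -
    \<comment> \<open>Zero is written as a product to match \<open>plucker_eval_scale\<close> with
      scalar 0, which yields the factor \<open>0 ^ a s\<close>.\<close>
    have "minor (cone_point d J N) I = 0 * 0" if "I \<in> plucker_index d {s}" for I
      using minor_combine_0[of I d r] that J r by (auto simp: cone_point_def plucker_index_def)
    then have "minor_eval const_poly (cone_point d J N) g = plucker_eval const_poly (\<lambda>I. 0 * 0) g"
      unfolding minor_eval_def by (rule plucker_eval_cong[OF mhomog_carrier[OF g]])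
    also have "\<dots> = 0 ^ a s * plucker_eval const_poly (\<lambda>I. 0) g"
      by (rule plucker_eval_scale[OF g])
    also have "\<dots> = 0" using a by (simp add: zero_power)
    finally show ?thesis .
  qed
  moreover have "0 \<in> P"
    using ideal_0[OF prime_set_ideal[OF flag_scheme_prime_ext(1)[OF P]]]
      mem_prime_ext[OF plucker_ring_0_closed] by blast
  ultimately show ?thesis by (simp add: cone_ideal_def)
qed

lemma mhomog_degree_0:
  assumes g: "mhomog d {s} a g" and a: "a s = 0"
  shows "g = const_poly (Poly_Mapping.lookup g 0)"
proof (rule poly_mapping_eqI)
  fix m
  have "m = 0" if m: "m \<in> Poly_Mapping.keys g"
  proof -
    have k: "Poly_Mapping.keys m \<subseteq> plucker_index d {s}" and "multidegree m s = 0"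
      using g a m by (auto simp: mhomog_def mem_plucker_ring)
    then have "Poly_Mapping.lookup m I = 0" if "I \<in> Poly_Mapping.keys m" for I
      using that by (auto simp: multidegree_def plucker_index_def)
    then show ?thesis
      by (metis in_keys_iff keys_eq_empty all_not_in_conv)
  qed
  then have "Poly_Mapping.lookup g m = 0" if "m \<noteq> 0"
    using that in_keys_iff[of m g] by blast
  then show "Poly_Mapping.lookup g m = Poly_Mapping.lookup (const_poly (Poly_Mapping.lookup g 0)) m"
    by (cases "m = 0") (simp_all add: const_poly_def lookup_single when_def)
qed

text \<open>A separating polynomial is found in the highest rank \<open>s'\<close> of
  \<open>Z'\<close>. If \<open>Z\<close> stays below that rank, a Pluecker variable of rank
  \<open>s'\<close> works. Otherwise an equation of the top stratum of \<open>Z\<close> does; it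
  vanishes at all lower ranks because its degree is positive.\<close>

lemma set_ideal_strict:
  assumes Z: "total_Gr_closed d Z" "irreducible_subset (total_Gr d) Z"
    and Z': "total_Gr_closed d Z'" "irreducible_subset (total_Gr d) Z'" and sub: "Z \<subset> Z'"
  shows "set_ideal d Z' \<subset> set_ideal d Z"
proof -
  have ZX: "Z \<subseteq> total_Gr_points d" "Z \<noteq> {}" "Z' \<subseteq> total_Gr_points d" "Z' \<noteq> {}"
    and irred: "\<And>A B. total_Gr_closed d A \<Longrightarrow> total_Gr_closed d B \<Longrightarrow> Z' \<subseteq> A \<union> B \<Longrightarrow> Z' \<subseteq> A \<or> Z' \<subseteq> B"
    using assms by (auto simp: irreducible_subset_def closedin_total_Gr topspace_total_Gr)
  have fin: "finite (fst ` Y)" if "Y \<subseteq> total_Gr_points d" for Y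
    by (rule finite_subset[of _ "{..d}"]) (use that in \<open>auto simp: total_Gr_points_def\<close>)
  define s where "s = Max (fst ` Z)"
  define s' where "s' = Max (fst ` Z')"
  have top: "r \<le> s" if "(r, P) \<in> Z" for r P
    unfolding s_def using that fin[OF ZX(1)] by (intro Max_ge) force+
  have top': "r \<le> s'" if "(r, P) \<in> Z'" for r P
    unfolding s'_def using that fin[OF ZX(3)] by (intro Max_ge) force+
  obtain P0 where P0: "(s, P0) \<in> Z"
    using Max_in[OF fin[OF ZX(1)]] ZX(2) unfolding s_def by force
  obtain P0' where P0': "(s', P0') \<in> Z'"
    using Max_in[OF fin[OF ZX(3)]] ZX(4) unfolding s'_def by force
  have ss': "s \<le> s'" using P0 sub top' by blast
  have s'd: "s' \<le> d" using P0' ZX(3) by (auto simp: total_Gr_points_def)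
  have Gr: "P \<in> Gr d r" if "(r, P) \<in> Z'" for r P
    using that ZX(3) by (auto simp: total_Gr_points_def)
  have "\<exists>g a P. mhomog d {s'} a g \<and> (s', P) \<in> Z' \<and> g \<notin> P \<and> (\<forall>(r, Q)\<in>Z. g \<in> cone_ideal d r Q)"
  proof (cases "s < s'")
    case True
    obtain J where J: "J \<in> plucker_index d {s'}" "plucker_var J \<notin> P0'"
      using flag_scheme_nonzero[OF Gr[OF P0']] by blast
    then have h: "mhomog d {s'} (unit_degree s') (plucker_var J)"
      using mhomog_var[of J d "{s'}"] by (auto simp: plucker_index_def)
    have "plucker_var J \<in> cone_ideal d r Q" if "(r, Q) \<in> Z" for r Q
      using mhomog_in_cone_ideal_lower[OF Gr[of r Q] _ s'd h] that sub True top[OF that]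
      by (auto simp: unit_degree_def)
    with h P0' J(2) show ?thesis by blast
  next
    case False
    then have eq: "s' = s" using ss' by simp
    \<comment> \<open>If the top strata agreed, \<open>Z'\<close> would be the union of
      \<open>Z\<close> and its own part of lower rank, both closed and both proper.\<close>
    have "\<not> stratum Z' s \<subseteq> stratum Z s"
    proof
      assume *: "stratum Z' s \<subseteq> stratum Z s"
      have "Z' \<subseteq> Z \<union> {(r, P). (r, P) \<in> Z' \<and> r < s}"
      proof
        fix x assume x: "x \<in> Z'"
        obtain r P where rP: "x = (r, P)" by (cases x)
        show "x \<in> Z \<union> {(r, P). (r, P) \<in> Z' \<and> r < s}"
        proof (cases "r = s")
          case True
          then have "P \<in> stratum Z' s" using x rP by (simp add: stratum_def)
          then have "P \<in> stratum Z s" using * by blast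
          then show ?thesis using True rP by (simp add: stratum_def)
        next
          case False
          then have "r < s" using top'[of r P] x rP eq by simp
          then show ?thesis using x rP by simp
        qed
      qed
      then have "Z' \<subseteq> Z \<or> Z' \<subseteq> {(r, P). (r, P) \<in> Z' \<and> r < s}"
        by (intro irred Z(1) total_Gr_closed_truncate Z'(1))
      then show False using sub P0' eq by auto
    qed
    then obtain P1 where P1: "(s, P1) \<in> Z'" "(s, P1) \<notin> Z" by (auto simp: stratum_def)
    have "zariski_closed d {s} (stratum Z s)"
      using Z(1) s'd eq by (simp add: total_Gr_closed_def)
    then obtain S where S: "S \<subseteq> carrier (plucker_ring d {s})" "\<forall>f\<in>S. multihomogeneous f"
      "stratum Z s = {P \<in> Gr d s. S \<subseteq> P}"
      unfolding zariski_closed_def by blast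
    have mem: "(s, P) \<in> Z \<longleftrightarrow> P \<in> Gr d s \<and> S \<subseteq> P" for P
      using S(3) by (auto simp: stratum_def set_eq_iff)
    obtain g where g: "g \<in> S" "g \<notin> P1"
      using P1 mem Gr by blast
    then obtain a where a: "mhomog d {s} a g"
      using S(1,2) unfolding mhomog_def multihomogeneous_def by blast
    \<comment> \<open>Degree 0 would make \<open>g\<close> a constant: nonzero because it is not in
      \<open>P1\<close>, hence a unit, which cannot lie in a prime containing
      \<open>P0\<close>.\<close>
    have as: "a s > 0"
    proof (rule ccontr)
      assume "\<not> a s > 0"
      then have gc: "g = const_poly (Poly_Mapping.lookup g 0)"
        using mhomog_degree_0[OF a] by simp
      let ?P = "\<lambda>P. prime_ext d {s} P"
      have "g \<in> ?P P0" "g \<notin> ?P P1"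
        using P0 g mem mem_prime_ext[OF mhomog_carrier[OF a]] by blast+
      moreover have p: "prime_set (?P P0)" "prime_set (?P P1)"
        using flag_scheme_prime_ext(1) Gr P0 P1(1) sub by blast+
      moreover have "Poly_Mapping.lookup g 0 \<noteq> 0"
        using gc ideal_0[OF prime_set_ideal[OF p(2)]] calculation(2) by (metis const_poly.hom_zero)
      moreover have "const_poly (inverse (Poly_Mapping.lookup g 0)) * g = 1" if "Poly_Mapping.lookup g 0 \<noteq> 0"
        by (subst gc) (simp add: const_poly.hom_mult[symmetric] that)
      ultimately show False
        using ideal_mult[OF prime_set_ideal[OF p(1)]] unfolding prime_set_def by metis
    qed
    have "g \<in> cone_ideal d r Q" if Q: "(r, Q) \<in> Z" for r Q
    proof (cases "r = s")
      case True
      then show ?thesis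
        using mem_cone_ideal_mhomog[OF _ a] mem Q g(1) by blast
    next
      case False
      then show ?thesis
        using mhomog_in_cone_ideal_lower[OF Gr[of r Q] _ _ a as] top[OF Q] Q sub s'd eq by auto
    qed
    with a P1(1) g(2) eq show ?thesis by blast
  qed
  then obtain g a P where g: "mhomog d {s'} a g" "(s', P) \<in> Z'" "g \<notin> P" "g \<in> set_ideal d Z"
    unfolding set_ideal_def by blast
  then have "g \<notin> set_ideal d Z'"
    using mem_cone_ideal_mhomog[OF Gr[OF g(2)] g(1)] unfolding set_ideal_def by blast
  moreover have "set_ideal d Z' \<subseteq> set_ideal d Z"
    using sub unfolding set_ideal_def by blast
  ultimately show ?thesis using g(4) by blast
qed

subsection \<open>Chains of primes and algebraic dependence\<close>

definition monomial_of :: "(nat \<Rightarrow> 'a::comm_monoid_mult) \<Rightarrow> nat list \<Rightarrow> 'a" where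
  "monomial_of f xs = (\<Prod>i<length xs. f i ^ (xs ! i))"

lemma monomial_of_Nil [simp]: "monomial_of f [] = 1"
  by (simp add: monomial_of_def)

lemma monomial_of_Cons: "monomial_of f (x # xs) = f 0 ^ x * monomial_of (\<lambda>i. f (Suc i)) xs"
  unfolding monomial_of_def length_Cons prod.lessThan_Suc_shift by simp

lemma const_poly_unit:
  assumes "prime_set P" "c \<noteq> 0"
  shows "const_poly c \<notin> P"
proof
  assume "const_poly c \<in> P"
  then have "const_poly (inverse c) * const_poly c \<in> P"
    by (rule ideal_mult[OF prime_set_ideal[OF assms(1)]])
  then show False
    using assms by (simp add: const_poly.hom_mult[symmetric] prime_set_def)
qed

text \<open>Read off the lowest power of \<open>f\<^sub>0\<close>: since \<open>f\<^sub>0\<close> is not in \<open>P\<^sub>0\<close> but is in \<open>P\<^sub>1\<close>, its coefficient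
  is a polynomial in the other \<open>f\<^sub>i\<close> lying in \<open>P\<^sub>1\<close>.\<close>

lemma prime_chain_independent:
  assumes "\<And>i. i \<le> m \<Longrightarrow> prime_set (P i)" "\<And>i. i < m \<Longrightarrow> P i \<subseteq> P (Suc i)"
    and "\<And>i. i < m \<Longrightarrow> f i \<in> P (Suc i)" "\<And>i. i < m \<Longrightarrow> f i \<notin> P i"
    and "finite A" "\<And>xs. xs \<in> A \<Longrightarrow> length xs = m" "ys \<in> A" "c ys \<noteq> 0"
  shows "(\<Sum>xs\<in>A. const_poly (c xs) * monomial_of f xs) \<notin> P 0"
  using assms
proof (induction m arbitrary: P f A c ys)
  case 0
  then have "A = {[]}" "ys = []" by auto
  then show ?case using 0 const_poly_unit by simp
next
  case (Suc m)
  let ?f = "\<lambda>i. f (Suc i)"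
  let ?t = "\<lambda>xs. const_poly (c xs) * monomial_of f xs"
  define B where "B = {xs \<in> A. c xs \<noteq> 0}"
  have B: "finite B" "ys \<in> B" using Suc.prems by (auto simp: B_def)
  define a where "a = Min (hd ` B)"
  have a_le: "a \<le> hd xs" if "xs \<in> B" for xs
    using that B by (simp add: a_def)
  obtain zs where zs: "zs \<in> B" "hd zs = a"
    using Min_in[of "hd ` B"] B unfolding a_def by fastforce
  have cons: "xs = hd xs # tl xs" if "xs \<in> B" for xs
    using that Suc.prems(6)[of xs] by (cases xs) (auto simp: B_def)
  let ?B0 = "{xs \<in> B. hd xs = a}" and ?B1 = "{xs \<in> B. hd xs \<noteq> a}"
  let ?g = "\<Sum>xs\<in>?B0. const_poly (c xs) * monomial_of ?f (tl xs)"
  \<comment> \<open>On \<open>?B1\<close> the exponent exceeds \<open>a\<close>, so beyond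
    \<open>f 0 ^ a\<close> one more factor \<open>f 0\<close> splits off; it puts this part of the
    sum into \<open>P (Suc 0)\<close>.\<close>
  let ?h = "\<Sum>xs\<in>?B1. const_poly (c xs) * (f 0 ^ (hd xs - Suc a) * monomial_of ?f (tl xs))"
  have mon: "monomial_of f xs = f 0 ^ hd xs * monomial_of ?f (tl xs)" if "xs \<in> B" for xs
    using cons[OF that] monomial_of_Cons by metis
  have "(\<Sum>xs\<in>A. ?t xs) = (\<Sum>xs\<in>B. ?t xs)"
    unfolding B_def using Suc.prems(5) by (intro sum.mono_neutral_right) auto
  also have "\<dots> = (\<Sum>xs\<in>?B0. ?t xs) + (\<Sum>xs\<in>?B1. ?t xs)"
    using B(1) by (subst sum.union_disjoint[symmetric]) (auto intro!: sum.cong)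
  also have "(\<Sum>xs\<in>?B0. ?t xs) = f 0 ^ a * ?g"
    unfolding sum_distrib_left by (intro sum.cong) (auto simp: mon algebra_simps)
  also have "(\<Sum>xs\<in>?B1. ?t xs) = f 0 ^ a * (f 0 * ?h)"
    unfolding sum_distrib_left
  proof (intro sum.cong refl)
    fix xs assume "xs \<in> ?B1"
    then have xs: "xs \<in> B" "hd xs = a + Suc (hd xs - Suc a)"
      using a_le[of xs] by auto
    have "f 0 ^ hd xs = f 0 ^ a * (f 0 * f 0 ^ (hd xs - Suc a))"
      by (subst xs(2)) (simp add: power_add)
    then show "?t xs = f 0 ^ a * (f 0 * (const_poly (c xs) * (f 0 ^ (hd xs - Suc a) * monomial_of ?f (tl xs))))"
      unfolding mon[OF xs(1)] by (simp add: algebra_simps)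
  qed
  finally have eq: "(\<Sum>xs\<in>A. ?t xs) = f 0 ^ a * (?g + f 0 * ?h)"
    by (simp add: distrib_left)
  have inj: "inj_on tl ?B0"
    using cons by (intro inj_onI) (metis (mono_tags, lifting) mem_Collect_eq)
  have c_tl: "c (a # tl xs) = c xs" if "xs \<in> ?B0" for xs
    using cons[of xs] that by auto
  have g: "?g = (\<Sum>xs\<in>tl ` ?B0. const_poly (c (a # xs)) * monomial_of ?f xs)"
    unfolding sum.reindex[OF inj] o_def by (intro sum.cong) (use c_tl in auto)
  have "?g \<notin> P (Suc 0)"
    unfolding g
  proof (rule Suc.IH[of "\<lambda>i. P (Suc i)" ?f])
    show "tl zs \<in> tl ` ?B0" using zs by blast
    have "a # tl zs = zs" using cons[OF zs(1)] zs(2) by metis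
    then show "c (a # tl zs) \<noteq> 0" using zs by (auto simp: B_def)
    fix xs assume "xs \<in> tl ` ?B0"
    then show "length xs = m" using Suc.prems(6) by (auto simp: B_def)
  qed (use Suc.prems(1-4) B(1) in auto)
  show ?case
  proof
    assume "(\<Sum>xs\<in>A. ?t xs) \<in> P 0"
    then have "f 0 ^ a \<in> P 0 \<or> ?g + f 0 * ?h \<in> P 0"
      using Suc.prems(1)[of 0] unfolding eq prime_set_def by blast
    moreover have "f 0 ^ a \<notin> P 0"
      using Suc.prems(1)[of 0] Suc.prems(4)[of 0] by (intro prime_set_power) auto
    ultimately have "?g + f 0 * ?h \<in> P (Suc 0)"
      using Suc.prems(2)[of 0] by blast
    moreover have I: "ideal_set (P (Suc 0))"
      using Suc.prems(1)[of "Suc 0"] by (auto intro: prime_set_ideal)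
    moreover have "f 0 * ?h \<in> P (Suc 0)"
      using Suc.prems(3)[of 0] by (intro ideal_mult'[OF I]) auto
    ultimately have "(?g + f 0 * ?h) - f 0 * ?h \<in> P (Suc 0)"
      by (intro ideal_diff[OF I])
    then show False using \<open>?g \<notin> P (Suc 0)\<close> by simp
  qed
qed

section \<open>Linear dependence and reduction to triangular matrices\<close>

lemma homogeneous_system_nontrivial:
  fixes M :: "'a \<Rightarrow> 'b \<Rightarrow> 'c::field"
  assumes "finite B" "finite A" "card B < card A"
  shows "\<exists>c. (\<exists>x\<in>A. c x \<noteq> 0) \<and> (\<forall>b\<in>B. (\<Sum>x\<in>A. c x * M x b) = 0)"
  using assms
proof (induction B arbitrary: A M rule: finite_induct)
  case empty
  then obtain x where "x \<in> A" by fastforce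
  then show ?case by (intro exI[of _ "\<lambda>_. 1"]) auto
next
  case (insert b B)
  show ?case
  proof (cases "\<forall>x\<in>A. M x b = 0")
    case True
    obtain c where "\<exists>x\<in>A. c x \<noteq> 0" "\<forall>b\<in>B. (\<Sum>x\<in>A. c x * M x b) = 0"
      using insert.IH[of A M] insert.prems insert.hyps by auto
    then show ?thesis using True by (intro exI[of _ c]) auto
  next
    case False
    then obtain x0 where x0: "x0 \<in> A" "M x0 b \<noteq> 0" by blast
    let ?A = "A - {x0}" and ?M = "\<lambda>x b'. M x b' - M x b / M x0 b * M x0 b'"
    have "card B < card ?A"
      using insert.prems insert.hyps x0(1) by simp
    then obtain c where c: "\<exists>x\<in>?A. c x \<noteq> 0" "\<forall>b'\<in>B. (\<Sum>x\<in>?A. c x * ?M x b') = 0"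
      using insert.IH[of ?A ?M] insert.prems by auto
    \<comment> \<open>Equation \<open>b\<close> solved for the unknown \<open>x0\<close>, up to
      sign; \<open>?M\<close> is the system after elimination of \<open>x0\<close>.\<close>
    define k where "k = (\<Sum>x\<in>?A. c x * (M x b / M x0 b))"
    let ?c = "c(x0 := - k)"
    have "(\<Sum>x\<in>A. ?c x * M x b') = - k * M x0 b' + (\<Sum>x\<in>?A. c x * M x b')" for b'
      using sum.remove[OF insert.prems(1) x0(1), of "\<lambda>x. ?c x * M x b'"] by (auto intro!: sum.cong)
    also have "\<dots> b' = (\<Sum>x\<in>?A. c x * ?M x b')" for b'
    proof -
      have "(\<Sum>x\<in>?A. c x * ?M x b') = (\<Sum>x\<in>?A. c x * M x b' - c x * (M x b / M x0 b) * M x0 b')"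
        by (intro sum.cong) (auto simp: right_diff_distrib mult.assoc)
      then show ?thesis
        unfolding k_def sum_subtractf by (simp only: sum_distrib_right[symmetric]) simp
    qed
    finally have eq: "(\<Sum>x\<in>A. ?c x * M x b') = (\<Sum>x\<in>?A. c x * ?M x b')" for b' .
    have "(\<Sum>x\<in>A. ?c x * M x b') = 0" if "b' \<in> insert b B" for b'
      unfolding eq using that c(2) x0(2) by auto
    moreover have "\<exists>x\<in>A. ?c x \<noteq> 0" using c(1) by auto
    ultimately show ?thesis by blast
  qed
qed

text \<open>The operation is left multiplication by a unit lower triangular matrix, which restricts
  to leading blocks of every size. If \<open>j\<close> lies outside the block, no row of the block
  changes.\<close>

lemma minor_row_operation:
  assumes "\<And>i. i \<le> j \<Longrightarrow> u i = 0"
  shows "minor (\<lambda>i k. Y i k + u i * Y j k) I = minor Y I"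
proof -
  let ?n = "length I"
  let ?L = "mat ?n ?n (\<lambda>(i, l). (if i = l then 1 else 0) + (if l = j then u i else 0))"
  have "minor_mat (\<lambda>i k. Y i k + u i * Y j k) I = ?L * minor_mat Y I"
  proof (rule eq_matI)
    fix i k assume "i < dim_row (?L * minor_mat Y I)" "k < dim_col (?L * minor_mat Y I)"
    then have ik: "i < ?n" "k < ?n" by simp_all
    have "(\<Sum>l<?n. ((if i = l then 1 else 0) + (if l = j then u i else 0)) * Y l (I ! k))
        = (\<Sum>l<?n. (if l = i then Y i (I ! k) else 0) + (if l = j then u i * Y j (I ! k) else 0))"
      by (intro sum.cong) (auto simp: distrib_right)
    also have "\<dots> = Y i (I ! k) + u i * Y j (I ! k)"
      using ik assms[of i] by (cases "j < ?n") (auto simp: sum.distrib)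
    finally show "minor_mat (\<lambda>i k. Y i k + u i * Y j k) I $$ (i, k) = (?L * minor_mat Y I) $$ (i, k)"
      using ik by (simp add: scalar_prod_def lessThan_atLeast0)
  qed simp_all
  moreover have "det ?L = 1"
  proof -
    have "det ?L = prod_list (diag_mat ?L)"
      by (rule det_lower_triangular[of ?n]) (use assms in auto)
    also have "\<dots> = (\<Prod>i = 0..<?n. ?L $$ (i, i))"
      by (simp add: prod_list_diag_prod)
    also have "\<dots> = 1"
      using assms by (intro prod.neutral) auto
    finally show ?thesis .
  qed
  ultimately show ?thesis
    unfolding minor_def using det_mult[of ?L ?n "minor_mat Y I"] by simp
qed

text \<open>A matrix is reduced to an upper triangular one by row operations that do not change any
  minor of its first rows; a vanishing pivot is removed by a perturbation.\<close>

lemma minor_eval_upper_triangular: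
  assumes tri: "\<And>Y. (\<And>i k. \<not> (i \<le> k \<and> k < d) \<Longrightarrow> Y i k = 0) \<Longrightarrow> minor_eval (\<lambda>c. c) Y F = (0 :: complex)"
    and Y: "\<And>i k. \<not> (i < d \<and> k < d) \<Longrightarrow> Y i k = 0"
  shows "minor_eval (\<lambda>c. c) Y F = 0"
proof -
  \<comment> \<open>Downward induction on the number \<open>j\<close> of columns that are already
    reduced; \<open>j = 0\<close> is the goal.\<close>
  have "\<forall>Y :: nat \<Rightarrow> nat \<Rightarrow> complex. (\<forall>i k. \<not> (i < d \<and> k < d) \<longrightarrow> Y i k = 0) \<longrightarrow>
      (\<forall>i k. k < j \<longrightarrow> k < i \<longrightarrow> Y i k = 0) \<longrightarrow> minor_eval (\<lambda>c. c) Y F = 0"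
    if "j \<le> d" for j
    using that
  proof (induction rule: inc_induct)
    case base
    show ?case
    proof (intro allI impI tri)
      fix Y :: "nat \<Rightarrow> nat \<Rightarrow> complex" and i k
      assume "\<forall>i k. \<not> (i < d \<and> k < d) \<longrightarrow> Y i k = 0" "\<forall>i k. k < d \<longrightarrow> k < i \<longrightarrow> Y i k = 0"
        "\<not> (i \<le> k \<and> k < d)"
      then show "Y i k = 0" by (cases "k < d") auto
    qed
  next
    case (step j)
    have pivot: "minor_eval (\<lambda>c. c) Y F = 0"
      if Y1: "\<And>i k. \<not> (i < d \<and> k < d) \<Longrightarrow> Y i k = 0" and Y2: "\<And>i k. k < j \<Longrightarrow> k < i \<Longrightarrow> Y i k = 0"
        and pivot: "Y j j \<noteq> 0" for Y :: "nat \<Rightarrow> nat \<Rightarrow> complex"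
    proof -
      let ?u = "\<lambda>i. if i \<le> j then 0 else - (Y i j / Y j j)"
      let ?Y = "\<lambda>i k. Y i k + ?u i * Y j k"
      have "?Y i k = 0" if ik: "\<not> (i < d \<and> k < d)" for i k
      proof (cases "k < d")
        case True
        then have "Y i k = 0" "Y i j = 0" using Y1 ik by simp_all
        then show ?thesis by simp
      qed (simp add: Y1)
      moreover have "?Y i k = 0" if ik: "k < Suc j" "k < i" for i k
      proof (cases "k = j")
        case True
        then show ?thesis using ik pivot by simp
      next
        case False
        then have "Y i k = 0" "Y j k = 0" using Y2 ik by simp_all
        then show ?thesis by simp
      qed
      ultimately have "minor_eval (\<lambda>c. c) ?Y F = 0"
        by (intro step.IH[THEN spec, THEN mp, THEN mp] allI impI)
      moreover have "minor ?Y = minor Y"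
        by (intro ext minor_row_operation) simp
      ultimately show ?thesis unfolding minor_eval_def by simp
    qed
    show ?case
    proof (intro allI impI)
      fix Y :: "nat \<Rightarrow> nat \<Rightarrow> complex"
      assume Y1: "\<forall>i k. \<not> (i < d \<and> k < d) \<longrightarrow> Y i k = 0" and Y2: "\<forall>i k. k < j \<longrightarrow> k < i \<longrightarrow> Y i k = 0"
      \<comment> \<open>Adding \<open>t\<close> at the pivot makes it nonzero for all
        \<open>t\<close> but one, so the polynomial in \<open>t\<close> has infinitely many zeros
        and vanishes at \<open>t = 0\<close> too.\<close>
      let ?E = "\<lambda>i k. if i = j \<and> k = j then 1 else (0::complex)"
      obtain q where q: "\<And>t. poly q t = minor_eval (\<lambda>c. c) (\<lambda>i k. Y i k + t * ?E i k) F"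
        using complex_algebra.minor_eval_line[OF complex_algebra_id, of F Y ?E] by blast
      have q0: "poly q t = 0" if t: "t \<noteq> - Y j j" for t
        unfolding q
      proof (rule pivot)
        show "Y j j + t * ?E j j \<noteq> 0" using t by (simp add: add_eq_0_iff)
        show "Y i k + t * ?E i k = 0" if "\<not> (i < d \<and> k < d)" for i k
        proof -
          have "\<not> (i = j \<and> k = j)" using that step.hyps by auto
          moreover have "Y i k = 0" using Y1 that by blast
          ultimately show ?thesis by (simp only: if_False mult_zero_right add_0_right)
        qed
        show "Y i k + t * ?E i k = 0" if "k < j" "k < i" for i k
          using Y2 that by simp
      qed
      have "q = 0"
      proof (rule ccontr)
        assume "q \<noteq> 0"
        then have "finite {t. poly q t = 0}" by (rule poly_roots_finite)
        moreover have "UNIV \<subseteq> insert (- Y j j) {t. poly q t = 0}" using q0 by auto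
        ultimately have "finite (UNIV :: complex set)"
          by (metis finite_insert finite_subset)
        then show False by (simp add: infinite_UNIV_char_0)
      qed
      then show "minor_eval (\<lambda>c. c) Y F = 0" using q[of 0] by simp
    qed
  qed
  from this[of 0] show ?thesis using Y by simp
qed

text \<open>Interpolation with the ideal \<open>{0}\<close>: an identity for complex matrices
  persists for entries in the Pluecker ring, where the cone points live.\<close>

lemma minor_eval_complex_imp:
  assumes F: "\<And>Y :: nat \<Rightarrow> nat \<Rightarrow> complex. (\<And>i k. \<not> (i < d \<and> k < d) \<Longrightarrow> Y i k = 0) \<Longrightarrow> minor_eval (\<lambda>c. c) Y F = 0"
    and Y: "\<And>i k. \<not> (i < d \<and> k < d) \<Longrightarrow> Y i k = 0"
  shows "minor_eval const_poly Y F = 0"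
proof -
  let ?S = "{..<d} \<times> {..<d}" and ?T = "(of_nat :: nat \<Rightarrow> complex) ` {..minor_degree F}"
  let ?\<phi> = "\<lambda>N :: nat \<times> nat \<Rightarrow> plucker_poly. minor_eval const_poly (\<lambda>i k. N (i, k)) F"
  have "?\<phi> (\<lambda>(i, k). Y i k) \<in> {0}"
  proof (rule const_poly.ideal_grid[OF ideal_set_singleton_0, of ?S "minor_degree F" ?\<phi> ?T "\<lambda>_. 0"])
    fix N :: "nat \<times> nat \<Rightarrow> plucker_poly" and v :: "nat \<times> nat"
    have "(N(v := t)) (i, k) = (N(v := 0)) (i, k) + t * (if (i, k) = v then 1 else 0)" for t i k
      by simp
    then show "\<exists>q. degree q \<le> minor_degree F \<and> (\<forall>t. poly q t = ?\<phi> (N(v := t)))"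
      by (rule const_poly.minor_eval_update)
  next
    fix N :: "nat \<times> nat \<Rightarrow> plucker_poly" assume N: "\<forall>v\<in>?S. N v \<in> const_poly ` ?T" "\<forall>v. v \<notin> ?S \<longrightarrow> N v = 0"
    have "\<exists>c. N v = const_poly c \<and> (v \<notin> ?S \<longrightarrow> c = 0)" for v
    proof (cases "v \<in> ?S")
      case False
      then have "N v = const_poly 0" using N(2) by (metis const_poly.hom_zero)
      then show ?thesis by blast
    qed (use N(1) in blast)
    then obtain c where c: "\<And>v. N v = const_poly (c v)" "\<And>v. v \<notin> ?S \<Longrightarrow> c v = 0" by metis
    have "?\<phi> N = const_poly (minor_eval (\<lambda>c. c) (\<lambda>i k. c (i, k)) F)"
      unfolding const_poly.hom_minor_eval c(1) ..
    also have "minor_eval (\<lambda>c. c) (\<lambda>i k. c (i, k)) F = 0"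
      by (rule F) (use c(2) in auto)
    finally show "?\<phi> N \<in> {0}" by simp
  qed (use card_of_nat_complex[of "minor_degree F"] Y in auto)
  then show ?thesis by simp
qed

definition triangle :: "nat \<Rightarrow> (nat \<times> nat) set" where
  "triangle d = {(i, k). i \<le> k \<and> k < d}"

lemma card_triangle: "finite (triangle d)" "card (triangle d) = (d + 1) choose 2"
proof -
  have eq: "triangle d = (\<lambda>(k, i). (i, k)) ` (SIGMA k:{..<d}. {..k})"
    by (auto simp: triangle_def image_iff)
  show "finite (triangle d)" unfolding eq by simp
  have "card (triangle d) = card (SIGMA k:{..<d}. {..k})"
    unfolding eq by (rule card_image) (auto intro: inj_onI)
  also have "\<dots> = (\<Sum>k<d. Suc k)" by simp
  also have "\<dots> = (d + 1) choose 2"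
    by (induction d) (simp_all add: numeral_2_eq_2)
  finally show "card (triangle d) = (d + 1) choose 2" .
qed

definition on_triangle :: "nat \<Rightarrow> (nat \<times> nat \<Rightarrow> complex) \<Rightarrow> nat \<Rightarrow> nat \<Rightarrow> complex" where
  "on_triangle d T i k = (if (i, k) \<in> triangle d then T (i, k) else 0)"

lemma minor_eval_hom: "complex_algebra \<kappa> \<Longrightarrow> comm_ring_hom (minor_eval \<kappa> Y)"
  unfolding minor_eval_def by (rule complex_algebra.plucker_eval_hom)

text \<open>The substitution of upper triangular matrices involves only \<open>(d + 1) choose 2\<close> variables, so
  it makes any larger number of polynomials algebraically dependent: there are more monomials of
  bounded degree in the given polynomials than points in a grid on which their combination has to
  vanish.\<close>

lemma minor_eval_dependent:
  fixes f :: "nat \<Rightarrow> plucker_poly"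
  assumes m: "m = Suc ((d + 1) choose 2)"
  shows "\<exists>A c. finite A \<and> (\<forall>xs\<in>A. length xs = m) \<and> (\<exists>xs\<in>A. c xs \<noteq> 0) \<and>
    (\<forall>Y. (\<forall>i k. \<not> (i < d \<and> k < d) \<longrightarrow> Y i k = 0) \<longrightarrow>
      minor_eval const_poly Y (\<Sum>xs\<in>A. const_poly (c xs) * monomial_of f xs) = 0)"
proof -
  let ?n = "(d + 1) choose 2"
  \<comment> \<open>\<open>D\<close> bounds the degree of every \<open>f i\<close>, \<open>B\<close>
    the exponents, and \<open>e\<close> the degree of the combination along any line. There are
    \<open>(B + 1) ^ m\<close> unknown coefficients and \<open>(e + 1) ^ ?n\<close> grid points,
    where \<open>m = ?n + 1\<close>. Since \<open>e + 1 \<le> (m * D + 1) * (B + 1)\<close>, this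
    \<open>B\<close> makes the unknowns outnumber the conditions.\<close>
  define D where "D = (\<Sum>i<m. minor_degree (f i))"
  define B where "B = (m * D + 1) ^ ?n"
  define e where "e = m * B * D"
  let ?A = "{xs. set xs \<subseteq> {..B} \<and> length xs = m}"
  let ?T = "(of_nat :: nat \<Rightarrow> complex) ` {..e}"
  let ?G = "triangle d \<rightarrow>\<^sub>E ?T"
  let ?ev = "\<lambda>Y. minor_eval (\<lambda>c. c) Y :: plucker_poly \<Rightarrow> complex"
  have A: "finite ?A" "card ?A = (B + 1) ^ m"
    by (simp_all add: finite_lists_length_eq card_lists_length_eq)
  have G: "finite ?G" "card ?G = (e + 1) ^ ?n"
    using card_triangle[of d] card_of_nat_complex[of e] by (auto intro: finite_PiE simp: card_PiE)
  have "e + 1 \<le> (m * D + 1) * (B + 1)"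
    by (simp add: e_def algebra_simps)
  then have "(e + 1) ^ ?n \<le> B * (B + 1) ^ ?n"
    using power_mono[of "e + 1" "(m * D + 1) * (B + 1)" ?n] unfolding B_def[symmetric] power_mult_distrib by simp
  also have "\<dots> < (B + 1) ^ m"
    unfolding m by simp
  finally have "card ?G < card ?A" unfolding A(2) G(2) .
  then obtain c where c: "\<exists>xs\<in>?A. c xs \<noteq> 0"
    "\<forall>T\<in>?G. (\<Sum>xs\<in>?A. c xs * ?ev (on_triangle d T) (monomial_of f xs)) = 0"
    using homogeneous_system_nontrivial[OF G(1) A(1), of "\<lambda>xs T. ?ev (on_triangle d T) (monomial_of f xs)"]
    by blast
  define F where "F = (\<Sum>xs\<in>?A. const_poly (c xs) * monomial_of f xs)"
  have ev_mon: "?ev Y (monomial_of f xs) = monomial_of (\<lambda>i. ?ev Y (f i)) xs" for Y xs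
  proof -
    interpret h: comm_ring_hom "?ev Y" by (rule minor_eval_hom[OF complex_algebra_id])
    show ?thesis unfolding monomial_of_def by (simp add: h.hom_prod h.hom_power)
  qed
  have ev_F: "?ev Y F = (\<Sum>xs\<in>?A. c xs * ?ev Y (monomial_of f xs))" for Y
  proof -
    interpret h: comm_ring_hom "?ev Y" by (rule minor_eval_hom[OF complex_algebra_id])
    have "?ev Y (const_poly a) = a" for a
      by (simp add: minor_eval_def const_poly_def complex_algebra.plucker_eval_single[OF complex_algebra_id])
    then show ?thesis unfolding F_def by (simp add: h.hom_sum h.hom_mult)
  qed
  have line: "\<exists>q. degree q \<le> e \<and> (\<forall>t. poly q t = ?ev (\<lambda>i k. Y0 i k + t * Y1 i k) F)" for Y0 Y1
  proof -
    have "\<forall>i. \<exists>q. degree q \<le> minor_degree (f i) \<and> (\<forall>t. poly q t = ?ev (\<lambda>i k. Y0 i k + t * Y1 i k) (f i))"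
      using complex_algebra.minor_eval_line[OF complex_algebra_id] by blast
    then obtain q where q: "\<And>i. degree (q i) \<le> minor_degree (f i)"
      "\<And>i t. poly (q i) t = ?ev (\<lambda>i k. Y0 i k + t * Y1 i k) (f i)" by metis
    let ?q = "\<Sum>xs\<in>?A. [:c xs:] * monomial_of q xs"
    have "degree ([:c xs:] * monomial_of q xs) \<le> e" if xs: "xs \<in> ?A" for xs
    proof -
      have "degree ([:c xs:] * monomial_of q xs) \<le> degree (monomial_of q xs)"
        using degree_mult_le[of "[:c xs:]" "monomial_of q xs"] by simp
      also have "\<dots> \<le> (\<Sum>i<m. degree (q i ^ (xs ! i)))"
        unfolding monomial_of_def using xs degree_prod_sum_le[of "{..<m}" "\<lambda>i. q i ^ (xs ! i)"] by (simp add: o_def)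
      also have "\<dots> \<le> (\<Sum>i<m. D * B)"
      proof (rule sum_mono)
        fix i assume i: "i \<in> {..<m}"
        have "degree (q i) \<le> D"
          unfolding D_def using i member_le_sum[of i "{..<m}" "\<lambda>i. minor_degree (f i)"] q(1)[of i] by simp
        moreover have "xs ! i \<in> set xs" using xs i by (intro nth_mem) simp
        then have "xs ! i \<le> B" using xs by auto
        ultimately show "degree (q i ^ (xs ! i)) \<le> D * B"
          by (intro order.trans[OF degree_power_le] mult_mono) auto
      qed
      also have "\<dots> = e" by (simp add: e_def)
      finally show ?thesis .
    qed
    then have "degree ?q \<le> e" using A(1) by (intro degree_sum_le) auto
    moreover have "poly ?q t = ?ev (\<lambda>i k. Y0 i k + t * Y1 i k) F" for t
      unfolding ev_F ev_mon q(2)[symmetric] by (simp add: poly_sum monomial_of_def poly_prod)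
    ultimately show ?thesis by blast
  qed
  have on_tri: "?ev (on_triangle d T) F \<in> {0}" for T
  proof (rule complex_algebra.ideal_grid[OF complex_algebra_id ideal_set_singleton_0,
        of "triangle d" e "\<lambda>T. ?ev (on_triangle d T) F" ?T T])
    fix N and v :: "nat \<times> nat" assume v: "v \<in> triangle d"
    obtain q where q: "degree q \<le> e" "\<And>t. poly q t = ?ev (\<lambda>i k. on_triangle d (N(v := 0)) i k
        + t * (if (i, k) = v then 1 else 0)) F"
      using line[of "on_triangle d (N(v := 0))" "\<lambda>i k. if (i, k) = v then 1 else 0"] by blast
    moreover have "(\<lambda>i k. on_triangle d (N(v := 0)) i k + t * (if (i, k) = v then 1 else 0)) = on_triangle d (N(v := t))" for t
      using v by (auto simp: on_triangle_def fun_eq_iff)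
    ultimately show "\<exists>q. degree q \<le> e \<and> (\<forall>t. poly q t = ?ev (on_triangle d (N(v := t))) F)"
      by auto
  next
    fix N assume N: "\<forall>v\<in>triangle d. N v \<in> (\<lambda>c. c) ` ?T"
    have "on_triangle d N = on_triangle d (restrict N (triangle d))"
      by (auto simp: on_triangle_def fun_eq_iff)
    moreover have "restrict N (triangle d) \<in> ?G" using N by auto
    ultimately show "?ev (on_triangle d N) F \<in> {0}"
      using c(2) by (simp add: ev_F)
  qed (use card_of_nat_complex[of e] card_triangle(1) in auto)
  have "?ev Y F = 0" if Y: "\<And>i k. \<not> (i < d \<and> k < d) \<Longrightarrow> Y i k = 0" for Y
  proof (rule minor_eval_upper_triangular[OF _ Y])
    fix Y' :: "nat \<Rightarrow> nat \<Rightarrow> complex" assume "\<And>i k. \<not> (i \<le> k \<and> k < d) \<Longrightarrow> Y' i k = 0"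
    then have "Y' = on_triangle d (\<lambda>(i, k). Y' i k)"
      by (intro ext) (auto simp: on_triangle_def triangle_def)
    then show "?ev Y' F = 0" using on_tri by (metis singletonD)
  qed
  then have "minor_eval const_poly Y F = 0" if "\<forall>i k. \<not> (i < d \<and> k < d) \<longrightarrow> Y i k = 0" for Y
    using minor_eval_complex_imp[of d F Y] that by simp
  then show ?thesis
    using A(1) c(1) unfolding F_def by (intro exI[of _ ?A] exI[of _ c]) simp
qed

lemma irreducible_chain_length_le:
  assumes closed: "\<And>i. i \<le> k \<Longrightarrow> total_Gr_closed d (Z i)"
    and irred: "\<And>i. i \<le> k \<Longrightarrow> irreducible_subset (total_Gr d) (Z i)"
    and strict: "\<And>i. i < k \<Longrightarrow> Z i \<subset> Z (Suc i)"
  shows "k \<le> (d + 1) choose 2"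
proof (rule ccontr)
  assume "\<not> k \<le> (d + 1) choose 2"
  define m where "m = Suc ((d + 1) choose 2)"
  have mk: "m \<le> k" using \<open>\<not> _\<close> by (simp add: m_def)
  \<comment> \<open>The order is reversed, as ideals shrink when sets grow: \<open>P 0\<close>
    belongs to the largest of the sets \<open>Z 0, ..., Z m\<close>.\<close>
  define P where "P i = set_ideal d (Z (m - i))" for i
  have prime: "prime_set (P i)" for i
    unfolding P_def using mk by (intro prime_set_set_ideal irred) simp
  have sub: "P i \<subset> P (Suc i)" if "i < m" for i
  proof -
    have *: "m - i = Suc (m - Suc i)" "m - Suc i < k" using that mk by simp_all
    have "Z (m - Suc i) \<subset> Z (m - i)" unfolding *(1) by (rule strict[OF *(2)])
    then show ?thesis
      unfolding P_def using mk by (intro set_ideal_strict closed irred) simp_all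
  qed
  define f where "f i = (SOME g. g \<in> P (Suc i) \<and> g \<notin> P i)" for i
  have f: "f i \<in> P (Suc i) \<and> f i \<notin> P i" if "i < m" for i
  proof -
    have "\<exists>g. g \<in> P (Suc i) \<and> g \<notin> P i" using psubset_imp_ex_mem[OF sub[OF that]] by simp
    then show ?thesis unfolding f_def by (rule someI_ex)
  qed
  obtain A c where A: "finite A" "\<forall>xs\<in>A. length xs = m" "\<exists>xs\<in>A. c xs \<noteq> 0"
    and zero: "\<forall>Y. (\<forall>i k. \<not> (i < d \<and> k < d) \<longrightarrow> Y i k = 0) \<longrightarrow>
      minor_eval const_poly Y (\<Sum>xs\<in>A. const_poly (c xs) * monomial_of f xs) = 0"
    using minor_eval_dependent[OF m_def, of f] by (elim exE conjE)
  obtain ys where ys: "ys \<in> A" "c ys \<noteq> 0" using A(3) by blast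
  \<comment> \<open>The combination vanishes on all \<open>d\<close> by \<open>d\<close> matrices,
    in particular at every cone point, so it belongs to every cone ideal.\<close>
  have "(\<Sum>xs\<in>A. const_poly (c xs) * monomial_of f xs) \<in> P 0"
    unfolding P_def set_ideal_def
  proof (intro CollectI ballI, clarify)
    fix s Q assume "(s, Q) \<in> Z (m - 0)"
    then have Q: "Q \<in> Gr d s"
      using closed[OF mk] by (auto simp: total_Gr_closed_def total_Gr_points_def)
    have "0 \<in> Q"
      using ideal_0[OF prime_set_ideal[OF flag_scheme_prime_ext(1)[OF Q]]]
        mem_prime_ext[OF plucker_ring_0_closed] by blast
    moreover have "minor_eval const_poly (cone_point d J N) (\<Sum>xs\<in>A. const_poly (c xs) * monomial_of f xs) = 0" for J N
      by (rule zero[rule_format]) (simp only: cone_point_def combine_def if_False)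
    ultimately show "(\<Sum>xs\<in>A. const_poly (c xs) * monomial_of f xs) \<in> cone_ideal d s Q"
      unfolding cone_ideal_def by simp
  qed
  moreover have "(\<Sum>xs\<in>A. const_poly (c xs) * monomial_of f xs) \<notin> P 0"
  proof (rule prime_chain_independent[of m P f A ys c, OF prime _ _ _ A(1) A(2)[rule_format] ys])
    show "P i \<subseteq> P (Suc i)" if "i < m" for i using sub[OF that] by (rule psubset_imp_subset)
    show "f i \<in> P (Suc i)" if "i < m" for i using f[OF that] by (rule conjunct1)
    show "f i \<notin> P i" if "i < m" for i using f[OF that] by (rule conjunct2)
  qed
  ultimately show False by blast
qed

subsection \<open>Monomial primes\<close>

definition plucker_degree :: "plucker_poly \<Rightarrow> nat" where
  "plucker_degree f = (\<Sum>m\<in>Poly_Mapping.keys f. \<Sum>I\<in>Poly_Mapping.keys m. Poly_Mapping.lookup m I)"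

lemma (in complex_algebra) plucker_eval_update:
  "\<exists>q. degree q \<le> plucker_degree f \<and> (\<forall>t. poly q t = plucker_eval \<kappa> (x(I := t)) f)"
proof -
  let ?x = "\<lambda>J. if J = I then [:0, 1:] else [:x J:]"
  let ?q = "plucker_eval (\<lambda>c. [:\<kappa> c:]) ?x f"
  have "degree ([:\<kappa> (Poly_Mapping.lookup f m):] * mono_eval ?x m)
      \<le> (\<Sum>I\<in>Poly_Mapping.keys m. Poly_Mapping.lookup m I)" (is "degree (?c * ?m) \<le> ?s") for m
  proof -
    have "degree (?c * ?m) \<le> degree ?m"
      using degree_mult_le[of ?c ?m] by simp
    also have "\<dots> \<le> (\<Sum>J\<in>Poly_Mapping.keys m. degree (?x J ^ Poly_Mapping.lookup m J))"
      unfolding mono_eval_def using degree_prod_sum_le[of "Poly_Mapping.keys m"] by (simp add: o_def)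
    also have "\<dots> \<le> ?s"
    proof (rule sum_mono)
      fix J
      have "degree (?x J) * Poly_Mapping.lookup m J \<le> 1 * Poly_Mapping.lookup m J"
        by (intro mult_right_mono) (auto simp: degree_pCons_eq_if)
      then show "degree (?x J ^ Poly_Mapping.lookup m J) \<le> Poly_Mapping.lookup m J"
        using degree_power_le[of "?x J" "Poly_Mapping.lookup m J"] by linarith
    qed
    finally show ?thesis .
  qed
  moreover have "(\<Sum>I\<in>Poly_Mapping.keys m. Poly_Mapping.lookup m I) \<le> plucker_degree f"
    if "m \<in> Poly_Mapping.keys f" for m
    unfolding plucker_degree_def using that by (intro member_le_sum) auto
  ultimately have "degree ?q \<le> plucker_degree f"
    unfolding plucker_eval_def by (intro degree_sum_le) (auto intro: order.trans)
  moreover have "poly ?q t = plucker_eval \<kappa> (x(I := t)) f" for t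
  proof -
    have "poly ?q t = plucker_eval (\<lambda>c. poly [:\<kappa> c:] t) (\<lambda>J. poly (?x J) t) f"
      by (rule comm_ring_hom.hom_plucker_eval[OF comm_ring_hom_poly])
    moreover have "(\<lambda>J. poly (?x J) t) = x(I := t)" by auto
    ultimately show ?thesis by simp
  qed
  ultimately show ?thesis by blast
qed

lemma mono_eval_multiscale:
  assumes R: "finite R" and m: "Poly_Mapping.keys m \<subseteq> plucker_index d R"
  shows "mono_eval (\<lambda>I. c (length I) * x I) m = (\<Prod>k\<in>R. c k ^ multidegree m k) * mono_eval x m"
proof -
  let ?K = "Poly_Mapping.keys m"
  have "(\<Prod>I\<in>?K. c (length I) ^ Poly_Mapping.lookup m I)
      = (\<Prod>k\<in>R. \<Prod>I\<in>{I \<in> ?K. length I = k}. c (length I) ^ Poly_Mapping.lookup m I)"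
    using m R by (intro prod.group[symmetric]) (auto simp: plucker_index_def)
  also have "\<dots> = (\<Prod>k\<in>R. c k ^ multidegree m k)"
    unfolding multidegree_def by (intro prod.cong refl) (simp add: power_sum)
  finally show ?thesis
    by (simp add: mono_eval_def power_mult_distrib prod.distrib)
qed

text \<open>The Pluecker vector of a flag is determined only up to one scalar for each rank, whence
  a separate \<open>c k\<close> per rank.\<close>

lemma plucker_eval_multiscale:
  assumes "finite R" "mhomog d R a g"
  shows "plucker_eval \<kappa> (\<lambda>I. c (length I) * x I) g = (\<Prod>k\<in>R. c k ^ a k) * plucker_eval \<kappa> x g"
  unfolding plucker_eval_def sum_distrib_left
proof (intro sum.cong refl)
  fix m assume "m \<in> Poly_Mapping.keys g"
  then have "Poly_Mapping.keys m \<subseteq> plucker_index d R" "multidegree m = a"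
    using assms(2) by (auto simp: mhomog_def mem_plucker_ring)
  then show "\<kappa> (Poly_Mapping.lookup g m) * mono_eval (\<lambda>I. c (length I) * x I) m
      = (\<Prod>k\<in>R. c k ^ a k) * (\<kappa> (Poly_Mapping.lookup g m) * mono_eval x m)"
    using mono_eval_multiscale[OF assms(1), of m d c x] by simp
qed

definition kill_vars :: "nat list set \<Rightarrow> plucker_poly \<Rightarrow> plucker_poly" where
  "kill_vars V = plucker_eval const_poly (\<lambda>I. if I \<in> V then plucker_var I else 0)"

lemma kill_vars_hom: "comm_ring_hom (kill_vars V)"
  unfolding kill_vars_def by (rule const_poly.plucker_eval_hom)

lemma kill_vars_var [simp]: "kill_vars V (plucker_var I) = (if I \<in> V then plucker_var I else 0)"
  by (simp add: kill_vars_def)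

lemma kill_vars_subset:
  assumes "V \<subseteq> W"
  shows "kill_vars V (kill_vars W f) = kill_vars V f"
proof -
  interpret h: comm_ring_hom "kill_vars V" by (rule kill_vars_hom)
  have "kill_vars V (const_poly c) = const_poly c" for c
    by (simp add: kill_vars_def const_poly_def[of c])
  then have "kill_vars V (kill_vars W f)
      = plucker_eval const_poly (\<lambda>I. kill_vars V (if I \<in> W then plucker_var I else 0)) f"
    unfolding kill_vars_def[of W] h.hom_plucker_eval by simp
  moreover have "(\<lambda>I. kill_vars V (if I \<in> W then plucker_var I else 0)) = (\<lambda>I. if I \<in> V then plucker_var I else 0)"
    using assms by (auto simp: fun_eq_iff)
  ultimately show ?thesis by (simp add: kill_vars_def[of V])
qed

text \<open>The monomials supported in \<open>V\<close> form a basis of the residue ring, so this prime is the generic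
  point of a coordinate subspace.\<close>

definition mono_prime :: "nat \<Rightarrow> nat set \<Rightarrow> nat list set \<Rightarrow> plucker_poly set" where
  "mono_prime d R V = {f \<in> carrier (plucker_ring d R). kill_vars V f = 0}"

lemma mono_prime_antimono: "V \<subseteq> W \<Longrightarrow> mono_prime d R W \<subseteq> mono_prime d R V"
proof
  fix f assume V: "V \<subseteq> W" and f: "f \<in> mono_prime d R W"
  interpret h: comm_ring_hom "kill_vars V" by (rule kill_vars_hom)
  have "kill_vars V f = kill_vars V 0"
    using kill_vars_subset[OF V, of f] f by (simp add: mono_prime_def)
  then show "f \<in> mono_prime d R V" using f by (simp add: mono_prime_def)
qed

lemma forget_mono_prime:
  assumes R: "r \<in> R" and V: "V \<inter> plucker_index d {r} = W \<inter> plucker_index d {r}"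
  shows "forget d {r} (mono_prime d R V) = mono_prime d {r} W"
proof -
  have "plucker_index d {r} \<subseteq> plucker_index d R"
    using R by (auto simp: plucker_index_def)
  then have "f \<in> carrier (plucker_ring d R)" if "f \<in> carrier (plucker_ring d {r})" for f
    using that unfolding mem_plucker_ring by blast
  moreover have "kill_vars V f = kill_vars W f" if "f \<in> carrier (plucker_ring d {r})" for f
    unfolding kill_vars_def by (rule plucker_eval_cong[OF that]) (use V in auto)
  ultimately show ?thesis
    unfolding forget_def mono_prime_def by auto
qed

text \<open>The hypothesis speaks only of the torus of the coordinate subspace, so the interpolation
  nodes must be nonzero; this is why the grid starts at 1.\<close>

lemma vanishing_imp_kill_vars_eq_0:
  assumes V: "finite V"
    and zero: "\<And>x. (\<forall>I\<in>V. x I \<noteq> 0) \<Longrightarrow> plucker_eval (\<lambda>c. c) (\<lambda>I. if I \<in> V then x I else 0) g = 0"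
  shows "kill_vars V g = 0"
proof -
  let ?e = "plucker_degree g"
  let ?T = "(of_nat :: nat \<Rightarrow> complex) ` {1..Suc ?e}"
  have T: "finite ?T" "card ?T = Suc ?e"
    by (simp_all add: card_image)
  have "plucker_eval const_poly (\<lambda>I. if I \<in> V then plucker_var I else 0) g \<in> {0}"
  proof (rule const_poly.ideal_grid[OF ideal_set_singleton_0, of V ?e "\<lambda>x. plucker_eval const_poly x g" ?T "\<lambda>_. 0"])
    show "\<exists>q. degree q \<le> ?e \<and> (\<forall>t. poly q t = plucker_eval const_poly (N(v := t)) g)" for N v
      by (rule const_poly.plucker_eval_update)
  next
    fix N assume N: "\<forall>I\<in>V. N I \<in> const_poly ` ?T" "\<forall>I. I \<notin> V \<longrightarrow> N I = 0"
    define c where "c I = (SOME z. z \<noteq> 0 \<and> N I = const_poly z)" for I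
    have c: "c I \<noteq> 0 \<and> N I = const_poly (c I)" if I: "I \<in> V" for I
    proof -
      obtain z where z: "z \<in> ?T" "N I = const_poly z"
        by (rule imageE[OF N(1)[rule_format, OF I]])
      moreover have "z \<noteq> 0" using z(1) by auto
      ultimately have "\<exists>z. z \<noteq> 0 \<and> N I = const_poly z" by blast
      then show ?thesis unfolding c_def by (rule someI_ex)
    qed
    have "N = (\<lambda>I. const_poly (if I \<in> V then c I else 0))"
    proof
      fix I
      show "N I = const_poly (if I \<in> V then c I else 0)"
        using c[of I] N(2) by (cases "I \<in> V") simp_all
    qed
    then have "plucker_eval const_poly N g = const_poly (plucker_eval (\<lambda>c. c) (\<lambda>I. if I \<in> V then c I else 0) g)"
      by (simp only: const_poly.hom_plucker_eval)
    also have "plucker_eval (\<lambda>c. c) (\<lambda>I. if I \<in> V then c I else 0) g = 0"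
      using c by (intro zero) blast
    finally show "plucker_eval const_poly N g \<in> {0}" by simp
  qed (use T V in auto)
  then show ?thesis by (simp add: kill_vars_def)
qed

text \<open>If the torus consists of Pluecker vectors of flags, up to a scalar per rank, then the
  components of an element of the flag ideal vanish on the torus and hence on the coordinate
  subspace. Testing only the torus permits division by coordinates when a flag has to be
  constructed.\<close>

lemma flag_ideal_subset_mono_prime:
  assumes R: "finite R" and V: "finite V"
    and pts: "\<And>x. (\<forall>I\<in>V. x I \<noteq> 0) \<Longrightarrow> \<exists>M\<in>quotient_flags d R. \<exists>c. \<forall>I\<in>plucker_index d R.
      (if I \<in> V then x I else 0) = c (length I) * plucker_coord M I"
  shows "flag_ideal d R \<subseteq> mono_prime d R V"
proof
  fix f assume f: "f \<in> flag_ideal d R"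
  then have fc: "f \<in> carrier (plucker_ring d R)" using flag_ideal_carrier by blast
  have comp: "kill_vars V (component a f) = 0" for a
  proof (rule vanishing_imp_kill_vars_eq_0[OF V])
    fix x :: "nat list \<Rightarrow> complex" assume "\<forall>I\<in>V. x I \<noteq> 0"
    then obtain M c where M: "M \<in> quotient_flags d R"
      "\<And>I. I \<in> plucker_index d R \<Longrightarrow> (if I \<in> V then x I else 0) = c (length I) * plucker_coord M I"
      using pts by blast
    have h: "mhomog d R a (component a f)" by (rule mhomog_component[OF fc])
    have "plucker_eval (\<lambda>c. c) (\<lambda>I. if I \<in> V then x I else 0) (component a f)
        = plucker_eval (\<lambda>c. c) (\<lambda>I. c (length I) * plucker_coord M I) (component a f)"
      by (rule plucker_eval_cong[OF mhomog_carrier[OF h] M(2)])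
    also have "\<dots> = (\<Prod>k\<in>R. c k ^ a k) * plucker_eval (\<lambda>c. c) (plucker_coord M) (component a f)"
      by (rule plucker_eval_multiscale[OF R h])
    also have "plucker_eval (\<lambda>c. c) (plucker_coord M) (component a f) = 0"
      using f M(1) by (simp add: flag_ideal_def eval_plucker_eq)
    finally show "plucker_eval (\<lambda>c. c) (\<lambda>I. if I \<in> V then x I else 0) (component a f) = 0" by simp
  qed
  interpret h: comm_ring_hom "kill_vars V" by (rule kill_vars_hom)
  have "kill_vars V f = kill_vars V (\<Sum>a\<in>multidegree ` Poly_Mapping.keys f. component a f)"
    using sum_components[of f] by simp
  also have "\<dots> = 0" by (simp add: h.hom_sum comp)
  finally show "f \<in> mono_prime d R V" using fc by (simp add: mono_prime_def)
qed

lemma plucker_var_neq_0: "plucker_var I \<noteq> 0"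
  by (metis lookup_single_eq lookup_zero plucker_var_def zero_neq_one)

lemma plucker_var_in_mono_prime:
  "I \<in> plucker_index d R \<Longrightarrow> plucker_var I \<in> mono_prime d R V \<longleftrightarrow> I \<notin> V"
  by (simp add: mono_prime_def plucker_var_in_carrier plucker_var_neq_0)

lemma lookup_kill_vars:
  assumes "f \<in> carrier (plucker_ring d R)"
  shows "Poly_Mapping.lookup (kill_vars V f) m
    = (if Poly_Mapping.keys m \<subseteq> V then Poly_Mapping.lookup f m else 0)"
proof -
  have mono: "mono_eval (\<lambda>I. if I \<in> V then plucker_var I else 0) m'
      = (if Poly_Mapping.keys m' \<subseteq> V then Poly_Mapping.single m' 1 else 0)" for m'
  proof (cases "Poly_Mapping.keys m' \<subseteq> V")
    case True
    then have "mono_eval (\<lambda>I. if I \<in> V then plucker_var I else 0) m' = Poly_Mapping.single m' 1"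
      by (intro mono_eval_plucker_var) auto
    with True show ?thesis by simp
  next
    case False
    then obtain I where I: "I \<in> Poly_Mapping.keys m'" "I \<notin> V" by blast
    have pow: "(if I \<in> V then plucker_var I else 0) ^ Poly_Mapping.lookup m' I = 0"
      using I in_keys_iff[of I m'] by (simp only: if_False) (simp add: zero_power)
    then have "mono_eval (\<lambda>I. if I \<in> V then plucker_var I else 0) m' = 0"
      unfolding mono_eval_def by (intro prod_zero finite_keys) (rule bexI[of _ I], rule pow, rule I(1))
    with False show ?thesis by simp
  qed
  have "Poly_Mapping.lookup (kill_vars V f) m = (\<Sum>m'\<in>Poly_Mapping.keys f.
      if m' = m then (if Poly_Mapping.keys m' \<subseteq> V then Poly_Mapping.lookup f m' else 0) else 0)"
    unfolding kill_vars_def plucker_eval_def mono lookup_sum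
    by (rule sum.cong[OF refl]) (simp add: const_poly_def mult_single lookup_single when_def)
  also have "\<dots> = (if m \<in> Poly_Mapping.keys f then
      (if Poly_Mapping.keys m \<subseteq> V then Poly_Mapping.lookup f m else 0) else 0)"
    by (rule sum.delta) simp
  finally show ?thesis using in_keys_iff[of m f] by simp
qed

text \<open>The set is the kernel of an endomorphism of a polynomial ring, and values in a domain
  make it prime. A variable of \<open>V\<close> in each rank keeps it away from the irrelevant
  ideals.\<close>

lemma mono_prime_flag_scheme:
  assumes flag: "flag_ideal d R \<subseteq> mono_prime d R V"
    and V: "\<And>k. k \<in> R \<Longrightarrow> \<exists>I\<in>V. I \<in> plucker_index d {k}"
  shows "mono_prime d R V \<in> flag_scheme d R"
proof -
  interpret h: comm_ring_hom "kill_vars V" by (rule kill_vars_hom)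
  interpret R: cring "plucker_ring d R" by (rule cring_plucker_ring)
  have ops: "x \<otimes>\<^bsub>plucker_ring d R\<^esub> y = x * y" "x \<oplus>\<^bsub>plucker_ring d R\<^esub> y = x + y"
    "\<zero>\<^bsub>plucker_ring d R\<^esub> = 0" "\<one>\<^bsub>plucker_ring d R\<^esub> = 1" for x y
    by (simp_all add: plucker_ring_def)
  have carrier: "kill_vars V f \<in> carrier (plucker_ring d R)" if f: "f \<in> carrier (plucker_ring d R)" for f
  proof -
    have "kill_vars V f = plucker_eval const_poly (\<lambda>I. if I \<in> V \<inter> plucker_index d R then plucker_var I else 0) f"
      unfolding kill_vars_def by (rule plucker_eval_cong[OF f]) auto
    then show ?thesis
      by (auto intro!: plucker_eval_in_carrier plucker_var_in_carrier plucker_ring_0_closed)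
  qed
  have "kill_vars V \<in> Ring.ring_hom (plucker_ring d R) (plucker_ring d R)"
    by (rule ring_hom_memI) (simp_all add: ops carrier h.hom_add h.hom_mult)
  then interpret hom: ring_hom_ring "plucker_ring d R" "plucker_ring d R" "kill_vars V"
    by (intro ring_hom_ringI2 R.ring_axioms)
  have "a_kernel (plucker_ring d R) (plucker_ring d R) (kill_vars V) = mono_prime d R V"
    unfolding a_kernel_def' ops mono_prime_def ..
  then have ideal: "ideal (mono_prime d R V) (plucker_ring d R)"
    using hom.kernel_is_ideal by simp
  have prime: "primeideal (mono_prime d R V) (plucker_ring d R)"
  proof (rule primeidealI[OF ideal R.cring_axioms])
    have "1 \<notin> mono_prime d R V" by (simp add: mono_prime_def)
    then show "carrier (plucker_ring d R) \<noteq> mono_prime d R V"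
      using plucker_ring_1_closed by blast
  next
    fix f g assume fg: "f \<in> carrier (plucker_ring d R)" "g \<in> carrier (plucker_ring d R)"
      "f \<otimes>\<^bsub>plucker_ring d R\<^esub> g \<in> mono_prime d R V"
    then have "kill_vars V f * kill_vars V g = 0"
      by (simp add: ops mono_prime_def h.hom_mult)
    then show "f \<in> mono_prime d R V \<or> g \<in> mono_prime d R V"
      using fg by (simp add: mono_prime_def)
  qed
  have comp: "component a f \<in> mono_prime d R V" if f: "f \<in> mono_prime d R V" for f a
  proof -
    have fc: "f \<in> carrier (plucker_ring d R)" and f0: "kill_vars V f = 0"
      using f by (auto simp: mono_prime_def)
    note cc = mhomog_carrier[OF mhomog_component[OF fc]]
    have "kill_vars V (component a f) = 0"
    proof (rule poly_mapping_eqI)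
      fix m
      show "Poly_Mapping.lookup (kill_vars V (component a f)) m = Poly_Mapping.lookup 0 m"
        using lookup_kill_vars[OF fc, of V m] f0
        by (simp add: lookup_kill_vars[OF cc] lookup_component split: if_splits)
    qed
    with cc show ?thesis by (simp add: mono_prime_def)
  qed
  have "\<not> plucker_var ` plucker_index d {k} \<subseteq> mono_prime d R V" if k: "k \<in> R" for k
  proof -
    obtain I where I: "I \<in> V" "I \<in> plucker_index d {k}" using V[OF k] by blast
    then have "I \<in> plucker_index d R" using k by (auto simp: plucker_index_def)
    then have "plucker_var I \<notin> mono_prime d R V"
      using plucker_var_in_mono_prime I(1) by blast
    then show ?thesis using I(2) by blast
  qed
  then show ?thesis
    unfolding flag_scheme_def using prime comp flag by simp
qed

subsection \<open>Coordinate subspaces of hyperplanes in a coordinate space\<close>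

definition omit :: "nat \<Rightarrow> nat \<Rightarrow> nat list" where
  "omit t i = sorted_list_of_set ({..t} - {i})"

text \<open>For \<open>j \<le> t\<close>, the last \<open>j + 1\<close> of the \<open>t + 1\<close>
  Pluecker coordinates of rank \<open>t\<close> quotients of the coordinate space. Writing
  \<open>t \<le> i + j\<close> avoids truncated subtraction, and \<open>omit t t\<close> always
  belongs.\<close>

definition omit_set :: "nat \<Rightarrow> nat \<Rightarrow> nat list set" where
  "omit_set t j = {omit t i | i. i \<le> t \<and> t \<le> i + j}"

lemma omit_props:
  "sorted_wrt (<) (omit t i)" "set (omit t i) = {..t} - {i}" "i \<le> t \<Longrightarrow> length (omit t i) = t"
  by (simp_all add: omit_def)

lemma omit_inject: "i \<le> t \<Longrightarrow> i' \<le> t \<Longrightarrow> omit t i = omit t i' \<longleftrightarrow> i = i'"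
  using omit_props(2)[of t i] omit_props(2)[of t i'] by (metis Diff_iff atMost_iff insertI1 singletonD)

lemma omit_in_index:
  assumes "i \<le> t" "t < d"
  shows "omit t i \<in> plucker_index d {t}"
proof -
  have "set (omit t i) \<subseteq> {..<d}" unfolding omit_props(2) using assms(2) by auto
  then show ?thesis
    unfolding plucker_index_def using omit_props(1)[of t i] omit_props(3)[OF assms(1)] by simp
qed

lemma omit_last: "omit t t = [0..<t]"
proof -
  have "{..t} - {t} = {0..<t}" by auto
  then show ?thesis by (simp add: omit_def)
qed

lemma omit_in_index_last: "t \<le> d \<Longrightarrow> omit t t \<in> plucker_index d {t}"
  by (auto simp: omit_last plucker_index_def)

lemma plucker_index_atMost:
  assumes I: "I \<in> plucker_index d {t}" and sub: "set I \<subseteq> {..t}"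
  obtains i where "i \<le> t" "I = omit t i"
proof -
  have I': "sorted_wrt (<) I" "length I = t" using I by (auto simp: plucker_index_def)
  then have "card (set I) = t" using strict_sorted_iff[of I] distinct_card[of I] by simp
  then have "card ({..t} - set I) = 1"
    using card_Diff_subset[of "set I" "{..t}"] sub by simp
  then obtain i where i: "{..t} - set I = {i}" using card_1_singletonE by blast
  then have "set I = {..t} - {i}" "i \<le> t" using sub by auto
  moreover have "I = sorted_list_of_set (set I)"
    using I'(1) strict_sorted_iff[of I] sorted_list_of_set_unique[of "set I" I] distinct_card[of I] by simp
  ultimately show ?thesis using that[of i] by (simp add: omit_def)
qed

lemma minor_zero_column:
  assumes j: "j < length I" and zero: "\<And>i. i < length I \<Longrightarrow> Y i (I ! j) = 0"
  shows "minor Y I = 0"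
  unfolding minor_def using j zero by (subst laplace_expansion_column[of _ "length I" j]) auto

lemma minor_identity:
  assumes "\<And>i k. i < t \<Longrightarrow> k < t \<Longrightarrow> Y i k = (if i = k then 1 else 0)"
  shows "minor Y [0..<t] = 1"
proof -
  have "minor_mat Y [0..<t] = 1\<^sub>m t"
    by (rule eq_matI) (auto simp: assms)
  then show ?thesis unfolding minor_def by simp
qed

text \<open>The row space of \<open>(1 | b)\<close> is a hyperplane of \<open>\<complex>\<^sup>t\<^sup>+\<^sup>1\<close>; its Pluecker coordinates are, up to
  sign, the entries of \<open>b\<close> and \<open>1\<close>.\<close>

lemma minor_hyperplane:
  fixes b :: "nat \<Rightarrow> complex"
  assumes Y: "\<And>i k. i < t \<Longrightarrow> k \<le> t \<Longrightarrow> Y i k = (if i = k then 1 else if k = t then b i else 0)"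
    and i: "i < t"
  shows "col_sign ([0..<t][i := t]) * minor Y (omit t i) = b i"
proof -
  let ?L = "[0..<t][i := t]"
  \<comment> \<open>Cramer's rule for the columns \<open>[0..<t]\<close> and the new column
    \<open>t\<close>: the block is the identity, so only the summand \<open>l = i\<close>
    survives.\<close>
  have "(\<Sum>l<length [0..<t]. Y i ([0..<t] ! l) * minor Y ([0..<t][l := t])) = minor Y [0..<t] * Y i t"
    by (rule cramer_rule) (use i in simp)
  moreover have "minor Y [0..<t] = 1"
    by (rule minor_identity) (simp add: Y)
  moreover have "(\<Sum>l<length [0..<t]. Y i ([0..<t] ! l) * minor Y ([0..<t][l := t]))
      = (\<Sum>l<t. if l = i then minor Y ([0..<t][l := t]) else 0)"
    using i by (intro sum.cong) (auto simp: Y)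
  ultimately have "minor Y ?L = b i"
    using i by (simp add: Y)
  moreover have "sort ?L = omit t i"
  proof -
    have "distinct ?L" by (simp add: distinct_list_update)
    moreover have "set ?L = {..t} - {i}"
      using i by (subst set_update_distinct) auto
    ultimately show ?thesis
      unfolding omit_def by (metis distinct_remdups_id sorted_list_of_set_sort_remdups)
  qed
  ultimately show ?thesis using minor_sort[of Y ?L] by simp
qed

text \<open>For \<open>b\<close> constantly 1 the sign times a minor equals 1, which settles the
  matter without computing the sign.\<close>

lemma col_sign_hyperplane:
  assumes "i < t"
  shows "col_sign ([0..<t][i := t]) \<noteq> 0"
proof -
  let ?Y = "\<lambda>i k. if i = k then 1 else if k = t then 1 else 0"
  have "col_sign ([0..<t][i := t]) * minor ?Y (omit t i) = 1"
    by (rule minor_hyperplane[where b = "\<lambda>_. 1", OF _ assms]) simp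
  then show ?thesis by auto
qed

lemma quotient_mat_padded:
  assumes "s \<le> d" "M \<in> carrier_mat s d" "\<And>i k. i < s \<Longrightarrow> k < s \<Longrightarrow> M $$ (i, k) = (if i = k then 1 else 0)"
  shows "quotient_mat d s M"
  unfolding quotient_mat_def
proof (intro conjI ballI assms(2))
  fix y :: "complex vec" assume y: "y \<in> carrier_vec s"
  let ?x = "vec d (\<lambda>k. if k < s then y $ k else 0)"
  have "M *\<^sub>v ?x = y"
  proof (rule eq_vecI)
    fix i assume "i < dim_vec y"
    then have i: "i < s" using y by simp
    have "(M *\<^sub>v ?x) $ i = (\<Sum>k<d. M $$ (i, k) * (if k < s then y $ k else 0))"
      using i assms(2) by (auto simp: scalar_prod_def lessThan_atLeast0 intro!: sum.cong)
    also have "\<dots> = (\<Sum>k<d. if k = i then y $ k else 0)"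
      using i assms(3) by (intro sum.cong) auto
    also have "\<dots> = y $ i" using i assms(1) by simp
    finally show "(M *\<^sub>v ?x) $ i = y $ i" .
  qed (use y assms(2) in auto)
  then show "\<exists>x\<in>carrier_vec d. M *\<^sub>v x = y" by (intro bexI[of _ ?x]) auto
qed

text \<open>At rank \<open>Suc t\<close> this is the fixed projection onto the first
  \<open>Suc t\<close> coordinates; as \<open>b\<close> varies, rank \<open>t\<close> runs through
  an affine chart of the projective space of its rank \<open>t\<close> quotients.\<close>

definition hyperplane_flag :: "nat \<Rightarrow> nat \<Rightarrow> (nat \<Rightarrow> complex) \<Rightarrow> nat \<Rightarrow> complex mat" where
  "hyperplane_flag d t b s =
     mat s d (\<lambda>(i, k). if i = k then 1 else if s = t \<and> k = t then b i else 0)"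

lemma hyperplane_flag_in_quotient_flags:
  assumes t: "t < d"
  shows "hyperplane_flag d t b \<in> quotient_flags d {t, Suc t}"
proof -
  let ?M = "hyperplane_flag d t b"
  have q: "quotient_mat d s (?M s)" if "s \<in> {t, Suc t}" for s
    using that t by (intro quotient_mat_padded) (auto simp: hyperplane_flag_def)
  have id: "\<exists>A\<in>carrier_mat s s. ?M s = A * ?M s" for s
    by (intro bexI[of _ "1\<^sub>m s"]) (auto simp: hyperplane_flag_def)
  \<comment> \<open>The rank \<open>t\<close> matrix without its zero columns beyond
    \<open>t\<close>.\<close>
  let ?A = "mat t (Suc t) (\<lambda>(i, k). if i = k then 1 else if k = t then b i else 0)"
  have "?M t = ?A * ?M (Suc t)"
  proof (rule eq_matI)
    fix i k assume "i < dim_row (?A * ?M (Suc t))" "k < dim_col (?A * ?M (Suc t))"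
    then have ik: "i < t" "k < d" by (simp_all add: hyperplane_flag_def)
    have "(?A * ?M (Suc t)) $$ (i, k)
        = (\<Sum>l<Suc t. (if i = l then 1 else if l = t then b i else 0) * (if l = k then 1 else 0))"
      using ik by (auto simp: hyperplane_flag_def scalar_prod_def lessThan_atLeast0 intro!: sum.cong)
    also have "\<dots> = (\<Sum>l<Suc t. if l = k then (if i = l then 1 else if l = t then b i else 0) else 0)"
      by (intro sum.cong) auto
    also have "\<dots> = ?M t $$ (i, k)"
      using ik by (auto simp: hyperplane_flag_def)
    finally show "?M t $$ (i, k) = (?A * ?M (Suc t)) $$ (i, k)" by simp
  qed (simp_all add: hyperplane_flag_def)
  then have step: "\<exists>A\<in>carrier_mat t (Suc t). ?M t = A * ?M (Suc t)"
    by (intro bexI[of _ ?A]) simp_all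
  have "\<exists>A\<in>carrier_mat k l. ?M k = A * ?M l" if "k \<in> {t, Suc t}" "l \<in> {t, Suc t}" "k \<le> l" for k l
    using that id step by (cases "k = l") auto
  then show ?thesis unfolding quotient_flags_def using q by blast
qed

text \<open>The single coordinate of the fixed quotient of rank \<open>t + 1\<close> and all
  coordinates of its rank \<open>t\<close> quotients: the corresponding prime is the generic point
  of a fibre of the flag variety over the larger Grassmannian.\<close>

abbreviation flag_vars :: "nat \<Rightarrow> nat list set" where
  "flag_vars t \<equiv> insert (omit (Suc t) (Suc t)) (omit_set t t)"

lemma omit_set_self: "omit_set t t = omit t ` {..t}"
  by (auto simp: omit_set_def)

lemma set_flag_vars: "I \<in> flag_vars t \<Longrightarrow> set I \<subseteq> {..t}"
  by (auto simp: omit_set_self omit_props(2))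

lemma flag_ideal_subset_flag_vars:
  assumes t: "t < d"
  shows "flag_ideal d {t, Suc t} \<subseteq> mono_prime d {t, Suc t} (flag_vars t)"
proof (rule flag_ideal_subset_mono_prime)
  show "finite (flag_vars t)" by (simp add: omit_set_self)
  fix x :: "nat list \<Rightarrow> complex" assume x: "\<forall>I\<in>flag_vars t. x I \<noteq> 0"
  have xt: "x (omit t i) \<noteq> 0" if "i \<le> t" for i
    using x that by (auto simp: omit_set_self)
  \<comment> \<open>Since the minor of \<open>(1 | b)\<close> at \<open>omit t t\<close> is 1, the
    coordinates are divided by \<open>x (omit t t)\<close>, which is nonzero on the torus. The sign
    is included to cancel the one in \<open>minor_hyperplane\<close>.\<close>
  define b where "b i = col_sign ([0..<t][i := t]) * x (omit t i) / x (omit t t)" for i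
  define c where "c s = (if s = t then x (omit t t) else x (omit (Suc t) (Suc t)))" for s
  let ?M = "hyperplane_flag d t b"
  have "(if I \<in> flag_vars t then x I else 0) = c (length I) * plucker_coord ?M I"
    if I: "I \<in> plucker_index d {t, Suc t}" for I
  proof -
    have Id: "set I \<subseteq> {..<d}" "sorted_wrt (<) I" "length I \<in> {t, Suc t}"
      using I by (auto simp: plucker_index_def)
    have nth_d: "I ! j < d" if "j < length I" for j
      using Id(1) nth_mem[OF that] by blast
    have coord: "plucker_coord ?M I = minor (flag_entry ?M (length I)) I"
      by (rule plucker_coord_minor[OF _ Id(1)]) (simp add: hyperplane_flag_def)
    have entry: "flag_entry ?M s i k = (if i = k then 1 else if s = t \<and> k = t then b i else 0)"
      if "i < s" "k < d" for s i k
      using that by (simp add: flag_entry_def hyperplane_flag_def)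
    consider "length I = t" "set I \<subseteq> {..t}" | "length I = t" "\<not> set I \<subseteq> {..t}"
      | "length I = Suc t" "set I \<subseteq> {..t}" | "length I = Suc t" "\<not> set I \<subseteq> {..t}"
      using Id(3) by blast
    then show ?thesis
    proof cases
      case 1
      then have "I \<in> plucker_index d {t}" using Id by (simp add: plucker_index_def)
      then obtain i where i: "i \<le> t" "I = omit t i" using plucker_index_atMost 1(2) by blast
      have "x I = x (omit t t) * minor (flag_entry ?M t) I"
      proof (cases "i = t")
        case True
        have "minor (flag_entry ?M t) I = 1"
          unfolding i(2) True omit_last by (rule minor_identity) (use t in \<open>simp add: entry\<close>)
        then show ?thesis using i True by simp
      next
        case False
        then have it: "i < t" using i by simp
        have "col_sign ([0..<t][i := t]) * minor (flag_entry ?M t) I = b i"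
          unfolding i(2) by (rule minor_hyperplane[OF _ it]) (use t in \<open>simp add: entry\<close>)
        then have "col_sign ([0..<t][i := t]) * minor (flag_entry ?M t) I
            = col_sign ([0..<t][i := t]) * (x (omit t i) / x (omit t t))"
          by (simp only: b_def times_divide_eq_right)
        then have "minor (flag_entry ?M t) I = x (omit t i) / x (omit t t)"
          by (simp only: mult_left_cancel[OF col_sign_hyperplane[OF it]])
        then show ?thesis using xt[of t] i by simp
      qed
      then show ?thesis using 1(1) i coord by (simp add: c_def omit_set_self)
    next
      case 2
      \<comment> \<open>Columns beyond \<open>t\<close> are zero, so coordinates that use one of
        them vanish.\<close>
      then obtain k where k: "k \<in> set I" "t < k" by (meson atMost_iff not_le subsetI)
      then obtain j where j: "j < t" "I ! j = k" using 2(1) by (auto simp: in_set_conv_nth)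
      have "minor (flag_entry ?M t) I = 0"
        by (rule minor_zero_column[of j]) (use 2(1) j k nth_d[of j] in \<open>auto simp: entry\<close>)
      moreover have "I \<notin> flag_vars t"
        using 2(2) set_flag_vars by blast
      ultimately show ?thesis using 2(1) coord by simp
    next
      case 3
      then have "I = omit (Suc t) (Suc t)"
      proof -
        have "I \<in> plucker_index d {Suc t}" using Id 3 by (simp add: plucker_index_def)
        moreover have "set I \<subseteq> {..Suc t}" using 3(2) by auto
        ultimately obtain i where i: "i \<le> Suc t" "I = omit (Suc t) i" using plucker_index_atMost by blast
        have "Suc t \<notin> set I" using 3(2) by auto
        then have "i = Suc t" unfolding i(2) omit_props(2) by auto
        then show ?thesis using i by simp
      qed
      moreover have "minor (flag_entry ?M (Suc t)) [0..<Suc t] = 1"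
        by (rule minor_identity) (use t in \<open>simp add: entry\<close>)
      ultimately show ?thesis
        using 3(1) coord by (simp add: c_def omit_last)
    next
      case 4
      then obtain k where k: "k \<in> set I" "t < k" by (meson atMost_iff not_le subsetI)
      then obtain j where j: "j < Suc t" "I ! j = k" using 4(1) by (auto simp: in_set_conv_nth)
      have "minor (flag_entry ?M (Suc t)) I = 0"
        by (rule minor_zero_column[of j]) (use 4(1) j k nth_d[of j] in \<open>auto simp: entry\<close>)
      moreover have "I \<notin> flag_vars t"
        using 4(2) set_flag_vars by blast
      ultimately show ?thesis using 4(1) coord by simp
    qed
  qed
  then show "\<exists>M\<in>quotient_flags d {t, Suc t}. \<exists>c. \<forall>I\<in>plucker_index d {t, Suc t}.
      (if I \<in> flag_vars t then x I else 0) = c (length I) * plucker_coord M I"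
    using hyperplane_flag_in_quotient_flags[OF t, of b] by blast
qed simp

subsection \<open>A maximal chain\<close>

text \<open>All lower ranks are included completely, so transfer to a lower rank imposes no
  condition. These sets separate consecutive points of the chain.\<close>

lemma total_Gr_closed_above:
  assumes P: "P \<subseteq> carrier (plucker_ring d {t})" and comp: "\<And>f a. f \<in> P \<Longrightarrow> component a f \<in> P"
  shows "total_Gr_closed d {(r, Q) \<in> total_Gr_points d. r < t \<or> (r = t \<and> P \<subseteq> Q)}" (is "total_Gr_closed d ?Z")
  unfolding total_Gr_closed_def
proof (intro conjI allI impI)
  show "?Z \<subseteq> total_Gr_points d" by auto
next
  fix r assume r: "r \<le> d"
  consider "r < t" | "r = t" | "r > t" by linarith
  then show "zariski_closed d {r} (stratum ?Z r)"
  proof cases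
    case 1
    then have "stratum ?Z r = {Q \<in> Gr d r. {} \<subseteq> Q}"
      using r by (auto simp: stratum_def total_Gr_points_def)
    then show ?thesis
      unfolding zariski_closed_def by (intro exI[of _ "{}"]) simp
  next
    case 2
    let ?S = "{component a f | a f. f \<in> P}"
    have hom: "mhomog d {t} a (component a f)" if "f \<in> P" for a f
      using mhomog_component P that by blast
    have eqv: "P \<subseteq> Q \<longleftrightarrow> ?S \<subseteq> Q" if "Q \<in> Gr d t" for Q
    proof
      assume S: "?S \<subseteq> Q"
      show "P \<subseteq> Q"
      proof
        fix f assume f: "f \<in> P"
        then have "\<forall>a. component a f \<in> Q" using S by blast
        then show "f \<in> Q" using flag_scheme_mem_components[OF that, of f] f P by blast
      qed
    qed (use comp in blast)
    have "stratum ?Z r = {Q \<in> Gr d r. P \<subseteq> Q}"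
      using r 2 by (auto simp: stratum_def total_Gr_points_def)
    also have "\<dots> = {Q \<in> Gr d r. ?S \<subseteq> Q}"
      unfolding 2 by (intro Collect_cong conj_cong refl eqv)
    finally have "stratum ?Z r = {Q \<in> Gr d r. ?S \<subseteq> Q}" .
    moreover have "?S \<subseteq> carrier (plucker_ring d {r})"
      using mhomog_carrier[OF hom] 2 by auto
    moreover have "\<forall>f\<in>?S. multihomogeneous f"
      using mhomog_imp_multihomogeneous[OF hom] by auto
    ultimately show ?thesis
      unfolding zariski_closed_def by (intro exI[of _ ?S] conjI)
  next
    case 3
    then have "stratum ?Z r = {}" by (auto simp: stratum_def)
    then show ?thesis by (simp add: zariski_closed_empty)
  qed
next
  fix s r assume sr: "s \<le> d" "r \<le> s"
  show "lower_transfer d r s (stratum ?Z s) \<subseteq> stratum ?Z r"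
  proof
    fix Q assume "Q \<in> lower_transfer d r s (stratum ?Z s)"
    then obtain F where F: "F \<in> Fl d r s" "Q = forget d {r} F" "forget d {s} F \<in> stratum ?Z s"
      by (auto simp: lower_transfer_def)
    show "Q \<in> stratum ?Z r"
    proof (cases "r = s")
      case True
      then show ?thesis using F by simp
    next
      case False
      then have "r < t" using F(3) sr by (auto simp: stratum_def)
      moreover have "Q \<in> Gr d r" unfolding F(2) by (rule forget_in_Gr[OF F(1)]) simp
      ultimately show ?thesis using sr by (simp add: stratum_def total_Gr_points_def)
    qed
  qed
qed

definition chain_point :: "nat \<Rightarrow> nat \<Rightarrow> nat \<Rightarrow> nat \<times> plucker_poly set" where
  "chain_point d t j = (t, mono_prime d {t} (omit_set t j))"

lemma omit_set_0: "omit_set t 0 = {omit t t}"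
  by (auto simp: omit_set_def)

lemma omit_set_mono: "i \<le> j \<Longrightarrow> omit_set t i \<subseteq> omit_set t j"
  by (auto simp: omit_set_def)

lemma omit_self_in_omit_set: "omit t t \<in> omit_set t j"
  by (auto simp: omit_set_def)

lemma flag_vars_prime:
  assumes t: "t < d"
  shows "mono_prime d {t, Suc t} (flag_vars t) \<in> Fl d t (Suc t)"
proof (rule mono_prime_flag_scheme[OF flag_ideal_subset_flag_vars[OF t]])
  fix k assume "k \<in> {t, Suc t}"
  then consider "k = t" | "k = Suc t" by blast
  then show "\<exists>I\<in>flag_vars t. I \<in> plucker_index d {k}"
  proof cases
    case 1
    then show ?thesis
      using omit_in_index_last[of t d] omit_self_in_omit_set[of t t] t by (intro bexI[of _ "omit t t"]) auto
  next
    case 2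
    then show ?thesis
      using omit_in_index_last[of "Suc t" d] t by (intro bexI[of _ "omit (Suc t) (Suc t)"]) auto
  qed
qed

text \<open>One flag prime lies over both points: it witnesses that the last point of rank
  \<open>t\<close> belongs to every closed set containing the first point of rank
  \<open>t + 1\<close>.\<close>

lemma forget_flag_vars_prime:
  "forget d {t} (mono_prime d {t, Suc t} (flag_vars t)) = mono_prime d {t} (omit_set t t)"
  "forget d {Suc t} (mono_prime d {t, Suc t} (flag_vars t)) = mono_prime d {Suc t} (omit_set (Suc t) 0)"
  by (rule forget_mono_prime; auto simp: omit_set_self omit_set_0 plucker_index_def omit_props)+

text \<open>The case \<open>d = 0\<close> stands apart, since for \<open>d > 0\<close> the point of
  rank \<open>d\<close> is obtained by contraction from flags of ranks \<open>d - 1\<close> and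
  \<open>d\<close>.\<close>

lemma flag_ideal_rank_0: "flag_ideal 0 {0} \<subseteq> mono_prime 0 {0} {[]}"
proof (rule flag_ideal_subset_mono_prime)
  fix x :: "nat list \<Rightarrow> complex"
  let ?M = "\<lambda>_ :: nat. mat 0 0 (\<lambda>_. 0) :: complex mat"
  have "quotient_mat 0 0 (?M 0)"
    by (rule quotient_mat_padded) simp_all
  moreover have "?M 0 = ?M 0 * ?M 0"
    by (rule eq_matI) simp_all
  then have "\<exists>A\<in>carrier_mat 0 0. ?M 0 = A * ?M 0"
    by (rule bexI) simp
  ultimately have "?M \<in> quotient_flags 0 {0}"
    by (simp add: quotient_flags_def)
  moreover have "mat_of_cols 0 [] \<in> (carrier_mat 0 0 :: complex mat set)"
    using mat_of_cols_carrier(1)[of 0 "[] :: complex vec list"] unfolding list.size .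
  then have "plucker_coord ?M [] = 1" by (simp add: plucker_coord_def)
  then have "\<forall>I\<in>plucker_index 0 {0}. (if I \<in> {[]} then x I else 0) = x [] * plucker_coord ?M I"
    by (auto simp: plucker_index_def)
  ultimately show "\<exists>M\<in>quotient_flags 0 {0}. \<exists>c. \<forall>I\<in>plucker_index 0 {0}.
      (if I \<in> {[]} then x I else 0) = c (length I) * plucker_coord M I"
    by (intro bexI[of _ ?M] exI[of _ "\<lambda>_. x []"])
qed simp_all

lemma chain_point_in:
  assumes "t < d \<or> t = d \<and> j = 0"
  shows "mono_prime d {t} (omit_set t j) \<in> Gr d t"
proof (cases "t < d")
  case True
  have "mono_prime d {t} (omit_set t t) \<in> Gr d t"
    using forget_in_Gr[OF flag_vars_prime[OF True], of t] forget_flag_vars_prime(1) by simp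
  then have "flag_ideal d {t} \<subseteq> mono_prime d {t} (omit_set t t)"
    by (simp add: flag_scheme_def)
  \<comment> \<open>Fewer surviving variables give a larger prime, so coordinate subspaces inherit
    the relations.\<close>
  also have "\<dots> \<subseteq> mono_prime d {t} (omit_set t j)"
    by (intro mono_prime_antimono) (auto simp: omit_set_def)
  finally have *: "flag_ideal d {t} \<subseteq> mono_prime d {t} (omit_set t j)" .
  show ?thesis
    by (rule mono_prime_flag_scheme[OF *])
      (use omit_in_index_last[of t d] omit_self_in_omit_set[of t j] True in auto)
next
  case False
  then have t: "t = d" "j = 0" using assms by auto
  show ?thesis
  proof (cases d)
    case 0
    have "[] \<in> plucker_index 0 {0}" by (simp add: plucker_index_def)
    then have "mono_prime 0 {0} {[]} \<in> Gr 0 0"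
      by (intro mono_prime_flag_scheme[OF flag_ideal_rank_0]) auto
    then show ?thesis using t 0 by (simp add: omit_set_0 omit_last)
  next
    case (Suc s)
    then show ?thesis
      using forget_in_Gr[OF flag_vars_prime[of s d], of "Suc s"] forget_flag_vars_prime(2)[of d s] t by simp
  qed
qed

lemma chain_point_in_total:
  assumes "t < d \<or> t = d \<and> j = 0"
  shows "chain_point d t j \<in> total_Gr_points d"
  using chain_point_in[OF assms] assms by (auto simp: chain_point_def total_Gr_points_def)

section \<open>Chains of closures of points\<close>

definition irreducible_chain :: "'a topology \<Rightarrow> nat \<Rightarrow> (nat \<Rightarrow> 'a set) \<Rightarrow> bool" where
  "irreducible_chain X k Z \<longleftrightarrow>
     (\<forall>i\<le>k. closedin X (Z i) \<and> irreducible_subset X (Z i)) \<and> (\<forall>i<k. Z i \<subset> Z (Suc i))"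

lemma irreducible_closure_of:
  assumes "x \<in> topspace X"
  shows "irreducible_subset X (X closure_of {x})"
  unfolding irreducible_subset_def
proof (intro conjI allI impI)
  have x: "x \<in> X closure_of {x}" using closure_of_subset[of "{x}" X] assms by simp
  show "X closure_of {x} \<noteq> {}" using x by blast
  show "X closure_of {x} \<subseteq> topspace X" by (rule closure_of_subset_topspace)
  fix A B assume AB: "closedin X A" "closedin X B" "X closure_of {x} \<subseteq> A \<union> B"
  then have "x \<in> A \<or> x \<in> B" using x by blast
  then show "X closure_of {x} \<subseteq> A \<or> X closure_of {x} \<subseteq> B"
    using closure_of_minimal[of "{x}" A X] closure_of_minimal[of "{x}" B X] AB(1,2) by auto
qed

text \<open>By \<open>spec\<close> the point \<open>x\<close> is a specialization of
  \<open>y\<close>, which gives the inclusion of closures; a closed set containing only the former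
  makes it strict.\<close>

lemma irreducible_chain_extend:
  assumes Z: "irreducible_chain X k Z" "Z k = X closure_of {x}"
    and y: "y \<in> topspace X" and spec: "\<And>A. closedin X A \<Longrightarrow> y \<in> A \<Longrightarrow> x \<in> A"
    and A: "closedin X A" "x \<in> A" "y \<notin> A"
  shows "\<exists>Z. irreducible_chain X (Suc k) Z \<and> Z (Suc k) = X closure_of {y}"
proof -
  have yc: "y \<in> X closure_of {y}" using closure_of_subset[of "{y}" X] y by simp
  have "X closure_of {x} \<subseteq> X closure_of {y}"
    by (rule closure_of_minimal) (use spec[OF closedin_closure_of yc] in auto)
  moreover have "X closure_of {x} \<subseteq> A"
    by (rule closure_of_minimal) (use A in auto)
  ultimately have strict: "Z k \<subset> X closure_of {y}"
    using yc A(3) unfolding Z(2) by blast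
  let ?Z = "Z(Suc k := X closure_of {y})"
  have "irreducible_chain X (Suc k) ?Z"
    unfolding irreducible_chain_def
  proof (intro conjI allI impI)
    fix i assume i: "i \<le> Suc k"
    show "closedin X (?Z i)" "irreducible_subset X (?Z i)"
      using i Z(1) irreducible_closure_of[OF y] unfolding irreducible_chain_def
      by (cases "i = Suc k"; simp)+
  next
    fix i assume i: "i < Suc k"
    show "?Z i \<subset> ?Z (Suc i)"
      using i Z(1) strict unfolding irreducible_chain_def by (cases "i = k") simp_all
  qed
  then show ?thesis by (intro exI[of _ ?Z]) simp
qed

lemma component_mono_prime:
  "mono_prime d {t} V \<in> Gr d t \<Longrightarrow> f \<in> mono_prime d {t} V \<Longrightarrow> component a f \<in> mono_prime d {t} V"
  by (rule flag_scheme_component)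

lemma mono_prime_carrier: "mono_prime d R V \<subseteq> carrier (plucker_ring d R)"
  by (auto simp: mono_prime_def)

lemma chain_step_within_rank:
  assumes t: "t < d" and j: "Suc j \<le> t"
    and Z: "irreducible_chain (total_Gr d) k Z" "Z k = total_Gr d closure_of {chain_point d t j}"
  shows "\<exists>Z. irreducible_chain (total_Gr d) (Suc k) Z \<and>
    Z (Suc k) = total_Gr d closure_of {chain_point d t (Suc j)}"
proof (rule irreducible_chain_extend[OF Z])
  let ?P = "mono_prime d {t} (omit_set t j)" and ?P' = "mono_prime d {t} (omit_set t (Suc j))"
  have P: "?P \<in> Gr d t" "?P' \<in> Gr d t" using t by (simp_all add: chain_point_in)
  have sub: "?P' \<subseteq> ?P" by (intro mono_prime_antimono omit_set_mono) simp
  show "chain_point d t (Suc j) \<in> topspace (total_Gr d)"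
    unfolding topspace_total_Gr by (rule chain_point_in_total) (use t in simp)
  show "chain_point d t j \<in> A" if A: "closedin (total_Gr d) A" "chain_point d t (Suc j) \<in> A" for A
  proof -
    have "zariski_closed d {t} (stratum A t)"
      using A(1) t unfolding closedin_total_Gr total_Gr_closed_def by simp
    then obtain S where S: "stratum A t = {Q \<in> Gr d t. S \<subseteq> Q}"
      unfolding zariski_closed_def by blast
    have "?P' \<in> stratum A t" using A(2) by (simp add: stratum_def chain_point_def)
    then have "?P \<in> stratum A t" using S P sub by blast
    then show ?thesis by (simp add: stratum_def chain_point_def)
  qed
  let ?A = "{(r, Q) \<in> total_Gr_points d. r < t \<or> (r = t \<and> ?P \<subseteq> Q)}"
  show "closedin (total_Gr d) ?A"
    unfolding closedin_total_Gr
    by (rule total_Gr_closed_above[OF mono_prime_carrier component_mono_prime[OF P(1)]])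
  show "chain_point d t j \<in> ?A"
    using chain_point_in_total[of t d j] t by (simp add: chain_point_def)
  \<comment> \<open>The coordinate that enters in passing from \<open>j\<close> to
    \<open>Suc j\<close>; its variable lies in \<open>?P\<close> but not in
    \<open>?P'\<close>.\<close>
  let ?I = "omit t (t - Suc j)"
  have I: "?I \<in> plucker_index d {t}" by (rule omit_in_index) (use t in auto)
  have "?I \<in> omit_set t (Suc j)"
    using j by (auto simp: omit_set_def)
  moreover have "?I \<notin> omit_set t j"
  proof
    assume "?I \<in> omit_set t j"
    then obtain i where "i \<le> t" "t \<le> i + j" "?I = omit t i" by (auto simp: omit_set_def)
    then show False using omit_inject[of "t - Suc j" t i] j by simp
  qed
  ultimately have "plucker_var ?I \<in> ?P" "plucker_var ?I \<notin> ?P'"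
    using plucker_var_in_mono_prime[OF I] by simp_all
  then have "\<not> ?P \<subseteq> ?P'" by blast
  then show "chain_point d t (Suc j) \<notin> ?A" by (simp add: chain_point_def)
qed

lemma chain_step_next_rank:
  assumes t: "t < d"
    and Z: "irreducible_chain (total_Gr d) k Z" "Z k = total_Gr d closure_of {chain_point d t t}"
  shows "\<exists>Z. irreducible_chain (total_Gr d) (Suc k) Z \<and>
    Z (Suc k) = total_Gr d closure_of {chain_point d (Suc t) 0}"
proof (rule irreducible_chain_extend[OF Z])
  have P: "mono_prime d {t} (omit_set t t) \<in> Gr d t" by (rule chain_point_in) (use t in simp)
  show "chain_point d (Suc t) 0 \<in> topspace (total_Gr d)"
    unfolding topspace_total_Gr by (rule chain_point_in_total) (use t in auto)
  show "chain_point d t t \<in> A" if A: "closedin (total_Gr d) A" "chain_point d (Suc t) 0 \<in> A" for A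
  proof -
    let ?F = "mono_prime d {t, Suc t} (flag_vars t)"
    have "forget d {Suc t} ?F \<in> stratum A (Suc t)"
      using A(2) by (simp add: forget_flag_vars_prime(2) stratum_def chain_point_def)
    then have "forget d {t} ?F \<in> lower_transfer d t (Suc t) (stratum A (Suc t))"
      unfolding lower_transfer_def using flag_vars_prime[OF t] by blast
    moreover have "lower_transfer d t (Suc t) (stratum A (Suc t)) \<subseteq> stratum A t"
      using A(1) t unfolding closedin_total_Gr total_Gr_closed_def by simp
    ultimately show ?thesis
      by (auto simp: forget_flag_vars_prime(1) stratum_def chain_point_def)
  qed
  \<comment> \<open>With no equations this is the union of all strata of rank at most
    \<open>t\<close>.\<close>
  let ?A = "{(r, Q) \<in> total_Gr_points d. r < t \<or> (r = t \<and> {} \<subseteq> Q)}"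
  show "closedin (total_Gr d) ?A"
    unfolding closedin_total_Gr by (rule total_Gr_closed_above) auto
  show "chain_point d t t \<in> ?A"
    using P t by (simp add: chain_point_def total_Gr_points_def)
  show "chain_point d (Suc t) 0 \<notin> ?A" by (simp add: chain_point_def)
qed

text \<open>Rank \<open>t\<close> accounts for \<open>t\<close> steps inside the rank and one step
  into rank \<open>t + 1\<close>, that is \<open>t + 1\<close> in total; adding these up gives the
  triangular number.\<close>

lemma irreducible_chain_exists:
  "t \<le> d \<Longrightarrow> \<exists>Z. irreducible_chain (total_Gr d) ((t + 1) choose 2) Z \<and>
    Z ((t + 1) choose 2) = total_Gr d closure_of {chain_point d t 0}"
proof (induction t)
  case 0
  have "chain_point d 0 0 \<in> topspace (total_Gr d)"
    unfolding topspace_total_Gr by (rule chain_point_in_total) auto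
  then show ?case
    by (intro exI[of _ "\<lambda>_. total_Gr d closure_of {chain_point d 0 0}"])
      (simp add: irreducible_chain_def irreducible_closure_of numeral_2_eq_2)
next
  case (Suc t)
  let ?n = "(t + 1) choose 2"
  have t: "t < d" using Suc.prems by simp
  have "j \<le> t \<Longrightarrow> \<exists>Z. irreducible_chain (total_Gr d) (?n + j) Z \<and>
    Z (?n + j) = total_Gr d closure_of {chain_point d t j}" for j
  proof (induction j)
    case 0
    then show ?case using Suc.IH t by simp
  next
    case (Suc j)
    then obtain Z where "irreducible_chain (total_Gr d) (?n + j) Z"
      "Z (?n + j) = total_Gr d closure_of {chain_point d t j}" by auto
    from chain_step_within_rank[OF t Suc.prems this] show ?case by simp
  qed
  then obtain Z where "irreducible_chain (total_Gr d) (?n + t) Z"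
    "Z (?n + t) = total_Gr d closure_of {chain_point d t t}" by blast
  moreover have "Suc (?n + t) = (Suc t + 1) choose 2"
    by (simp add: numeral_2_eq_2)
  ultimately show ?case
    using chain_step_next_rank[OF t] by metis
qed

theorem theorem1p2:
  fixes d :: nat
  shows "krull_dim (total_Gr d) = enat ((d + 1) choose 2)"
proof (rule antisym)
  show "krull_dim (total_Gr d) \<le> enat ((d + 1) choose 2)"
    unfolding krull_dim_def
  proof (rule Sup_least, clarify)
    fix k and Z :: "nat \<Rightarrow> (nat \<times> plucker_poly set) set"
    assume "\<forall>i\<le>k. closedin (total_Gr d) (Z i) \<and> irreducible_subset (total_Gr d) (Z i)"
      and "\<forall>i<k. Z i \<subset> Z (Suc i)"
    then have "k \<le> (d + 1) choose 2"
      by (intro irreducible_chain_length_le[of k d Z]) (simp_all add: closedin_total_Gr)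
    then show "enat k \<le> enat ((d + 1) choose 2)" by simp
  qed
next
  obtain Z where "irreducible_chain (total_Gr d) ((d + 1) choose 2) Z"
    using irreducible_chain_exists[of d d] by blast
  then show "enat ((d + 1) choose 2) \<le> krull_dim (total_Gr d)"
    unfolding krull_dim_def irreducible_chain_def by (intro Sup_upper) blast
qed

end
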